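(* Let $k$ be a field of odd characteristic $p$, and let $k(t)$ be the field of rational functions in one variable $t$ over $k$. Let $f\colon Y=\mathbb P^1_{k(t)}\to X=\mathbb P^1_{k(t)}$ be the map of curves over $k(t)$ given in the affine coordinate $y$ on the source by $y\mapsto \frac{t-y^p}{y}$, let $d$ be its degree, and let $df$ be the section of $\mathcal V=\operatorname{Hom}(f^*T^\vee X,T^\vee Y)$ given by pullback of differentials. Then there is a relative orientation of $\mathcal V$ such that, in $\operatorname{GW}(k(t))$, $$\operatorname{ind}_{(y^p-t)}df=\left(\tfrac{p-1}{2}\right)\cdot h+\langle 1\rangle,\qquad \operatorname{ind}_{\infty}df=\left(\tfrac{p-3}{2}\right)\cdot h+\langle -1\rangle,$$ where $(y^p-t)$ denotes the closed point of $Y$ defined by that ideal and $\infty$ is the point $y=\infty$. In particular, the enriched Riemann--Hurwitz formula $$\chi^{\mathbb A^1}(Y)=d\cdot \chi^{\mathbb A^1}(X)-\sum_{\{q\in Y:\ df(q)=0\}}\operatorname{ind}_q df$$ holds in $\operatorname{GW}(k(t))$.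
   Context: Write $L=k(t)$ for the base field. $\operatorname{GW}(L)$ is the Grothendieck--Witt group: the group completion of the semiring (under $\oplus,\otimes$) of isomorphism classes of nondegenerate symmetric $L$-bilinear forms on finite-dimensional $L$-vector spaces. For $a\in L^*$, $\langle a\rangle$ is the class of $L\times L\to L$, $(x,y)\mapsto axy$, and $h=\langle 1\rangle+\langle -1\rangle$. For a smooth proper geometrically connected curve $C$ over $L$ of genus $g(C)$, $\chi^{\mathbb A^1}(C)=(1-g(C))\cdot h\in\operatorname{GW}(L)$. $T$ and $T^\vee$ denote tangent and cotangent bundles. A relative orientation of a line bundle $\mathcal V$ on a smooth curve $Y$ over $L$ is a line bundle $N$ on $Y$ together with an isomorphism $\operatorname{Hom}(TY,\mathcal V)\cong N^{\otimes 2}$. Nisnevich coordinates around a closed point $q\in Y$ are a Zariski open neighborhood $U$ of $q$ and an étale map $\phi\colon U\to\mathbb A^1_L=\operatorname{Spec}L[s]$ inducing an isomorphism of residue fields $L(\phi(q))\to L(q)$; they exist around every closed point. Local index. Let $\sigma$ be a section of a relatively oriented line bundle $\mathcal V$ with an isolated zero at $q$, vanishing to order $n$ there. Choose Nisnevich coordinates $\phi$ around $q$; they trivialize $TY|_U$ by the vector field $\partial$ dual to $d(\phi^*s)$. After shrinking $U$, choose a trivialization of $\mathcal V|_U$, i.e. a generator $v$, compatible with the relative orientation: the homomorphism $TY|_U\to\mathcal V|_U$, $\partial\mapsto v$, corresponds to $\ell\otimes\ell$ for some $\ell\in N(U)$. Then $\sigma$ becomes a function $\sigma_0\in\mathcal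 O_{Y,q}$. With $m_q$ the maximal ideal of $\mathcal O_{Y,q}$, choose $g\in m_q^{N_0}$ with $N_0$ sufficiently large (e.g. $N_0\ge 2n$) such that $\sigma_0+g=\phi^*F$ for some $F\in R:=\mathcal O_{\mathbb A^1_L,\phi(q)}$. Put $Q=R/(F)$, a finite-dimensional $L$-algebra. Choose $a\in R\otimes_L R$ with $F\otimes 1-1\otimes F=a\,(s\otimes 1-1\otimes s)$ and let $\Delta$ be the image of $a$ in $Q\otimes_LQ$. Under the map $Q\otimes_LQ\to\operatorname{Hom}_L(\operatorname{Hom}_L(Q,L),Q)$, $b\otimes c\mapsto(\mu\mapsto\mu(b)c)$, $\Delta$ goes to an isomorphism $\Theta$. Let $\eta=\Theta^{-1}(1)$. Then $\operatorname{ind}_q\sigma\in\operatorname{GW}(L)$ is the class of the form $Q\times Q\to L$, $(b,c)\mapsto\eta(bc)$ (it does not depend on the choices). *)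

theory Defs
  imports
    "HOL-Computational_Algebra.Computational_Algebra"
    "Jordan_Normal_Form.Matrix"
begin

section \<open>The Grothendieck--Witt group\<close>

subsection \<open>Nondegenerate symmetric bilinear forms\<close>

text \<open>A finite-dimensional \<open>L\<close>-vector space with basis is some \<open>L\<^sup>n\<close>, so forms are given by their Gram
  matrices, and isomorphic forms are those whose Gram matrices are congruent.  Only the additive
  structure of \<open>GW(L)\<close> is set up.\<close>

typedef (overloaded) 'l symform = "{A :: 'l::field mat. invertible_mat A \<and> transpose_mat A = A}"
  morphisms gram_matrix Symform
proof
  have "inverts_mat (1\<^sub>m 0 :: 'l mat) (1\<^sub>m 0)" by (simp add: inverts_mat_def)
  then show "(1\<^sub>m 0 :: 'l mat) \<in> {A. invertible_mat A \<and> transpose_mat A = A}"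
    by (auto simp: invertible_mat_def)
qed

setup_lifting type_definition_symform

definition isometric_mat :: "'l::field mat \<Rightarrow> 'l mat \<Rightarrow> bool" where
  "isometric_mat A B \<longleftrightarrow> (\<exists>P. invertible_mat P \<and> dim_row P = dim_row A \<and> dim_row B = dim_row A \<and>
      B = transpose_mat P * A * P)"

definition diag_sum :: "'l::field mat \<Rightarrow> 'l mat \<Rightarrow> 'l mat" where
  "diag_sum A B = four_block_mat A (0\<^sub>m (dim_row A) (dim_col B)) (0\<^sub>m (dim_row B) (dim_col A)) B"

lemma invertible_matI:
  assumes "P \<in> carrier_mat n n" "Q \<in> carrier_mat n n" "P * Q = 1\<^sub>m n" "Q * P = 1\<^sub>m n"
  shows "invertible_mat P"
  using assms by (auto simp: invertible_mat_def inverts_mat_def)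

lemma invertible_matE:
  assumes "invertible_mat P" "dim_row P = n"
  obtains Q where "P \<in> carrier_mat n n" "Q \<in> carrier_mat n n" "P * Q = 1\<^sub>m n" "Q * P = 1\<^sub>m n"
proof -
  from assms obtain Q where Q: "square_mat P" "P * Q = 1\<^sub>m (dim_row P)" "Q * P = 1\<^sub>m (dim_row Q)"
    by (auto simp: invertible_mat_def inverts_mat_def)
  have P: "P \<in> carrier_mat n n" using Q(1) assms(2) by auto
  have "dim_col (P * Q) = n" using Q(2) assms(2) by simp
  then have "dim_col Q = n" by simp
  moreover have "dim_col (Q * P) = dim_row Q" using Q(3) by simp
  then have "dim_row Q = n" using P by simp
  ultimately show thesis using that[of Q] P Q assms(2) by auto
qed

lemma invertible_mat_mult:
  assumes "invertible_mat P" "invertible_mat Q" "dim_row P = n" "dim_row Q = n"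
  shows "invertible_mat (P * Q :: 'l::field mat)"
proof -
  from assms obtain P' where P: "P \<in> carrier_mat n n" "P' \<in> carrier_mat n n" "P * P' = 1\<^sub>m n" "P' * P = 1\<^sub>m n"
    by (elim invertible_matE)
  from assms obtain Q' where Q: "Q \<in> carrier_mat n n" "Q' \<in> carrier_mat n n" "Q * Q' = 1\<^sub>m n" "Q' * Q = 1\<^sub>m n"
    by (elim invertible_matE)
  show ?thesis
  proof (rule invertible_matI)
    show "P * Q \<in> carrier_mat n n" "Q' * P' \<in> carrier_mat n n" using P Q by auto
    have "P * Q * (Q' * P') = P * ((Q * Q') * P')"
      using P(1,2) Q(1,2) by (simp add: assoc_mult_mat[of _ n n _ n _ n])
    then show "P * Q * (Q' * P') = 1\<^sub>m n" using P Q by simp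
    have "Q' * P' * (P * Q) = Q' * ((P' * P) * Q)"
      using P(1,2) Q(1,2) by (simp add: assoc_mult_mat[of _ n n _ n _ n])
    then show "Q' * P' * (P * Q) = 1\<^sub>m n" using P Q by simp
  qed
qed

lemma isometric_mat_refl:
  assumes "A \<in> carrier_mat n n" shows "isometric_mat A (A :: 'l::field mat)"
proof -
  have "invertible_mat (1\<^sub>m n :: 'l mat)" by (rule invertible_matI[of _ n "1\<^sub>m n"]) auto
  with assms show ?thesis by (auto simp: isometric_mat_def intro!: exI[of _ "1\<^sub>m n"])
qed

lemma isometric_mat_sym:
  assumes "A \<in> carrier_mat n n" "isometric_mat A B" shows "isometric_mat B (A :: 'l::field mat)"
proof -
  from assms obtain P where P: "invertible_mat P" "dim_row P = n" and dB: "dim_row B = n"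
    and B: "B = transpose_mat P * A * P" by (auto simp: isometric_mat_def)
  from P obtain Q where Q: "P \<in> carrier_mat n n" "Q \<in> carrier_mat n n" "P * Q = 1\<^sub>m n" "Q * P = 1\<^sub>m n"
    by (elim invertible_matE)
  have "transpose_mat Q * transpose_mat P = 1\<^sub>m n"
    using transpose_mult[OF Q(1,2)] Q(3) by simp
  moreover have "transpose_mat Q * B * Q = (transpose_mat Q * transpose_mat P) * A * (P * Q)"
    using Q(1,2) assms(1) by (simp add: B assoc_mult_mat[of _ n n _ n _ n])
  ultimately have "A = transpose_mat Q * B * Q" using assms(1) Q by simp
  moreover have "invertible_mat Q" using Q by (intro invertible_matI[of Q n P]) auto
  ultimately show ?thesis using Q dB assms(1) unfolding isometric_mat_def
    by (intro exI[of _ Q]) auto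
qed

lemma isometric_mat_trans:
  assumes "A \<in> carrier_mat n n" "isometric_mat A B" "isometric_mat B C"
  shows "isometric_mat A (C :: 'l::field mat)"
proof -
  from assms obtain P where P: "invertible_mat P" "dim_row P = n" and dB: "dim_row B = n"
    and B: "B = transpose_mat P * A * P" by (auto simp: isometric_mat_def)
  from assms dB obtain Q where Q: "invertible_mat Q" "dim_row Q = n" and dC: "dim_row C = n"
    and C: "C = transpose_mat Q * B * Q" by (auto simp: isometric_mat_def)
  have PQ: "P \<in> carrier_mat n n" "Q \<in> carrier_mat n n"
    using P Q by (auto simp: invertible_mat_def)
  have "C = transpose_mat (P * Q) * A * (P * Q)"
    using PQ assms(1) by (simp add: B C transpose_mult[OF PQ] assoc_mult_mat[of _ n n _ n _ n])
  moreover have "invertible_mat (P * Q)" using P Q by (intro invertible_mat_mult) auto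
  ultimately show ?thesis using PQ dC assms(1) unfolding isometric_mat_def
    by (intro exI[of _ "P * Q"]) auto
qed

lemma diag_sum_mult:
  assumes "A \<in> carrier_mat n n" "B \<in> carrier_mat n n" "C \<in> carrier_mat m m" "D \<in> carrier_mat m m"
  shows "diag_sum A C * diag_sum B D = diag_sum (A * B) (C * D :: 'l::field mat)"
  using assms unfolding diag_sum_def
  by (subst mult_four_block_mat[of _ n n _ m _ m _ _ n _ m]) simp_all

lemma diag_sum_transpose:
  assumes "A \<in> carrier_mat n n" "B \<in> carrier_mat m m"
  shows "transpose_mat (diag_sum A B) = diag_sum (transpose_mat A) (transpose_mat B :: 'l::field mat)"
  using assms unfolding diag_sum_def
  by (subst transpose_four_block_mat[of _ n n _ m _ m]) auto

lemma diag_sum_carrier: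
  "A \<in> carrier_mat n n \<Longrightarrow> B \<in> carrier_mat m m \<Longrightarrow> diag_sum A B \<in> carrier_mat (n + m) (n + m)"
  by (auto simp: diag_sum_def)

lemma diag_sum_invertible:
  assumes "invertible_mat A" "invertible_mat B"
  shows "invertible_mat (diag_sum A (B :: 'l::field mat))"
proof -
  let ?n = "dim_row A" and ?m = "dim_row B"
  from assms obtain A' where A: "A \<in> carrier_mat ?n ?n" "A' \<in> carrier_mat ?n ?n"
    "A * A' = 1\<^sub>m ?n" "A' * A = 1\<^sub>m ?n" by (elim invertible_matE[OF _ refl])
  from assms obtain B' where B: "B \<in> carrier_mat ?m ?m" "B' \<in> carrier_mat ?m ?m"
    "B * B' = 1\<^sub>m ?m" "B' * B = 1\<^sub>m ?m" by (elim invertible_matE[OF _ refl])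
  have one: "diag_sum (1\<^sub>m ?n) (1\<^sub>m ?m) = (1\<^sub>m (?n + ?m) :: 'l mat)" by (simp add: diag_sum_def)
  show ?thesis
  proof (rule invertible_matI)
    show "diag_sum A B \<in> carrier_mat (?n + ?m) (?n + ?m)" by (rule diag_sum_carrier[OF A(1) B(1)])
    show "diag_sum A' B' \<in> carrier_mat (?n + ?m) (?n + ?m)" by (rule diag_sum_carrier[OF A(2) B(2)])
    show "diag_sum A B * diag_sum A' B' = 1\<^sub>m (?n + ?m)"
      unfolding diag_sum_mult[OF A(1,2) B(1,2)] A(3) B(3) by (rule one)
    show "diag_sum A' B' * diag_sum A B = 1\<^sub>m (?n + ?m)"
      unfolding diag_sum_mult[OF A(2,1) B(2,1)] A(4) B(4) by (rule one)
  qed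
qed

lemma diag_sum_isometric:
  assumes A: "A \<in> carrier_mat n n" and B: "B \<in> carrier_mat m m"
    and "isometric_mat A A'" "isometric_mat B B'"
  shows "isometric_mat (diag_sum A B) (diag_sum A' (B' :: 'l::field mat))"
proof -
  from assms obtain P where P: "invertible_mat P" "dim_row P = n" and dA: "dim_row A' = n"
    and A': "A' = transpose_mat P * A * P" by (auto simp: isometric_mat_def)
  from assms obtain Q where Q: "invertible_mat Q" "dim_row Q = m" and dB: "dim_row B' = m"
    and B': "B' = transpose_mat Q * B * Q" by (auto simp: isometric_mat_def)
  have PQ: "P \<in> carrier_mat n n" "Q \<in> carrier_mat m m" using P Q by (auto simp: invertible_mat_def)
  have "diag_sum A' B' = transpose_mat (diag_sum P Q) * diag_sum A B * diag_sum P Q"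
    using PQ A B
    by (simp add: A' B' diag_sum_transpose[of _ n _ m] diag_sum_mult[of _ n _ _ m])
  moreover have "invertible_mat (diag_sum P Q)" using P Q by (intro diag_sum_invertible)
  ultimately show ?thesis
    using PQ A B dA dB unfolding isometric_mat_def
    by (intro exI[of _ "diag_sum P Q"]) (auto simp: diag_sum_def)
qed

lemma diag_sum_assoc: "diag_sum (diag_sum A B) C = diag_sum A (diag_sum B (C :: 'l::field mat))"
  using assoc_four_block_mat[of A B C] by (simp add: diag_sum_def)

lemma diag_sum_comm:
  assumes A: "A \<in> carrier_mat n n" and B: "B \<in> carrier_mat m m"
  shows "isometric_mat (diag_sum A B) (diag_sum B (A :: 'l::field mat))"
proof -
  let ?P = "four_block_mat (0\<^sub>m n m) (1\<^sub>m n) (1\<^sub>m m) (0\<^sub>m m n) :: 'l mat"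
  let ?Q = "four_block_mat (0\<^sub>m m n) (1\<^sub>m m) (1\<^sub>m n) (0\<^sub>m n m) :: 'l mat"
  have P: "?P \<in> carrier_mat (n + m) (n + m)"
    and Q: "?Q \<in> carrier_mat (n + m) (n + m)" by (auto simp: add.commute)
  have PQ: "?P * ?Q = 1\<^sub>m (n + m)"
    by (subst mult_four_block_mat[of _ n m _ n _ m _ _ n _ m]) auto
  have QP: "?Q * ?P = 1\<^sub>m (n + m)"
    by (subst mult_four_block_mat[of _ m n _ m _ n _ _ m _ n]) (auto simp: add.commute)
  have tP: "transpose_mat ?P = ?Q"
    by (subst transpose_four_block_mat[of _ n m _ n _ m]) auto
  have "?Q * diag_sum A B = four_block_mat (0\<^sub>m m n) B A (0\<^sub>m n m)"
    using A B unfolding diag_sum_def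
    by (subst mult_four_block_mat[of _ m n _ m _ n _ _ n _ m]) auto
  also have "\<dots> * ?P = diag_sum B A"
    using A B unfolding diag_sum_def
    by (subst mult_four_block_mat[of _ m n _ m _ n _ _ m _ n]) auto
  finally have "diag_sum B A = transpose_mat ?P * diag_sum A B * ?P" by (simp add: tP)
  moreover have "invertible_mat ?P" using P Q PQ QP by (rule invertible_matI)
  ultimately show ?thesis using A B P unfolding isometric_mat_def
    by (intro exI[of _ ?P]) (auto simp: diag_sum_def)
qed

lemma gram_matrix_props:
  "invertible_mat (gram_matrix a)" "transpose_mat (gram_matrix a) = gram_matrix a"
  "gram_matrix a \<in> carrier_mat (dim_row (gram_matrix a)) (dim_row (gram_matrix a))"
  using gram_matrix[of a] by (auto simp: invertible_mat_def)

lift_definition symform_sum :: "'l::field symform \<Rightarrow> 'l symform \<Rightarrow> 'l symform" is diag_sum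
proof -
  fix A B :: "'l mat"
  assume A: "invertible_mat A \<and> transpose_mat A = A" and B: "invertible_mat B \<and> transpose_mat B = B"
  then have "A \<in> carrier_mat (dim_row A) (dim_row A)" "B \<in> carrier_mat (dim_row B) (dim_row B)"
    by (auto simp: invertible_mat_def)
  from diag_sum_transpose[OF this] A B
  show "invertible_mat (diag_sum A B) \<and> transpose_mat (diag_sum A B) = diag_sum A B"
    by (simp add: diag_sum_invertible)
qed

lift_definition symform_zero :: "'l::field symform" is "1\<^sub>m 0"
  by (auto intro!: invertible_matI[of _ 0 "1\<^sub>m 0"])

lift_definition symform_isometric :: "'l::field symform \<Rightarrow> 'l symform \<Rightarrow> bool" is isometric_mat .

quotient_type (overloaded) 'l form_class = "'l::field symform" / symform_isometric
proof (rule equivpI)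
  show "reflp (symform_isometric :: 'l symform \<Rightarrow> _)"
    by (rule reflpI) (simp add: symform_isometric.rep_eq isometric_mat_refl[OF gram_matrix_props(3)])
  show "symp (symform_isometric :: 'l symform \<Rightarrow> _)"
    by (rule sympI) (auto simp: symform_isometric.rep_eq intro: isometric_mat_sym[OF gram_matrix_props(3)])
  show "transp (symform_isometric :: 'l symform \<Rightarrow> _)"
    by (rule transpI) (auto simp: symform_isometric.rep_eq intro: isometric_mat_trans[OF gram_matrix_props(3)])
qed

instantiation form_class :: (field) comm_monoid_add
begin

lift_definition zero_form_class :: "'a form_class" is symform_zero .

lift_definition plus_form_class :: "'a form_class \<Rightarrow> 'a form_class \<Rightarrow> 'a form_class"
  is symform_sum
  by (auto simp: symform_isometric.rep_eq symform_sum.rep_eq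
      intro: diag_sum_isometric[OF gram_matrix_props(3) gram_matrix_props(3)])

instance
proof
  fix a b c :: "'a form_class"
  show "a + b + c = a + (b + c)"
    by transfer (simp add: symform_isometric.rep_eq symform_sum.rep_eq diag_sum_assoc
        isometric_mat_refl[OF diag_sum_carrier[OF gram_matrix_props(3)
          diag_sum_carrier[OF gram_matrix_props(3) gram_matrix_props(3)]]])
  show "a + b = b + a"
    by transfer (simp add: symform_isometric.rep_eq symform_sum.rep_eq
        diag_sum_comm[OF gram_matrix_props(3) gram_matrix_props(3)])
  have "diag_sum (1\<^sub>m 0) A = A" for A :: "'a mat"
    by (rule eq_matI) (auto simp: diag_sum_def)
  then show "0 + a = a"
    by transfer (simp add: symform_isometric.rep_eq symform_sum.rep_eq symform_zero.rep_eq
        isometric_mat_refl[OF gram_matrix_props(3)])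
qed

end

subsection \<open>Group completion\<close>

definition completion_rel :: "'a::comm_monoid_add \<times> 'a \<Rightarrow> 'a \<times> 'a \<Rightarrow> bool" where
  "completion_rel u v \<longleftrightarrow> (\<exists>e. fst u + snd v + e = fst v + snd u + e)"

quotient_type (overloaded) 'a completion = "'a::comm_monoid_add \<times> 'a" / completion_rel
proof (rule equivpI)
  show "reflp (completion_rel :: 'a \<times> 'a \<Rightarrow> _)"
    by (rule reflpI) (simp add: completion_rel_def)
  show "symp (completion_rel :: 'a \<times> 'a \<Rightarrow> _)"
    by (rule sympI) (metis completion_rel_def)
  show "transp (completion_rel :: 'a \<times> 'a \<Rightarrow> _)"
  proof (rule transpI)
    fix u v w :: "'a \<times> 'a"
    assume "completion_rel u v" "completion_rel v w"
    then obtain e e' where e: "fst u + snd v + e = fst v + snd u + e"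
      and e': "fst v + snd w + e' = fst w + snd v + e'"
      by (auto simp: completion_rel_def)
    have "fst u + snd w + (fst v + snd v + e + e') =
        (fst u + snd v + e) + (fst v + snd w + e')" by (simp add: ac_simps)
    also have "\<dots> = fst w + snd u + (fst v + snd v + e + e')"
      unfolding e e' by (simp add: ac_simps)
    finally show "completion_rel u w" unfolding completion_rel_def by blast
  qed
qed

instantiation completion :: (comm_monoid_add) ab_group_add
begin

lift_definition zero_completion :: "'a completion" is "(0, 0)" .

lift_definition plus_completion :: "'a completion \<Rightarrow> 'a completion \<Rightarrow> 'a completion"
  is "\<lambda>u v. (fst u + fst v, snd u + snd v)"
proof -
  fix u u' v v' :: "'a \<times> 'a"
  assume "completion_rel u u'" "completion_rel v v'"
  then obtain e e' where e: "fst u + snd u' + e = fst u' + snd u + e"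
    and e': "fst v + snd v' + e' = fst v' + snd v + e'"
    by (auto simp: completion_rel_def)
  have "fst u + fst v + (snd u' + snd v') + (e + e') =
      (fst u + snd u' + e) + (fst v + snd v' + e')" by (simp add: ac_simps)
  also have "\<dots> = fst u' + fst v' + (snd u + snd v) + (e + e')"
    unfolding e e' by (simp add: ac_simps)
  finally show "completion_rel (fst u + fst v, snd u + snd v) (fst u' + fst v', snd u' + snd v')"
    unfolding completion_rel_def by auto
qed

lift_definition uminus_completion :: "'a completion \<Rightarrow> 'a completion"
  is "\<lambda>u. (snd u, fst u)"
  by (auto simp: completion_rel_def) (metis add.commute)

definition minus_completion :: "'a completion \<Rightarrow> 'a completion \<Rightarrow> 'a completion" where
  "minus_completion a b = a + - b"

instance
proof
  fix a b c :: "'a completion"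
  show "a + b + c = a + (b + c)" by transfer (auto simp: completion_rel_def ac_simps)
  show "a + b = b + a" by transfer (auto simp: completion_rel_def ac_simps)
  show "0 + a = a" by transfer (auto simp: completion_rel_def ac_simps)
  show "- a + a = 0" by transfer (auto simp: completion_rel_def ac_simps)
  show "a - b = a + - b" by (simp add: minus_completion_def)
qed

end

lift_definition completion_of :: "'a::comm_monoid_add \<Rightarrow> 'a completion" is "\<lambda>a. (a, 0)" .

definition zmult :: "int \<Rightarrow> 'a::ab_group_add \<Rightarrow> 'a" where
  "zmult n x = (if n \<ge> 0 then (\<Sum>i<nat n. x) else - (\<Sum>i<nat (- n). x))"

subsection \<open>\<open>GW(L)\<close>\<close>

type_synonym 'l gw = "'l form_class completion"

text \<open>The class of the form with Gram matrix \<open>A\<close>; meaningful for invertible symmetric \<open>A\<close>.\<close>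

definition gw_class :: "'l::field mat \<Rightarrow> 'l gw" where
  "gw_class A = completion_of (abs_form_class (Symform A))"

definition gw_unary :: "'l::field \<Rightarrow> 'l gw" where
  "gw_unary a = gw_class (mat 1 1 (\<lambda>_. a))"

definition gw_h :: "'l::field gw" where
  "gw_h = gw_unary 1 + gw_unary (- 1)"

section \<open>The projective line\<close>

text \<open>The function field \<open>L(y)\<close> of the projective line over \<open>L\<close> is \<^typ>\<open>'l poly fract\<close>.  The same type serves as the function
  field of the affine line with coordinate \<open>s\<close>, and, with \<open>k\<close> in place of \<open>L\<close>, as \<open>k(t)\<close>.\<close>

definition fract_var :: "'l::field poly fract" where
  "fract_var = Fract [:0, 1:] 1"

definition fract_const :: "'l::field \<Rightarrow> 'l poly fract" where
  "fract_const c = Fract [:c:] 1"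

abbreviation fract_scale :: "'l::field \<Rightarrow> 'l poly fract \<Rightarrow> 'l poly fract" where
  "fract_scale c z \<equiv> fract_const c * z"

text \<open>The derivation \<open>d/dy\<close> of \<open>L(y)\<close>.\<close>

definition fract_deriv :: "'l::field poly fract \<Rightarrow> 'l poly fract" where
  "fract_deriv z = (THE w. \<exists>a b. b \<noteq> 0 \<and> z = Fract a b \<and>
     w = Fract (pderiv a * b - a * pderiv b) (b * b))"

lemma fract_deriv_Fract:
  assumes "b \<noteq> 0"
  shows "fract_deriv (Fract a b) = Fract (pderiv a * b - a * pderiv b) (b * b)"
proof -
  have "Fract (pderiv c * d - c * pderiv d) (d * d) = Fract (pderiv a * b - a * pderiv b) (b * b)"
    if d: "d \<noteq> 0" and "Fract a b = Fract c d" for c d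
  proof -
    have eq: "a * d = c * b" using that assms by (simp add: eq_fract(1))
    have D: "pderiv a * d + a * pderiv d = pderiv c * b + c * pderiv b"
      using arg_cong[OF eq, of pderiv] by (simp add: pderiv_mult algebra_simps)
    have "(pderiv a * b - a * pderiv b) * (d * d)
        = (pderiv a * d + a * pderiv d) * (b * d) - (a * d) * (pderiv d * b + pderiv b * d)"
      by (simp add: algebra_simps)
    also have "\<dots> = (pderiv c * b + c * pderiv b) * (b * d) - (c * b) * (pderiv d * b + pderiv b * d)"
      unfolding D eq ..
    also have "\<dots> = (pderiv c * d - c * pderiv d) * (b * b)"
      by (simp add: algebra_simps)
    finally show ?thesis using assms d by (simp add: eq_fract(1))
  qed
  then show ?thesis unfolding fract_deriv_def using assms by (intro the_equality) blast+
qed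

text \<open>A rational function \<open>x\<close> defines a rational map \<open>\<phi>\<close> to the line with coordinate \<open>s\<close>, with
  \<open>\<phi>\<^sup>* s = x\<close>; the pullback \<open>\<phi>\<^sup>* F\<close> is \<open>F(x)\<close>, defined for those \<open>F\<close> that can be written with a
  denominator not vanishing at \<open>x\<close> (all \<open>F\<close>, if \<open>x\<close> is not constant).\<close>

definition eval_at :: "'l::field poly fract \<Rightarrow> 'l poly \<Rightarrow> 'l poly fract" where
  "eval_at x A = poly (map_poly fract_const A) x"

definition pullback :: "'l::field poly fract \<Rightarrow> 'l poly fract \<Rightarrow> 'l poly fract" where
  "pullback x F = (THE w. \<exists>A B. F = Fract A B \<and> eval_at x B \<noteq> 0 \<and> w = eval_at x A / eval_at x B)"

text \<open>The degree \<open>[L(y) : f\<^sup>* L(x)]\<close> of the map given by the nonconstant rational function \<open>f\<close>.\<close>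

definition map_degree :: "'l::field poly fract \<Rightarrow> nat" where
  "map_degree f = vector_space.dim (\<lambda>r z. pullback f r * z) (UNIV :: 'l poly fract set)"

subsection \<open>Closed points and local rings\<close>

text \<open>The closed points are those of \<open>Spec L[y]\<close>, given by the monic irreducible generators of the
  maximal ideals, and \<open>\<infinity>\<close>.\<close>

datatype 'p point = Finite 'p | Infinity

definition closed_points :: "'l::field poly point set" where
  "closed_points = insert Infinity {Finite P | P. irreducible P \<and> lead_coeff P = 1}"

fun local_ring :: "'l::field poly point \<Rightarrow> 'l poly fract set" where
  "local_ring (Finite P) = {Fract A B | A B. \<not> P dvd B}"
| "local_ring Infinity = {Fract A B | A B. B \<noteq> 0 \<and> degree A \<le> degree B}"

definition max_ideal :: "'l::field poly point \<Rightarrow> 'l poly fract set" where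
  "max_ideal q = {z \<in> local_ring q. \<not> (\<exists>w \<in> local_ring q. z * w = 1)}"

text \<open>The additive group generated by all products; for an invertible fractional ideal \<open>M\<close> this is
  also \<open>M \<otimes> N\<close>, and for a ring \<open>M\<close> it is the \<open>M\<close>-module generated by \<open>N\<close>.\<close>

definition ideal_prod :: "'a::comm_ring_1 set \<Rightarrow> 'a set \<Rightarrow> 'a set" (infixl \<open>\<odot>\<close> 70) where
  "M \<odot> N = {\<Sum>(a, b)\<leftarrow>xs. a * b | xs. set xs \<subseteq> M \<times> N}"

primrec max_ideal_pow :: "'l::field poly point \<Rightarrow> nat \<Rightarrow> 'l poly fract set" where
  "max_ideal_pow q 0 = local_ring q"
| "max_ideal_pow q (Suc n) = max_ideal q \<odot> max_ideal_pow q n"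

subsection \<open>Line bundles\<close>

text \<open>A line bundle is identified with a subsheaf of the constant sheaf \<open>L(y)\<close>, given by its stalks:
  each is free of rank one, and all but finitely many are the local ring itself.  Maps between line
  bundles that are defined at the generic point are multiplications by elements of \<open>L(y)\<close>.\<close>

type_synonym 'l stalks = "'l poly point \<Rightarrow> 'l poly fract set"

definition line_bundle :: "'l::field stalks \<Rightarrow> bool" where
  "line_bundle N \<longleftrightarrow>
     (\<forall>q \<in> closed_points. \<exists>e. e \<noteq> 0 \<and> N q = (\<lambda>z. e * z) ` local_ring q) \<and>
     finite {q \<in> closed_points. N q \<noteq> local_ring q}"

definition hom_bundle :: "'l::field stalks \<Rightarrow> 'l stalks \<Rightarrow> 'l stalks" where
  "hom_bundle M N q = {w. \<forall>m \<in> M q. w * m \<in> N q}"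

text \<open>The module of differentials of a local ring \<open>O\<close> with fraction field \<open>L(y)\<close>, generated by all
  \<open>dz\<close> with \<open>z \<in> O\<close>.  The function \<open>g\<close> stands for the differential \<open>g dy\<close>.\<close>

definition differentials :: "'l::field poly fract set \<Rightarrow> 'l poly fract set" where
  "differentials O' = O' \<odot> fract_deriv ` O'"

definition cotangent :: "'l::field stalks" where
  "cotangent q = differentials (local_ring q)"

text \<open>\<open>L\<close>-derivations of the local ring; the function \<open>h\<close> stands for \<open>h d/dy\<close>.\<close>

definition tangent :: "'l::field stalks" where
  "tangent q = {h. \<forall>z \<in> local_ring q. h * fract_deriv z \<in> local_ring q}"

text \<open>For \<open>f : Y \<rightarrow> X\<close>, the bundle \<open>f\<^sup>* T\<^sup>\<or>X\<close> on \<open>Y\<close>, where \<open>g\<close> stands for \<open>g \<otimes> dx\<close> with \<open>x\<close> the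
  coordinate of \<open>X\<close>.  The local ring of \<open>X\<close> at \<open>f(q)\<close> consists of the functions whose pullback is
  regular at \<open>q\<close>.\<close>

definition pullback_cotangent :: "'l::field poly fract \<Rightarrow> 'l stalks" where
  "pullback_cotangent f q =
     local_ring q \<odot> pullback f ` differentials {z. pullback f z \<in> local_ring q}"

text \<open>\<open>Hom(f\<^sup>* T\<^sup>\<or>X, T\<^sup>\<or>Y)\<close>, where \<open>v\<close> stands for the homomorphism \<open>1 \<otimes> dx \<mapsto> v dy\<close>.\<close>

definition hom_cotangent :: "'l::field poly fract \<Rightarrow> 'l stalks" where
  "hom_cotangent f = hom_bundle (pullback_cotangent f) cotangent"

text \<open>The section \<open>df\<close> maps \<open>1 \<otimes> dx\<close> to \<open>d(f\<^sup>* x) = f' dy\<close>.\<close>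

definition d_section :: "'l::field poly fract \<Rightarrow> 'l poly fract" where
  "d_section f = fract_deriv f"

definition zeros :: "'l::field stalks \<Rightarrow> 'l poly fract \<Rightarrow> 'l poly point set" where
  "zeros V \<sigma> = {q \<in> closed_points. \<sigma> \<in> max_ideal q \<odot> V q}"

text \<open>The isomorphism \<open>Hom(TY, V) \<cong> N \<otimes> N\<close> is multiplication by \<open>c\<close>.\<close>

definition relative_orientation :: "'l::field stalks \<Rightarrow> 'l stalks \<Rightarrow> 'l poly fract \<Rightarrow> bool" where
  "relative_orientation V N c \<longleftrightarrow> line_bundle N \<and> c \<noteq> 0 \<and>
     (\<forall>q \<in> closed_points. (\<lambda>w. c * w) ` hom_bundle tangent V q = N q \<odot> N q)"

subsection \<open>The Euler characteristic\<close>

definition genus :: "'l::field itself \<Rightarrow> nat" where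
  "genus _ = vector_space.dim fract_scale (\<Inter>q \<in> closed_points. cotangent q :: 'l poly fract set)"

definition euler_char_P1 :: "'l::field gw" where
  "euler_char_P1 = zmult (1 - int (genus TYPE('l))) gw_h"

section \<open>The local index\<close>

text \<open>For a map \<open>\<phi>\<close> to the affine line, regular at \<open>q\<close> and with \<open>\<phi>\<^sup>* s = x\<close>: the local ring \<open>R\<close> of the
  affine line at \<open>\<phi>(q)\<close>, i.e. the localization of \<open>L[s]\<close> at the prime of all \<open>B\<close> with \<open>B(x)\<close>
  vanishing at \<open>q\<close>, and its maximal ideal.\<close>

definition target_ring :: "'l::field poly point \<Rightarrow> 'l poly fract \<Rightarrow> 'l poly fract set" where
  "target_ring q x = {Fract A B | A B. eval_at x B \<notin> max_ideal q}"

definition target_ideal :: "'l::field poly point \<Rightarrow> 'l poly fract \<Rightarrow> 'l poly fract set" where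
  "target_ideal q x = {Fract A B | A B. eval_at x A \<in> max_ideal q \<and> eval_at x B \<notin> max_ideal q}"

text \<open>Nisnevich coordinates: \<open>\<phi>\<close> is regular at \<open>q\<close>, flat (\<open>R\<close> is a discrete valuation ring or a
  field, so this means that the local ring of \<open>q\<close> is torsion-free over \<open>R\<close>, i.e. that \<open>x\<close> is
  transcendental), unramified, and induces an isomorphism of residue fields at \<open>q\<close>; in particular
  the residue extension is separable.  Being etale is an open condition, so this determines an
  etale map on some neighbourhood of \<open>q\<close>, and only its germ at \<open>q\<close> is used below.\<close>

definition nisnevich_coordinate :: "'l::field poly point \<Rightarrow> 'l poly fract \<Rightarrow> bool" where
  "nisnevich_coordinate q x \<longleftrightarrow>
     x \<in> local_ring q \<and>
     (\<forall>A. eval_at x A = 0 \<longrightarrow> A = 0) \<and>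
     max_ideal q = local_ring q \<odot> pullback x ` target_ideal q x \<and>
     (\<forall>z \<in> local_ring q. \<exists>F \<in> target_ring q x. z - pullback x F \<in> max_ideal q)"

text \<open>A generator \<open>v\<close> of the stalk of \<open>V\<close> at \<open>q\<close>, compatible with the orientation.  The vector field
  \<open>\<partial>\<close> dual to \<open>dx\<close> is \<open>(1/x') d/dy\<close>, so the homomorphism \<open>TY \<rightarrow> V\<close> with \<open>\<partial> \<mapsto> v\<close> is multiplication
  by \<open>v x'\<close>.\<close>

definition compatible_trivialization ::
  "'l::field stalks \<Rightarrow> 'l stalks \<Rightarrow> 'l poly fract \<Rightarrow> 'l poly point \<Rightarrow> 'l poly fract \<Rightarrow> 'l poly fract \<Rightarrow> bool"
  where
  "compatible_trivialization V N c q x v \<longleftrightarrow>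
     v \<noteq> 0 \<and> V q = (\<lambda>z. v * z) ` local_ring q \<and>
     (\<exists>l \<in> N q. c * (v * fract_deriv x) = l * l)"

text \<open>\<open>R\<close> below is an \<open>L\<close>-subspace of \<open>L(s)\<close>.  Elements of \<open>R \<otimes>\<^sub>L R\<close> are given as sums of pure
  tensors; two such sums are equal iff every bilinear form on \<open>R\<close> takes the same value on them.\<close>

definition linear_form_on :: "'l::field poly fract set \<Rightarrow> ('l poly fract \<Rightarrow> 'l) \<Rightarrow> bool" where
  "linear_form_on R \<mu> \<longleftrightarrow>
     (\<forall>a \<in> R. \<forall>b \<in> R. \<mu> (a + b) = \<mu> a + \<mu> b) \<and> (\<forall>c. \<forall>a \<in> R. \<mu> (fract_scale c a) = c * \<mu> a)"

definition bilinear_form_on ::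
  "'l::field poly fract set \<Rightarrow> ('l poly fract \<Rightarrow> 'l poly fract \<Rightarrow> 'l) \<Rightarrow> bool" where
  "bilinear_form_on R \<beta> \<longleftrightarrow>
     (\<forall>a \<in> R. linear_form_on R (\<beta> a)) \<and> (\<forall>b \<in> R. linear_form_on R (\<lambda>a. \<beta> a b))"

definition tensor_eq :: "'l::field poly fract set \<Rightarrow>
    ('l poly fract \<times> 'l poly fract) list \<Rightarrow> ('l poly fract \<times> 'l poly fract) list \<Rightarrow> bool" where
  "tensor_eq R u u' \<longleftrightarrow>
     (\<forall>\<beta>. bilinear_form_on R \<beta> \<longrightarrow> (\<Sum>(b, c)\<leftarrow>u. \<beta> b c) = (\<Sum>(b, c)\<leftarrow>u'. \<beta> b c))"

text \<open>\<open>a = \<Sum> b\<^sub>i \<otimes> c\<^sub>i\<close> in \<open>R \<otimes>\<^sub>L R\<close> satisfies \<open>F \<otimes> 1 - 1 \<otimes> F = a (s \<otimes> 1 - 1 \<otimes> s)\<close>.\<close>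

definition is_bezoutian :: "'l::field poly fract set \<Rightarrow> 'l poly fract \<Rightarrow>
    ('l poly fract \<times> 'l poly fract) list \<Rightarrow> bool" where
  "is_bezoutian R F a \<longleftrightarrow> set a \<subseteq> R \<times> R \<and>
     tensor_eq R [(F, 1), (- 1, F)]
       (map (\<lambda>(b, c). (b * fract_var, c)) a @ map (\<lambda>(b, c). (- b, c * fract_var)) a)"

text \<open>\<open>\<eta> : Q \<rightarrow> L\<close> with \<open>\<Theta>(\<eta>) = 1\<close>, where \<open>Q = R/(F)\<close> and \<open>\<Theta>(\<mu>) = \<Sum> \<mu>(b\<^sub>i) c\<^sub>i\<close>.  Linear forms on \<open>Q\<close>
  are linear forms on \<open>R\<close> that vanish on \<open>(F)\<close>.\<close>

definition is_theta_inverse_one :: "'l::field poly fract set \<Rightarrow> 'l poly fract \<Rightarrow>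
    ('l poly fract \<times> 'l poly fract) list \<Rightarrow> ('l poly fract \<Rightarrow> 'l) \<Rightarrow> bool" where
  "is_theta_inverse_one R F a \<eta> \<longleftrightarrow>
     linear_form_on R \<eta> \<and> (\<forall>r \<in> R. \<eta> (F * r) = 0) \<and>
     (\<Sum>(b, c)\<leftarrow>a. fract_scale (\<eta> b) c) - 1 \<in> (\<lambda>r. F * r) ` R"

text \<open>The images of \<open>bs\<close> form an \<open>L\<close>-basis of \<open>R/I\<close>.\<close>

definition is_basis_mod ::
  "'l::field poly fract set \<Rightarrow> 'l poly fract set \<Rightarrow> 'l poly fract list \<Rightarrow> bool" where
  "is_basis_mod R I bs \<longleftrightarrow> set bs \<subseteq> R \<and>
     (\<forall>r \<in> R. \<exists>!cs. length cs = length bs \<and>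
        r - (\<Sum>i<length bs. fract_scale (cs ! i) (bs ! i)) \<in> I)"

text \<open>The class \<open>w\<close> arises from some choice of all the data in the definition of the index of the
  section \<open>\<sigma>\<close> of \<open>V\<close> at \<open>q\<close>.\<close>

definition computes_index :: "'l::field stalks \<Rightarrow> 'l stalks \<Rightarrow> 'l poly fract \<Rightarrow>
    'l poly fract \<Rightarrow> 'l poly point \<Rightarrow> 'l gw \<Rightarrow> bool" where
  "computes_index V N c \<sigma> q w \<longleftrightarrow>
     (\<exists>x v \<sigma>\<^sub>0 n g F a \<eta> bs.
        nisnevich_coordinate q x \<and>
        compatible_trivialization V N c q x v \<and>
        \<sigma> = \<sigma>\<^sub>0 * v \<and>
        \<sigma>\<^sub>0 \<in> max_ideal_pow q n \<and> \<sigma>\<^sub>0 \<notin> max_ideal_pow q (Suc n) \<and>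
        g \<in> max_ideal_pow q (2 * n) \<and>
        F \<in> target_ring q x \<and> \<sigma>\<^sub>0 + g = pullback x F \<and>
        is_bezoutian (target_ring q x) F a \<and>
        is_theta_inverse_one (target_ring q x) F a \<eta> \<and>
        is_basis_mod (target_ring q x) ((\<lambda>r. F * r) ` target_ring q x) bs \<and>
        w = gw_class (mat (length bs) (length bs) (\<lambda>(i, j). \<eta> (bs ! i * bs ! j))))"

definition local_index :: "'l::field stalks \<Rightarrow> 'l stalks \<Rightarrow> 'l poly fract \<Rightarrow>
    'l poly fract \<Rightarrow> 'l poly point \<Rightarrow> 'l gw" where
  "local_index V N c \<sigma> q = (THE w. computes_index V N c \<sigma> q w)"

end

theory Submission
  imports Defs "Jordan_Normal_Form.Determinant"
begin

text \<open>
  Let \<open>x\<close> be any Nisnevich coordinate at a closed point \<open>q\<close>, and let the monic irreducible \<open>G\<close> cut out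
  \<open>\<phi>(q)\<close>; then \<open>G(x)\<close> is a uniformizer at \<open>q\<close>, and \<open>F = G\<^sup>n u\<close> with \<open>u\<close> a unit.  Pairing the Bezoutian of
  \<open>F\<close> with linear forms on \<open>Q\<close> shows that \<open>\<eta>(u r)\<close> is the coefficient of \<open>s\<^bsup>d-1\<^esup>\<close>, \<open>d = deg G\<^sup>n\<close>, in the
  remainder of \<open>r\<close> modulo \<open>G\<^sup>n\<close>.  If \<open>u\<close> is \<open>\<plusminus>1\<close> times a square, the form is therefore \<open>\<plusminus>1\<close> times an
  antidiagonal matrix of ones in a suitable basis of shifted monomials.

  Whether \<open>u\<close> is a square is decided by the leading term of the section.  At \<open>y^p = t\<close> the residue field
  is purely inseparable, \<open>G = s^p - b\<close> and \<open>G(x) \<equiv> (y^p - t) x'^p\<close> modulo the square of the maximal ideal;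
  since the trivialization contributes a factor \<open>x'\<close>, the unit is \<open>x'^(1 - p)\<close> up to squares, and \<open>p\<close> is odd.
  At infinity \<open>G = s - b\<close>, \<open>n = p - 2\<close> and the same count of powers leaves \<open>-1\<close> times a square.
\<close>

section \<open>Polynomials over a field\<close>

text \<open>The index is a definite description, so evaluating one convenient choice of data does
  not determine it: every coordinate, trivialization, correction g, Bezoutian, functional and basis
  must lead to the same class. What all choices share is that the leading term of the section has
  the form e z^2 G(x)^n with z a unit and e fixed. A correction in m^(2n) cannot change it, and the
  residue field isomorphism together with Newton iteration (2 is invertible) turns it into u = e
  rho^2 modulo G^n. The explicit coordinates y and 1/y only show that some choice exists.

  Both quotients have odd dimension, p at y^p = t and p - 2 at infinity, so each antidiagonal form
  splits into hyperbolic planes and one middle vector of norm e. The minus sign at infinity comes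
  from d(1/y) = -y^(-2) dy. In the sum of the two indices <1> + <-1> is one more h, so the total is
  (p - 1) h; with degree p and genus 0 the formula becomes h = p h - (p - 1) h.\<close>

lemma poly_bezout:
  fixes A B :: "'l::field poly"
  shows "\<exists>U V D. D = U * A + V * B \<and> D dvd A \<and> D dvd B"
proof (induction "if B = 0 then 0 else Suc (degree B)" arbitrary: A B rule: less_induct)
  case less
  show ?case
  proof (cases "B = 0")
    case True
    then show ?thesis by (intro exI[of _ 1] exI[of _ 0] exI[of _ A]) auto
  next
    case False
    have "\<exists>U V D. D = U * B + V * (A mod B) \<and> D dvd B \<and> D dvd A mod B"
      by (rule less) (use False degree_mod_less[of B A] in auto)
    then obtain U V D where D: "D = U * B + V * (A mod B)" "D dvd B" "D dvd A mod B" by blast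
    have "D = V * A + (U - V * (A div B)) * B"
      unfolding D(1) by (simp add: minus_div_mult_eq_mod[symmetric] algebra_simps)
    moreover have "D dvd A" using D(2,3) by (rule dvd_mod_imp_dvd[rotated])
    ultimately show ?thesis using D(2) by blast
  qed
qed

text \<open>Bezout inverts B modulo G. The n-th power of 1 - B C is divisible by G^n and, by the
  geometric series, is still of the form 1 - B C'. This is what lets denominators in a localization
  be replaced by polynomials modulo G^n.\<close>

lemma irreducible_inverse_mod:
  fixes G :: "'l::field poly"
  assumes G: "irreducible G" and B: "\<not> G dvd B"
  obtains C where "G ^ n dvd 1 - B * C"
proof -
  obtain U V D where D: "D = U * G + V * B" "D dvd G" "D dvd B"
    using poly_bezout[of G B] by (metis add.commute)
  have "D dvd 1"
  proof -
    from D(2) obtain E where E: "G = D * E" by (elim dvdE)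
    then have "D dvd 1 \<or> E dvd 1" using G by (simp add: irreducibleD)
    moreover have "\<not> E dvd 1"
    proof
      assume "E dvd 1"
      then have "G dvd D" using E by (metis dvd_mult_unit_iff dvd_refl)
      with D(3) B show False by (blast dest: dvd_trans)
    qed
    ultimately show ?thesis by simp
  qed
  then obtain D' where "1 = D * D'" by (elim dvdE)
  then have "1 - B * (V * D') = G * (U * D')" unfolding D(1) by (simp add: algebra_simps)
  then have "G dvd 1 - B * (V * D')" by simp
  then have "G ^ n dvd (1 - B * (V * D')) ^ n" by (rule dvd_power_same)
  moreover have "1 - (1 - B * (V * D')) ^ n
      = B * ((V * D') * (\<Sum>i<n. (1 - B * (V * D')) ^ i))"
    by (simp add: one_diff_power_eq)
  then have "(1 - B * (V * D')) ^ n = 1 - B * ((V * D') * (\<Sum>i<n. (1 - B * (V * D')) ^ i))"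
    by (simp add: algebra_simps)
  ultimately show thesis using that by metis
qed

lemma irreducible_dvd_mult:
  fixes G :: "'l::field poly"
  assumes "irreducible G" shows "G dvd A * B \<longleftrightarrow> G dvd A \<or> G dvd B"
  using field_poly_irreducible_imp_prime[OF assms] by (rule prime_elem_dvd_mult_iff)

lemma exists_irreducible_factor:
  fixes B :: "'l::field poly"
  assumes "degree B > 0"
  shows "\<exists>P. irreducible P \<and> lead_coeff P = 1 \<and> P dvd B"
  using assms
proof (induction "degree B" arbitrary: B rule: less_induct)
  case less
  have B0: "B \<noteq> 0" using less.prems by auto
  show ?case
  proof (cases "irreducible B")
    case True
    let ?c = "inverse (lead_coeff B)"
    have c: "?c \<noteq> 0" using B0 by simp
    have "irreducible (Polynomial.smult ?c B)"
    proof (rule irreducibleI)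
      show "Polynomial.smult ?c B \<noteq> 0" using B0 by simp
      show "\<not> Polynomial.smult ?c B dvd 1" using True c by (simp add: smult_dvd_iff irreducible_not_unit)
      fix a b assume "Polynomial.smult ?c B = a * b"
      then have "B = Polynomial.smult (lead_coeff B) a * b" using B0 by (metis c inverse_inverse_eq mult_smult_left smult_smult right_inverse smult_1_left B0 leading_coeff_neq_0)
      from irreducibleD[OF True this] show "a dvd 1 \<or> b dvd 1" using B0 by (simp add: smult_dvd_iff)
    qed
    moreover have "Polynomial.smult ?c B dvd B" using c by (simp add: smult_dvd_iff)
    ultimately show ?thesis using B0 by (intro exI[of _ "Polynomial.smult ?c B"]) simp
  next
    case False
    moreover have "\<not> B dvd 1" using less.prems by (simp add: is_unit_iff_degree B0)
    ultimately obtain a b where ab: "B = a * b" "\<not> a dvd 1" "\<not> b dvd 1"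
      using B0 by (auto simp: irreducible_def)
    then have "a \<noteq> 0" "b \<noteq> 0" using B0 by auto
    with ab have d: "degree a > 0" "degree b > 0" "degree B = degree a + degree b"
      by (auto simp: is_unit_iff_degree degree_mult_eq)
    with less.hyps[of a] show ?thesis using ab by (auto intro: dvd_mult2)
  qed
qed

lemma dvd_prime_power_eq:
  fixes A :: "'l::field poly"
  assumes "irreducible A" "H dvd A ^ n"
  shows "\<exists>j c. c \<noteq> 0 \<and> H = Polynomial.smult c (A ^ j)"
  using assms(2)
proof (induction n arbitrary: H)
  case 0
  then obtain c where "H = [:c:]" "c \<noteq> 0" by (auto simp: is_unit_poly_iff dvd_field_iff)
  then show ?case by (intro exI[of _ 0] exI[of _ c]) simp
next
  case (Suc n)
  have A0: "A \<noteq> 0" using assms(1) by auto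
  show ?case
  proof (cases "A dvd H")
    case True
    then obtain H' where H': "H = A * H'" by (elim dvdE)
    then have "H' dvd A ^ n" using Suc.prems A0 by simp
    from Suc.IH[OF this] obtain j c where "c \<noteq> 0" "H' = Polynomial.smult c (A ^ j)" by blast
    then show ?thesis using H' by (intro exI[of _ "Suc j"] exI[of _ c]) simp
  next
    case False
    from Suc.prems obtain E where E: "A * A ^ n = H * E" by (metis dvdE power_Suc)
    then have "A dvd E" using False irreducible_dvd_mult[OF assms(1)] by (metis dvd_triv_left)
    then obtain E' where "E = A * E'" by (elim dvdE)
    with E A0 have "A ^ n = H * E'" by simp
    then show ?thesis using Suc.IH by (metis dvd_triv_left)
  qed
qed

section \<open>The polynomial s^p - b in characteristic p\<close>

lemma power_CHAR_pCons:
  fixes A :: "'l::field poly"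
  assumes "prime p" "CHAR('l) = p"
  shows "(pCons c A) ^ p = [:c ^ p:] + monom 1 p * A ^ p"
proof -
  have "(pCons c A) ^ p = ([:c:] + [:0, 1:] * A) ^ p" by simp
  also have "\<dots> = [:c:] ^ p + ([:0, 1:] * A) ^ p"
    by (rule freshmans_dream) (use assms in simp_all)
  also have "\<dots> = [:c ^ p:] + monom 1 p * A ^ p"
    unfolding power_mult_distrib by (simp add: poly_const_pow monom_altdef)
  finally show ?thesis .
qed

text \<open>The Frobenius makes A^p a polynomial in s^p with coefficients a_i^p; substituting b for
  s^p leaves a constant.\<close>

lemma power_CHAR_poly:
  fixes A :: "'l::field poly"
  assumes p: "prime p" "CHAR('l) = p"
  shows "monom 1 p - [:b:] dvd A ^ p - [:poly (map_poly (\<lambda>c. c ^ p) A) b:]"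
proof (induction A)
  case 0
  then show ?case using prime_gt_0_nat[OF p(1)] by (simp add: power_0_left)
next
  case (pCons c A)
  let ?H = "monom 1 p - [:b:]" and ?e = "poly (map_poly (\<lambda>c. c ^ p) A) b"
  have "(pCons c A) ^ p - [:poly (map_poly (\<lambda>c. c ^ p) (pCons c A)) b:]
      = ?H * A ^ p + [:b:] * (A ^ p - [:?e:])"
    using prime_gt_0_nat[OF p(1)] unfolding power_CHAR_pCons[OF p]
    by (simp add: map_poly_pCons algebra_simps)
  then show ?case using pCons.IH by (metis dvd_add dvd_mult dvd_triv_left)
qed

lemma degree_monom_minus_const:
  fixes c :: "'l::field"
  assumes "p > 0"
  shows "degree (monom 1 p - [:c:]) = p" "lead_coeff (monom 1 p - [:c:]) = 1"
proof -
  show d: "degree (monom 1 p - [:c:]) = p"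
    using assms by (subst diff_conv_add_uminus, subst degree_add_eq_left) (simp_all add: degree_monom_eq)
  show "lead_coeff (monom 1 p - [:c:]) = 1" unfolding d using assms by (cases p) simp_all
qed

text \<open>Take a monic irreducible factor A of H = s^p - b. Modulo H the power A^p is a constant,
  and A divides that constant, so it is 0 and H divides A^p. Hence H is a power of A, and since p is
  prime A has degree p or 1; in degree 1 its root would be a p-th root of b.\<close>

lemma irreducible_monom_minus_const:
  fixes b :: "'l::field"
  assumes p: "prime p" "CHAR('l) = p" and b: "\<nexists>c. c ^ p = b"
  shows "irreducible (monom 1 p - [:b:])"
proof -
  let ?H = "monom 1 p - [:b:]"
  have p0: "p > 0" using p(1) by (simp add: prime_gt_0_nat)
  note deg = degree_monom_minus_const(1)[OF p0, of b] and lc = degree_monom_minus_const(2)[OF p0, of b]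
  obtain A where A: "irreducible A" "lead_coeff A = 1" "A dvd ?H"
    using exists_irreducible_factor[of ?H] deg p0 by auto
  have A0: "A \<noteq> 0" using A(1) by auto
  have Adeg: "degree A > 0" using A(1) A0 by (metis irreducible_not_unit is_unit_iff_degree neq0_conv)
  let ?e = "poly (map_poly (\<lambda>c. c ^ p) A) b"
  have "A dvd A ^ p - [:?e:]" using A(3) power_CHAR_poly[OF p, of b A] by (rule dvd_trans)
  moreover have "A dvd A ^ p" using p0 by (simp add: dvd_power)
  ultimately have "A dvd [:?e:]" by (metis dvd_diff diff_diff_eq2 add_diff_cancel_left' )
  then have "?e = 0" using Adeg dvd_imp_degree_le[of A "[:?e:]"] by auto
  then have "?H dvd A ^ p" using power_CHAR_poly[OF p, of b A] by simp
  from dvd_prime_power_eq[OF A(1) this] obtain j c where jc: "c \<noteq> 0" "?H = Polynomial.smult c (A ^ j)" by blast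
  have "lead_coeff ?H = c" unfolding jc(2) using A(2) by (simp add: lead_coeff_power)
  then have H: "?H = A ^ j" using jc(2) lc by (metis smult_1_left)
  have "p = j * degree A" using deg unfolding H by (simp add: degree_power_eq A0)
  then have "degree A = 1 \<or> degree A = p" using p(1) by (metis dvd_triv_right prime_nat_iff)
  then show ?thesis
  proof
    assume "degree A = p"
    with \<open>p = j * degree A\<close> p0 have "j = 1" by simp
    then show ?thesis using H A(1) by simp
  next
    assume "degree A = 1"
    then obtain a0 where "A = [:a0, 1:]" using A(2)
      by (cases A; cases "tl (coeffs A)") (auto simp: degree_eq_zeroE split: if_splits elim!: degree_eq_zeroE)
    then have "poly A (- a0) = 0" by simp
    then have "poly ?H (- a0) = 0" using A(3) by (metis poly_eq_0_iff_dvd dvd_trans)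
    then have "(- a0) ^ p = b" by (simp add: poly_monom)
    with b show ?thesis by blast
  qed
qed

section \<open>The function field of the line\<close>

lemma fract_const_conv: "fract_const c = to_fract [:c:]"
  by (simp add: fract_const_def to_fract_def)

lemma fract_var_conv: "fract_var = to_fract [:0, 1:]"
  by (simp add: fract_var_def to_fract_def)

lemma fract_const_simps [simp]:
  "fract_const 0 = 0" "fract_const 1 = 1"
  "fract_const (a + b) = fract_const a + fract_const b"
  "fract_const (a - b) = fract_const a - fract_const b"
  "fract_const (- a) = - fract_const a"
  "fract_const (a * b) = fract_const a * fract_const b"
  "fract_const a = fract_const b \<longleftrightarrow> a = b"
  "fract_const a = 0 \<longleftrightarrow> a = 0"
  by (simp_all add: fract_const_conv flip: to_fract_add to_fract_diff to_fract_uminus to_fract_mult) (simp_all add: to_fract_def One_fract_def flip: one_pCons)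

lemma fract_const_power [simp]: "fract_const (a ^ n) = fract_const a ^ n"
  by (induction n) simp_all

lemma fract_const_inverse [simp]: "fract_const (inverse a) = inverse (fract_const a)"
proof (cases "a = 0")
  case False
  then have "fract_const a * fract_const (inverse a) = 1" by (simp flip: fract_const_simps(6))
  then show ?thesis by (simp add: inverse_unique)
qed simp

lemma fract_const_divide [simp]: "fract_const (a / b) = fract_const a / fract_const b"
  by (simp add: divide_inverse)

lemma to_fract_power [simp]: "to_fract (A ^ n) = to_fract A ^ n"
  by (induction n) simp_all

lemma to_fract_smult: "to_fract (Polynomial.smult c A) = fract_const c * to_fract A"
  by (simp add: fract_const_conv flip: to_fract_mult)

lemma to_fract_pCons: "to_fract (pCons c A) = fract_const c + fract_var * to_fract A"
proof -
  have "pCons c A = [:c:] + [:0, 1:] * A" by simp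
  then show ?thesis by (metis fract_const_conv fract_var_conv to_fract_add to_fract_mult)
qed

lemma fract_repr:
  fixes z :: "'l::field poly fract"
  obtains A B where "z = Fract A B" "B \<noteq> 0" "z = to_fract A / to_fract B"
  by (metis Fract_cases Fract_conv_to_fract)

text \<open>Coprimality is recorded as a Bezout identity because an identity survives evaluation at
  f and reduction at a point.\<close>

lemma fract_coprime_repr:
  fixes z :: "'l::field poly fract"
  obtains A B U V where "z = Fract A B" "B \<noteq> 0" "U * A + V * B = 1"
proof -
  obtain a b where ab: "z = Fract a b" "b \<noteq> 0" by (rule fract_repr)
  obtain U V D where D: "D = U * a + V * b" "D dvd a" "D dvd b" using poly_bezout by blast
  then obtain A B where AB: "a = D * A" "b = D * B" by (elim dvdE)
  have "D \<noteq> 0" using AB ab by auto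
  moreover have "D * 1 = D * (U * A + V * B)"
    using D(1) unfolding AB by (simp add: algebra_simps)
  ultimately have "U * A + V * B = 1" by (metis mult_left_cancel)
  moreover have "z = Fract A B" "B \<noteq> 0" using ab AB \<open>D \<noteq> 0\<close> by (simp_all add: mult_fract_cancel)
  ultimately show thesis using that by blast
qed

lemma fract_deriv_to_fract [simp]: "fract_deriv (to_fract A) = to_fract (pderiv A)"
  unfolding to_fract_def by (subst fract_deriv_Fract) simp_all

lemma fract_deriv_const [simp]: "fract_deriv (fract_const c) = 0"
  by (simp add: fract_const_conv pderiv_pCons)

lemma fract_deriv_var [simp]: "fract_deriv fract_var = 1"
  unfolding fract_var_conv by (simp add: pderiv_pCons flip: one_pCons)

lemma fract_deriv_mult: "fract_deriv (y * z) = fract_deriv y * z + y * fract_deriv z"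
proof -
  obtain A B where y: "y = Fract A B" "B \<noteq> 0" by (rule fract_repr)
  obtain C D where z: "z = Fract C D" "D \<noteq> 0" by (rule fract_repr)
  show ?thesis using y z
    by (simp add: fract_deriv_Fract eq_fract pderiv_mult algebra_simps)
qed

lemma fract_deriv_add: "fract_deriv (y + z) = fract_deriv y + fract_deriv z"
proof -
  obtain A B where y: "y = Fract A B" "B \<noteq> 0" by (rule fract_repr)
  obtain C D where z: "z = Fract C D" "D \<noteq> 0" by (rule fract_repr)
  show ?thesis using y z
    by (simp add: fract_deriv_Fract eq_fract pderiv_mult pderiv_add algebra_simps)
qed

lemma fract_deriv_0 [simp]: "fract_deriv 0 = 0" and fract_deriv_1 [simp]: "fract_deriv 1 = 0"
  using fract_deriv_const[of 0] fract_deriv_const[of 1] by simp_all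

lemma fract_deriv_uminus: "fract_deriv (- z) = - fract_deriv z"
  by (rule minus_unique[symmetric]) (simp flip: fract_deriv_add)

lemma fract_deriv_diff: "fract_deriv (y - z) = fract_deriv y - fract_deriv z"
  using fract_deriv_add[of y "- z"] by (simp add: fract_deriv_uminus)

lemma fract_deriv_divide:
  assumes "z \<noteq> 0"
  shows "fract_deriv (y / z) = (fract_deriv y * z - y * fract_deriv z) / z ^ 2"
proof -
  have "fract_deriv y = fract_deriv (y / z * z)" using assms by simp
  also have "\<dots> = fract_deriv (y / z) * z + y / z * fract_deriv z" by (rule fract_deriv_mult)
  finally show ?thesis using assms by (simp add: field_simps power2_eq_square)
qed

lemma fract_deriv_power: "fract_deriv (z ^ n) = of_nat n * z ^ (n - 1) * fract_deriv z"
proof (induction n)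
  case (Suc n)
  then show ?case by (cases n) (simp_all add: fract_deriv_mult algebra_simps)
qed simp

subsection \<open>Evaluation and pullback\<close>

lemma eval_at_pCons [simp]: "eval_at x (pCons c A) = fract_const c + x * eval_at x A"
  by (simp add: eval_at_def map_poly_pCons)

lemma eval_at_0 [simp]: "eval_at x 0 = 0" by (simp add: eval_at_def)

lemma eval_at_1 [simp]: "eval_at x 1 = 1" by (simp add: one_pCons)

lemma eval_at_add [simp]: "eval_at x (A + B) = eval_at x A + eval_at x B"
proof (induction A arbitrary: B)
  case (pCons c A)
  show ?case by (cases B) (simp only: add_pCons eval_at_pCons pCons.IH fract_const_simps, simp add: algebra_simps)
qed simp

lemma eval_at_smult [simp]: "eval_at x (Polynomial.smult c A) = fract_const c * eval_at x A"
  by (induction A) (simp_all add: algebra_simps)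

lemma eval_at_mult [simp]: "eval_at x (A * B) = eval_at x A * eval_at x B"
  by (induction A) (simp_all add: algebra_simps)

lemma eval_at_uminus [simp]: "eval_at x (- A) = - eval_at x A"
  by (rule minus_unique[symmetric]) (simp flip: eval_at_add)

lemma eval_at_diff [simp]: "eval_at x (A - B) = eval_at x A - eval_at x B"
  using eval_at_add[of x A "- B"] by simp

lemma eval_at_power [simp]: "eval_at x (A ^ n) = eval_at x A ^ n"
  by (induction n) simp_all

lemma eval_at_monom [simp]: "eval_at x (monom c n) = fract_const c * x ^ n"
  by (simp add: monom_altdef)

lemma eval_at_var: "eval_at fract_var A = to_fract A"
  by (induction A) (simp_all add: to_fract_pCons)

text \<open>Transcendence over L. It makes evaluation injective on polynomials, so the description
  in \<open>pullback\<close> accepts every denominator and \<open>pullback x\<close> is a field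
  homomorphism.\<close>

definition nonconstant :: "'l::field poly fract \<Rightarrow> bool" where
  "nonconstant x \<longleftrightarrow> (\<forall>A. eval_at x A = 0 \<longrightarrow> A = 0)"

lemma nonconstant_var: "nonconstant fract_var"
  by (simp add: nonconstant_def eval_at_var)

context
  fixes x :: "'l::field poly fract"
  assumes x: "nonconstant x"
begin

lemma eval_at_eq_0 [simp]: "eval_at x A = 0 \<longleftrightarrow> A = 0"
  using x by (auto simp: nonconstant_def)

lemma pullback_Fract:
  assumes "B \<noteq> 0" shows "pullback x (Fract A B) = eval_at x A / eval_at x B"
  unfolding pullback_def
proof (rule the_equality)
  show "\<exists>A' B'. Fract A B = Fract A' B' \<and> eval_at x B' \<noteq> 0 \<and>
      eval_at x A / eval_at x B = eval_at x A' / eval_at x B'" using assms by auto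
  fix w assume "\<exists>A' B'. Fract A B = Fract A' B' \<and> eval_at x B' \<noteq> 0 \<and> w = eval_at x A' / eval_at x B'"
  then obtain A' B' where *: "Fract A B = Fract A' B'" "B' \<noteq> 0" "w = eval_at x A' / eval_at x B'"
    by auto
  then have "A * B' = A' * B" using assms by (simp add: eq_fract)
  then have "eval_at x A * eval_at x B' = eval_at x A' * eval_at x B" by (metis eval_at_mult)
  then show "w = eval_at x A / eval_at x B" using * assms by (simp add: nonzero_divide_eq_eq frac_eq_eq)
qed

lemma pullback_to_fract [simp]: "pullback x (to_fract A) = eval_at x A"
  unfolding to_fract_def by (subst pullback_Fract) simp_all

lemma pullback_add [simp]: "pullback x (y + z) = pullback x y + pullback x z"
proof -
  obtain A B where y: "y = Fract A B" "B \<noteq> 0" by (rule fract_repr)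
  obtain C D where z: "z = Fract C D" "D \<noteq> 0" by (rule fract_repr)
  show ?thesis using y z by (simp add: pullback_Fract field_simps)
qed

lemma pullback_mult [simp]: "pullback x (y * z) = pullback x y * pullback x z"
proof -
  obtain A B where y: "y = Fract A B" "B \<noteq> 0" by (rule fract_repr)
  obtain C D where z: "z = Fract C D" "D \<noteq> 0" by (rule fract_repr)
  show ?thesis using y z by (simp add: pullback_Fract field_simps)
qed

lemma pullback_const [simp]: "pullback x (fract_const c) = fract_const c"
  by (simp add: fract_const_conv)

lemma pullback_0 [simp]: "pullback x 0 = 0" and pullback_1 [simp]: "pullback x 1 = 1"
  using pullback_const[of 0] pullback_const[of 1] by simp_all

lemma pullback_var [simp]: "pullback x fract_var = x"
  by (simp add: fract_var_conv)

lemma pullback_uminus [simp]: "pullback x (- z) = - pullback x z"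
  by (rule minus_unique[symmetric]) (simp flip: pullback_add)

lemma pullback_diff [simp]: "pullback x (y - z) = pullback x y - pullback x z"
  using pullback_add[of y "- z"] by simp

lemma pullback_power [simp]: "pullback x (z ^ n) = pullback x z ^ n"
  by (induction n) simp_all

lemma pullback_eq_0 [simp]: "pullback x z = 0 \<longleftrightarrow> z = 0"
proof -
  obtain A B where z: "z = Fract A B" "B \<noteq> 0" "z = to_fract A / to_fract B" by (rule fract_repr)
  have "pullback x z = eval_at x A / eval_at x B" unfolding z(1) by (rule pullback_Fract[OF z(2)])
  then show ?thesis using z(2,3) by simp
qed

lemma pullback_inverse [simp]: "pullback x (inverse z) = inverse (pullback x z)"
proof (cases "z = 0")
  case False
  then have "pullback x z * pullback x (inverse z) = 1" by (simp flip: pullback_mult)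
  then show ?thesis by (simp add: inverse_unique)
qed simp

lemma pullback_divide [simp]: "pullback x (y / z) = pullback x y / pullback x z"
  by (simp add: divide_inverse)

end

lemma pullback_fract_var [simp]: "pullback fract_var z = z"
proof -
  obtain A B where z: "z = Fract A B" "B \<noteq> 0" "z = to_fract A / to_fract B" by (rule fract_repr)
  then show ?thesis by (simp add: pullback_Fract[OF nonconstant_var] eval_at_var)
qed

section \<open>Discrete valuation rings\<close>

text \<open>A local domain inside an ambient field, with principal maximal ideal and a chosen
  generator. Orders of vanishing are expressed by membership in \<open>mpow n\<close>;
  \<open>unif_power_unit_mpow\<close> takes the place of a valuation.\<close>

locale dvr =
  fixes R :: "'a::field set" and \<pi> :: 'a
  assumes one_mem [simp]: "1 \<in> R"
    and add_mem: "a \<in> R \<Longrightarrow> b \<in> R \<Longrightarrow> a + b \<in> R"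
    and uminus_mem: "a \<in> R \<Longrightarrow> - a \<in> R"
    and mult_mem: "a \<in> R \<Longrightarrow> b \<in> R \<Longrightarrow> a * b \<in> R"
    and unif_mem [simp]: "\<pi> \<in> R"
    and unif_nz [simp]: "\<pi> \<noteq> 0"
    and unif_nonunit: "inverse \<pi> \<notin> R"
    and unif_or_unit: "z \<in> R \<Longrightarrow> (\<exists>w\<in>R. z = \<pi> * w) \<or> inverse z \<in> R"
begin

definition mpow :: "nat \<Rightarrow> 'a set" where
  "mpow n = (\<lambda>z. \<pi> ^ n * z) ` R"

text \<open>Nonvanishing has to be demanded, since \<open>inverse 0 = 0\<close>.\<close>

definition unit :: "'a \<Rightarrow> bool" where
  "unit z \<longleftrightarrow> z \<noteq> 0 \<and> z \<in> R \<and> inverse z \<in> R"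

lemma zero_mem [simp]: "0 \<in> R"
  using add_mem[OF one_mem uminus_mem[OF one_mem]] by simp

lemma diff_mem: "a \<in> R \<Longrightarrow> b \<in> R \<Longrightarrow> a - b \<in> R"
  using add_mem[of a "- b"] uminus_mem by simp

lemma power_mem: "a \<in> R \<Longrightarrow> a ^ n \<in> R"
  by (induction n) (simp_all add: mult_mem)

lemma sum_mem: "(\<And>i. i \<in> A \<Longrightarrow> f i \<in> R) \<Longrightarrow> sum f A \<in> R"
  by (induction A rule: infinite_finite_induct) (simp_all add: add_mem)

lemma unit_mem: "unit z \<Longrightarrow> z \<in> R" and unit_nz: "unit z \<Longrightarrow> z \<noteq> 0"
  by (simp_all add: unit_def)

lemma unit_1 [simp]: "unit 1" by (simp add: unit_def)

lemma unit_mult: "unit y \<Longrightarrow> unit z \<Longrightarrow> unit (y * z)"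
  by (simp add: unit_def mult_mem)

lemma unit_inverse: "unit z \<Longrightarrow> unit (inverse z)"
  by (simp add: unit_def)

lemma unit_uminus: "unit z \<Longrightarrow> unit (- z)"
  by (simp add: unit_def uminus_mem)

lemma unit_power: "unit z \<Longrightarrow> unit (z ^ n)"
  by (induction n) (simp_all add: unit_mult)

lemma unit_divide: "unit y \<Longrightarrow> unit z \<Longrightarrow> unit (y / z)"
  by (simp add: divide_inverse unit_mult unit_inverse)

lemma unit_factors:
  assumes "unit (y * z)" "y \<in> R" "z \<in> R" shows "unit y" "unit z"
proof -
  have nz: "y \<noteq> 0" "z \<noteq> 0" using assms(1) by (auto simp: unit_def)
  then have *: "inverse y = inverse (y * z) * z" "inverse z = inverse (y * z) * y"
    by (simp_all add: field_simps)
  have "inverse (y * z) \<in> R" using assms(1) by (simp add: unit_def)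
  then show "unit y" "unit z" using assms(2,3) nz unfolding unit_def by (metis * mult_mem)+
qed

lemma mpow_0 [simp]: "mpow 0 = R" by (simp add: mpow_def)

lemma mpow_memI: "z \<in> R \<Longrightarrow> \<pi> ^ n * z \<in> mpow n" by (auto simp: mpow_def)

lemma mpow_memE:
  assumes "z \<in> mpow n" obtains w where "w \<in> R" "z = \<pi> ^ n * w"
  using assms by (auto simp: mpow_def)

lemma mpow_1E:
  assumes "z \<in> mpow 1" obtains w where "w \<in> R" "z = \<pi> * w"
  using assms by (auto simp: mpow_def)

lemma mpow_1I: "z \<in> R \<Longrightarrow> \<pi> * z \<in> mpow 1" using mpow_memI[of z 1] by simp

lemma mpow_add: "a \<in> mpow n \<Longrightarrow> b \<in> mpow n \<Longrightarrow> a + b \<in> mpow n"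
  by (elim mpow_memE) (metis add_mem distrib_left mpow_memI)

lemma mpow_uminus: "a \<in> mpow n \<Longrightarrow> - a \<in> mpow n"
  by (elim mpow_memE) (metis uminus_mem mult_minus_right mpow_memI)

lemma mpow_diff: "a \<in> mpow n \<Longrightarrow> b \<in> mpow n \<Longrightarrow> a - b \<in> mpow n"
  using mpow_add[of a n "- b"] mpow_uminus by simp

lemma mpow_diff_commute: "a - b \<in> mpow n \<longleftrightarrow> b - a \<in> mpow n"
  using mpow_uminus[of "a - b" n] mpow_uminus[of "b - a" n] by auto

lemma mpow_zero [simp]: "0 \<in> mpow n" using mpow_memI[of 0 n] by simp

lemma mpow_sum: "(\<And>i. i \<in> A \<Longrightarrow> f i \<in> mpow m) \<Longrightarrow> sum f A \<in> mpow m"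
  by (induction A rule: infinite_finite_induct) (simp_all add: mpow_add)

lemma mpow_mult: "a \<in> mpow m \<Longrightarrow> b \<in> mpow n \<Longrightarrow> a * b \<in> mpow (m + n)"
proof (elim mpow_memE)
  fix w w' assume "w \<in> R" "a = \<pi> ^ m * w" "w' \<in> R" "b = \<pi> ^ n * w'"
  then show ?thesis using mpow_memI[of "w * w'" "m + n"] by (simp add: mult_mem power_add mult_ac)
qed

lemma mpow_mult_left: "a \<in> R \<Longrightarrow> b \<in> mpow n \<Longrightarrow> a * b \<in> mpow n"
  using mpow_mult[of a 0 b n] by simp

lemma mpow_mult_right: "a \<in> mpow n \<Longrightarrow> b \<in> R \<Longrightarrow> a * b \<in> mpow n"
  using mpow_mult_left[of b a n] by (simp add: mult.commute)

lemma unif_mpow_1 [simp]: "\<pi> \<in> mpow 1" using mpow_1I[of 1] by simp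

lemma unif_power_mpow [simp]: "\<pi> ^ n \<in> mpow n" using mpow_memI[of 1 n] by simp

lemma mpow_antimono: "m \<le> n \<Longrightarrow> mpow n \<subseteq> mpow m"
proof
  fix z assume "m \<le> n" "z \<in> mpow n"
  then obtain w where "w \<in> R" "z = \<pi> ^ n * w" by (elim mpow_memE)
  then show "z \<in> mpow m"
    using mpow_memI[of "\<pi> ^ (n - m) * w" m] \<open>m \<le> n\<close>
    by (simp add: mult_mem power_mem mult.assoc[symmetric] flip: power_add)
qed

lemma mpow_mem: "z \<in> mpow n \<Longrightarrow> z \<in> R"
  using mpow_antimono[of 0 n] by auto

lemma unit_not_mpow: "unit u \<Longrightarrow> u \<notin> mpow 1"
proof
  assume u: "unit u" "u \<in> mpow 1"
  then obtain w where w: "w \<in> R" "u = \<pi> * w" by (elim mpow_1E)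
  then have "inverse \<pi> = inverse u * w" using u by (simp add: unit_def)
  then have "inverse \<pi> \<in> R" using u(1) w(1) by (metis unit_def mult_mem)
  then show False using unif_nonunit by simp
qed

lemma unit_iff: "unit u \<longleftrightarrow> u \<in> R \<and> u \<notin> mpow 1"
proof
  assume "u \<in> R \<and> u \<notin> mpow 1"
  then show "unit u" using unif_or_unit[of u] mpow_1I mpow_zero[of 1] unfolding unit_def by metis
qed (metis unit_not_mpow unit_mem)

lemma unif_power_unit_mpow:
  assumes "unit u" shows "\<pi> ^ n * u \<in> mpow m \<longleftrightarrow> m \<le> n"
proof
  assume "\<pi> ^ n * u \<in> mpow m"
  then obtain w where w: "w \<in> R" "\<pi> ^ n * u = \<pi> ^ m * w" by (elim mpow_memE)
  show "m \<le> n"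
  proof (rule ccontr)
    assume "\<not> m \<le> n"
    then obtain k where "m = Suc (n + k)" using less_iff_Suc_add[of n m] by auto
    then have "\<pi> ^ n * u = \<pi> ^ n * (\<pi> * (\<pi> ^ k * w))" using w(2) by (simp add: power_add mult_ac)
    then have "u = \<pi> * (\<pi> ^ k * w)" by simp
    then have "u \<in> mpow 1" using mpow_1I[of "\<pi> ^ k * w"] w(1) by (simp add: mult_mem power_mem)
    then show False using unit_not_mpow assms by blast
  qed
next
  assume "m \<le> n"
  then show "\<pi> ^ n * u \<in> mpow m"
    using mpow_antimono mpow_memI[OF unit_mem[OF assms], of n] by blast
qed

lemma nonunits: "{z \<in> R. \<not> (\<exists>w\<in>R. z * w = 1)} = mpow 1"
proof -
  have "(\<exists>w\<in>R. z * w = 1) \<longleftrightarrow> unit z" if "z \<in> R" for z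
  proof
    assume "\<exists>w\<in>R. z * w = 1"
    then show "unit z" using that unfolding unit_def by (metis inverse_unique mult_zero_left zero_neq_one)
  next
    assume "unit z" then show "\<exists>w\<in>R. z * w = 1"
      by (intro bexI[of _ "inverse z"]) (simp_all add: unit_def)
  qed
  then show ?thesis using mpow_mem by (auto simp: unit_iff)
qed

text \<open>All stalks that occur are principal, so tensor products and, by
  \<open>hom_multiples\<close>, Hom bundles reduce to multiplying and dividing generators.\<close>

lemma ideal_prod_multiples:
  "(\<lambda>z. a * z) ` R \<odot> (\<lambda>z. b * z) ` R = (\<lambda>z. a * b * z) ` R"
proof
  show "(\<lambda>z. a * z) ` R \<odot> (\<lambda>z. b * z) ` R \<subseteq> (\<lambda>z. a * b * z) ` R"
  proof
    fix s assume "s \<in> (\<lambda>z. a * z) ` R \<odot> (\<lambda>z. b * z) ` R"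
    then obtain xs where xs: "s = (\<Sum>(c, d)\<leftarrow>xs. c * d)"
      "set xs \<subseteq> (\<lambda>z. a * z) ` R \<times> (\<lambda>z. b * z) ` R" by (auto simp: ideal_prod_def)
    from xs(2) have "(\<Sum>(c, d)\<leftarrow>xs. c * d) \<in> (\<lambda>z. a * b * z) ` R"
    proof (induction xs)
      case Nil
      then show ?case by (auto intro!: image_eqI[of _ _ 0])
    next
      case (Cons cd xs)
      then obtain c d where "cd = (a * c, b * d)" "c \<in> R" "d \<in> R" by auto
      moreover obtain e where "e \<in> R" "(\<Sum>(c, d)\<leftarrow>xs. c * d) = a * b * e" using Cons by auto
      ultimately show ?case
        by (auto intro!: image_eqI[of _ _ "c * d + e"] simp: add_mem mult_mem algebra_simps)
    qed
    then show "s \<in> (\<lambda>z. a * b * z) ` R" by (simp add: xs(1))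
  qed
  show "(\<lambda>z. a * b * z) ` R \<subseteq> (\<lambda>z. a * z) ` R \<odot> (\<lambda>z. b * z) ` R"
  proof
    fix s assume "s \<in> (\<lambda>z. a * b * z) ` R"
    then obtain z where "z \<in> R" "s = a * b * z" by auto
    then show "s \<in> (\<lambda>z. a * z) ` R \<odot> (\<lambda>z. b * z) ` R"
      unfolding ideal_prod_def by (auto intro!: exI[of _ "[(a * 1, b * z)]"] simp: mult_ac)
  qed
qed

text \<open>Meant for sets N that need not be R-submodules, such as the derivatives of all regular
  functions or the pullback of an ideal: one member must divide all the others.\<close>

lemma ideal_prod_principal:
  assumes "e \<in> N" "N \<subseteq> (\<lambda>z. e * z) ` R"
  shows "R \<odot> N = (\<lambda>z. e * z) ` R"
proof
  have "R \<odot> N \<subseteq> (\<lambda>z. 1 * z) ` R \<odot> (\<lambda>z. e * z) ` R"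
    using assms(2) unfolding ideal_prod_def by fastforce
  then show "R \<odot> N \<subseteq> (\<lambda>z. e * z) ` R" unfolding ideal_prod_multiples by simp
  show "(\<lambda>z. e * z) ` R \<subseteq> R \<odot> N"
  proof
    fix s assume "s \<in> (\<lambda>z. e * z) ` R"
    then obtain z where "z \<in> R" "s = e * z" by auto
    then show "s \<in> R \<odot> N"
      using assms(1) unfolding ideal_prod_def by (auto intro!: exI[of _ "[(z, e)]"] simp: mult_ac)
  qed
qed

lemma multiples_eq_iff:
  assumes "a \<noteq> 0" shows "(\<lambda>z. a * z) ` R = (\<lambda>z. b * z) ` R \<longleftrightarrow> (\<exists>u. unit u \<and> b = a * u)"
proof
  assume eq: "(\<lambda>z. a * z) ` R = (\<lambda>z. b * z) ` R"
  have "b * 1 \<in> (\<lambda>z. a * z) ` R" unfolding eq by (rule imageI) simp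
  then obtain u where u: "u \<in> R" "b = a * u" by auto
  have "a * 1 \<in> (\<lambda>z. b * z) ` R" unfolding eq[symmetric] by (rule imageI) simp
  then obtain v where v: "v \<in> R" "a = b * v" by auto
  then have "u * v = 1" using u assms by (metis mult.assoc mult_cancel_left1)
  then show "\<exists>u. unit u \<and> b = a * u" using u v
    by (metis inverse_unique mult_zero_left unit_def zero_neq_one)
next
  assume "\<exists>u. unit u \<and> b = a * u"
  then obtain u where u: "unit u" "b = a * u" by blast
  then show "(\<lambda>z. a * z) ` R = (\<lambda>z. b * z) ` R"
  proof (intro subset_antisym subsetI; elim imageE)
    fix s z assume z: "s = a * z" "z \<in> R"
    then show "s \<in> (\<lambda>z. b * z) ` R" using u
      by (intro image_eqI[of _ _ "inverse u * z"]) (auto simp: unit_def mult_mem)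
  next
    fix s z assume z: "s = b * z" "z \<in> R"
    then show "s \<in> (\<lambda>z. a * z) ` R" using u
      by (intro image_eqI[of _ _ "u * z"]) (auto simp: unit_def mult_mem)
  qed
qed

end

section \<open>Local rings of the projective line\<close>

lemma (in dvr) hom_multiples:
  assumes "a \<noteq> 0"
  shows "{w. \<forall>m \<in> (\<lambda>z. a * z) ` R. w * m \<in> (\<lambda>z. b * z) ` R} = (\<lambda>z. b / a * z) ` R"
proof (intro subset_antisym subsetI)
  fix w assume "w \<in> {w. \<forall>m \<in> (\<lambda>z. a * z) ` R. w * m \<in> (\<lambda>z. b * z) ` R}"
  then have "\<forall>m \<in> (\<lambda>z. a * z) ` R. w * m \<in> (\<lambda>z. b * z) ` R" by (simp only: mem_Collect_eq)
  moreover have "a * 1 \<in> (\<lambda>z. a * z) ` R" by (rule imageI) simp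
  ultimately have "w * (a * 1) \<in> (\<lambda>z. b * z) ` R" by (rule bspec)
  then obtain z where "z \<in> R" "w * a = b * z" unfolding mult_1_right by (elim imageE)
  then have "w = b / a * z" using assms by (simp add: nonzero_eq_divide_eq)
  then show "w \<in> (\<lambda>z. b / a * z) ` R" using \<open>z \<in> R\<close> by (rule image_eqI)
next
  fix w assume "w \<in> (\<lambda>z. b / a * z) ` R"
  then obtain z where z: "z \<in> R" "w = b / a * z" by (elim imageE)
  have "w * (a * v) \<in> (\<lambda>z. b * z) ` R" if "v \<in> R" for v
    using z that assms by (intro image_eqI[of _ _ "z * v"]) (simp_all add: mult_mem)
  then show "w \<in> {w. \<forall>m \<in> (\<lambda>z. a * z) ` R. w * m \<in> (\<lambda>z. b * z) ` R}" by (simp add: ball_simps)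
qed

locale dvr_over = dvr R \<pi> for R :: "'l::field poly fract set" and \<pi> +
  assumes const_mem [simp]: "fract_const c \<in> R"
begin

lemma unit_const: "c \<noteq> 0 \<Longrightarrow> unit (fract_const c)"
  using const_mem[of "inverse c"] by (simp add: unit_def)

lemma const_mpow_1: "fract_const c \<in> mpow 1 \<longleftrightarrow> c = 0"
  using unit_const[of c] unit_not_mpow mpow_zero by auto

lemma eval_at_mem: "x \<in> R \<Longrightarrow> eval_at x A \<in> R"
  by (induction A) (simp_all add: add_mem mult_mem)

text \<open>A(f) / f^D is the reversed polynomial evaluated at 1/f, whose constant term is the
  coefficient at s^D. D may exceed the degree, so that several polynomials can share one
  bound.\<close>

lemma eval_at_pole:
  assumes f: "f \<noteq> 0" "inverse f \<in> R" and "degree A \<le> D"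
  shows "\<exists>z\<in>R. eval_at f A / f ^ D = fract_const (coeff A D) + inverse f * z"
  using assms(3)
proof (induction A arbitrary: D)
  case 0
  then show ?case by (auto intro!: bexI[of _ 0])
next
  case (pCons c A)
  show ?case
  proof (cases D)
    case 0
    then have "A = 0" using pCons.prems by (simp split: if_splits)
    then show ?thesis using 0 by (auto intro!: bexI[of _ 0])
  next
    case (Suc E)
    then have "degree A \<le> E" using pCons.prems by (simp split: if_splits)
    from pCons.IH[OF this] obtain z where z: "z \<in> R"
      "eval_at f A / f ^ E = fract_const (coeff A E) + inverse f * z" by blast
    have "eval_at f (pCons c A) / f ^ Suc E = inverse f * (fract_const c * inverse f ^ E) + eval_at f A / f ^ E"
      using f(1) by (simp add: field_simps)
    also have "\<dots> = fract_const (coeff (pCons c A) (Suc E))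
        + inverse f * (fract_const c * inverse f ^ E + z)"
      unfolding z(2) by (simp add: algebra_simps)
    finally show ?thesis using z(1) f(2) Suc
      by (intro bexI[of _ "fract_const c * inverse f ^ E + z"]) (simp_all only: add_mem mult_mem power_mem const_mem)
  qed
qed

lemma eval_at_pole_unit:
  assumes f: "f \<noteq> 0" "inverse f \<in> mpow 1" and "A \<noteq> 0"
  obtains u where "unit u" "eval_at f A = f ^ degree A * u"
proof -
  obtain z where z: "z \<in> R" "eval_at f A / f ^ degree A = fract_const (lead_coeff A) + inverse f * z"
    using eval_at_pole[OF f(1) mpow_mem[OF f(2)] order_refl, of A] by blast
  have i: "inverse f * z \<in> mpow 1" using f(2) z(1) by (rule mpow_mult_right)
  have "unit (eval_at f A / f ^ degree A)"
    unfolding unit_iff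
  proof
    show "eval_at f A / f ^ degree A \<in> R" unfolding z(2) by (intro add_mem const_mem mpow_mem[OF i])
    show "eval_at f A / f ^ degree A \<notin> mpow 1"
    proof
      assume "eval_at f A / f ^ degree A \<in> mpow 1"
      from mpow_diff[OF this i] have "fract_const (lead_coeff A) \<in> mpow 1" unfolding z(2) by simp
      with assms(3) show False by (simp only: const_mpow_1 leading_coeff_0_iff)
    qed
  qed
  then show thesis using f(1) by (intro that[of "eval_at f A / f ^ degree A"]) simp_all
qed

lemma nonconstant_of_pole:
  assumes f: "f \<noteq> 0" "inverse f \<in> mpow 1" shows "nonconstant f"
  unfolding nonconstant_def
proof (intro allI impI, rule ccontr)
  fix A assume "eval_at f A = 0" "A \<noteq> 0"
  then show False using eval_at_pole_unit[OF f \<open>A \<noteq> 0\<close>] f(1) unit_nz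
    by (metis mult_eq_0_iff power_not_zero)
qed

text \<open>The map sends such a point to infinity. A(f) is f^(deg A) times a unit, so comparing the
  degrees of numerator and denominator decides regularity.\<close>

lemma pullback_mem_iff_of_pole:
  assumes f: "f \<noteq> 0" "inverse f \<in> mpow 1"
  shows "pullback f z \<in> R \<longleftrightarrow> z \<in> local_ring Infinity"
proof -
  note nc = nonconstant_of_pole[OF f]
  obtain A B where z: "z = Fract A B" "B \<noteq> 0" "z = to_fract A / to_fract B" by (rule fract_repr)
  have iff: "z \<in> local_ring Infinity \<longleftrightarrow> degree A \<le> degree B"
  proof
    assume "z \<in> local_ring Infinity"
    then obtain C D where CD: "z = Fract C D" "D \<noteq> 0" "degree C \<le> degree D" by auto
    have "A * D = C * B" using z(1,2) CD(1,2) by (simp add: eq_fract)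
    then have "degree (A * D) = degree (C * B)" by simp
    then show "degree A \<le> degree B" using CD z(2)
      by (cases "A = 0"; cases "C = 0") (auto simp: degree_mult_eq)
  qed (use z in auto)
  show ?thesis
  proof (cases "A = 0")
    case True
    then show ?thesis using z iff by (simp add: nc)
  next
    case False
    obtain u where u: "unit u" "eval_at f A = f ^ degree A * u" by (rule eval_at_pole_unit[OF f False])
    obtain v where v: "unit v" "eval_at f B = f ^ degree B * v" by (rule eval_at_pole_unit[OF f z(2)])
    have eq: "pullback f z = (u / v) * (f ^ degree A / f ^ degree B)"
      using z(1,2) u v by (simp add: pullback_Fract[OF nc] mult_ac)
    have uv: "unit (u / v)" using u v by (simp add: unit_divide)
    show ?thesis
    proof (cases "degree A \<le> degree B")
      case True
      then have "f ^ degree A / f ^ degree B = inverse f ^ (degree B - degree A)"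
        using f(1) by (simp add: power_diff field_simps)
      then have "pullback f z \<in> R" unfolding eq
        using unit_mem[OF uv] power_mem[OF mpow_mem[OF f(2)]] by (simp only: mult_mem)
      then show ?thesis using iff True by simp
    next
      case lt: False
      have "pullback f z \<notin> R"
      proof
        assume mem: "pullback f z \<in> R"
        \<comment> \<open>Splitting off one factor f presents the unit u/v as a multiple of 1/f,
          which lies in the maximal ideal.\<close>
        have "f ^ degree A / f ^ degree B = f * f ^ (degree A - degree B - 1)"
          using f(1) lt by (simp add: field_simps flip: power_Suc power_add)
        then have "u / v = inverse f * (inverse f ^ (degree A - degree B - 1) * pullback f z)"
          unfolding eq using f(1) by (simp add: field_simps)
        moreover have "inverse f * (inverse f ^ (degree A - degree B - 1) * pullback f z) \<in> mpow 1"
          by (intro mpow_mult_right f(2) mult_mem power_mem mpow_mem[OF f(2)] mem)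
        ultimately show False using unit_not_mpow[OF uv] by simp
      qed
      then show ?thesis using iff lt by simp
    qed
  qed
qed



end

section \<open>Local rings at the closed points\<close>

fun uniformizer :: "'l::field poly point \<Rightarrow> 'l poly fract" where
  "uniformizer (Finite P) = to_fract P"
| "uniformizer Infinity = inverse fract_var"

lemma Fract_mem_Finite: "\<not> P dvd B \<Longrightarrow> Fract A B \<in> local_ring (Finite P)"
  by auto

lemma Fract_mem_Infinity: "B \<noteq> 0 \<Longrightarrow> degree A \<le> degree B \<Longrightarrow> Fract A B \<in> local_ring Infinity"
  by auto

lemma fract_mem_local_ring_Finite:
  assumes "irreducible P" "B \<noteq> 0" "U * A + V * B = 1"
  shows "Fract A B \<in> local_ring (Finite P) \<longleftrightarrow> \<not> P dvd B"
proof
  assume "Fract A B \<in> local_ring (Finite P)"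
  then obtain C D where CD: "Fract A B = Fract C D" "\<not> P dvd D" by auto
  have "D \<noteq> 0" using CD by auto
  then have eq: "A * D = C * B" using CD assms(2) by (simp add: eq_fract)
  show "\<not> P dvd B"
  proof
    assume B: "P dvd B"
    then have "P dvd A * D" unfolding eq by simp
    then have "P dvd A" using CD(2) irreducible_dvd_mult[OF assms(1)] by blast
    then have "P dvd U * A + V * B" using B by simp
    then show False using assms(1,3) irreducible_not_unit by metis
  qed
qed auto

lemma to_fract_mem_local_ring [simp]:
  "irreducible P \<Longrightarrow> to_fract A \<in> local_ring (Finite P)"
  unfolding to_fract_def by (rule Fract_mem_Finite) (rule irreducible_not_unit)

lemma inverse_to_fract_mem_local_ring:
  assumes "irreducible P"
  shows "inverse (to_fract A) \<in> local_ring (Finite P) \<longleftrightarrow> A = 0 \<or> \<not> P dvd A"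
proof (cases "A = 0")
  case True
  then show ?thesis using to_fract_mem_local_ring[OF assms, of 0] by simp
next
  case False
  then show ?thesis
    using fract_mem_local_ring_Finite[OF assms, of A 1 1 0] by (simp add: to_fract_def del: local_ring.simps)
qed

lemma dvr_over_Finite:
  assumes P: "irreducible P"
  shows "dvr_over (local_ring (Finite P)) (to_fract P)"
proof
  note dvd = irreducible_dvd_mult[OF P]
  have P0: "P \<noteq> 0" using P by auto
  show "1 \<in> local_ring (Finite P)" using to_fract_mem_local_ring[OF P, of 1] by simp
  show "to_fract P \<in> local_ring (Finite P)" by (rule to_fract_mem_local_ring[OF P])
  show "to_fract P \<noteq> 0" using P0 by simp
  show "inverse (to_fract P) \<notin> local_ring (Finite P)"
    using inverse_to_fract_mem_local_ring[OF P, of P] P0 by simp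
  show "fract_const c \<in> local_ring (Finite P)" for c
    unfolding fract_const_conv by (rule to_fract_mem_local_ring[OF P])
  fix a b assume "a \<in> local_ring (Finite P)" "b \<in> local_ring (Finite P)"
  then obtain A B C D where ab: "a = Fract A B" "\<not> P dvd B" "b = Fract C D" "\<not> P dvd D" by auto
  then have nz: "B \<noteq> 0" "D \<noteq> 0" by auto
  show "a + b \<in> local_ring (Finite P)"
    using ab nz by (simp add: Fract_mem_Finite dvd del: local_ring.simps)
  show "a * b \<in> local_ring (Finite P)"
    using ab nz by (simp add: Fract_mem_Finite dvd del: local_ring.simps)
next
  fix a assume "a \<in> local_ring (Finite P)"
  then obtain A B where ab: "a = Fract A B" "\<not> P dvd B" by auto
  then have nz: "B \<noteq> 0" by auto
  show "- a \<in> local_ring (Finite P)" using ab by (simp add: Fract_mem_Finite del: local_ring.simps)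
  show "(\<exists>w\<in>local_ring (Finite P). a = to_fract P * w) \<or> inverse a \<in> local_ring (Finite P)"
  proof (cases "P dvd A")
    case True
    then obtain A' where "A = P * A'" by (elim dvdE)
    then have "a = to_fract P * Fract A' B" using ab by (simp add: to_fract_def)
    then show ?thesis using Fract_mem_Finite[OF ab(2)] by blast
  next
    case False
    then have "inverse a \<in> local_ring (Finite P)" using ab by auto
    then show ?thesis ..
  qed
qed

lemma dvr_over_Infinity: "dvr_over (local_ring Infinity) (inverse fract_var :: 'l::field poly fract)"
proof
  let ?R = "local_ring Infinity :: 'l poly fract set"
  have c: "fract_const c \<in> ?R" for c :: 'l
    unfolding fract_const_def by (rule Fract_mem_Infinity) simp_all
  show "fract_const c \<in> ?R" for c by (rule c)
  show "1 \<in> ?R" using c[of 1] by simp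
  show "inverse fract_var \<in> ?R"
    unfolding fract_var_def by (simp add: Fract_mem_Infinity del: local_ring.simps)
  show "inverse fract_var \<noteq> (0 :: 'l poly fract)" by (simp add: fract_var_conv)
  show "inverse (inverse fract_var) \<notin> ?R"
  proof
    assume "inverse (inverse fract_var) \<in> ?R"
    then have "\<exists>A B. (fract_var :: 'l poly fract) = Fract A B \<and> B \<noteq> 0 \<and> degree A \<le> degree B" by simp
    then obtain A B :: "'l poly" where AB: "fract_var = Fract A B" "B \<noteq> 0" "degree A \<le> degree B" by metis
    then have "[:0, 1:] * B = A" by (simp add: fract_var_def eq_fract)
    then have "degree A = Suc (degree B)" using AB(2) by (auto simp: degree_mult_eq)
    with AB(3) show False by simp
  qed
  fix a b assume "a \<in> ?R" "b \<in> ?R"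
  then obtain A B C D where ab: "a = Fract A B" "B \<noteq> 0" "degree A \<le> degree B"
    "b = Fract C D" "D \<noteq> 0" "degree C \<le> degree D" by auto
  have "degree (A * D + C * B) \<le> degree (B * D)"
    using ab degree_mult_le[of A D] degree_mult_le[of C B]
    by (intro degree_add_le) (auto simp: degree_mult_eq)
  then show "a + b \<in> ?R" using ab by (simp add: Fract_mem_Infinity del: local_ring.simps)
  have "degree (A * C) \<le> degree (B * D)"
    using ab degree_mult_le[of A C] by (auto simp: degree_mult_eq)
  then show "a * b \<in> ?R" using ab by (simp add: Fract_mem_Infinity del: local_ring.simps)
next
  let ?R = "local_ring Infinity :: 'l poly fract set"
  fix a assume "a \<in> ?R"
  then obtain A B where ab: "a = Fract A B" "B \<noteq> 0" "degree A \<le> degree B" by auto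
  show "- a \<in> ?R" using ab by (simp add: Fract_mem_Infinity del: local_ring.simps)
  show "(\<exists>w\<in>?R. a = inverse fract_var * w) \<or> inverse a \<in> ?R"
  proof (cases "degree A < degree B")
    case True
    have "a = inverse fract_var * Fract ([:0, 1:] * A) B"
      using ab by (simp add: fract_var_def eq_fract)
    moreover have "degree ([:0, 1:] * A) \<le> degree B" using True by (simp add: degree_pCons_eq_if)
    then have "Fract ([:0, 1:] * A) B \<in> ?R" using ab(2) by (intro Fract_mem_Infinity)
    ultimately show ?thesis by blast
  next
    case False
    show ?thesis
    proof (cases "A = 0")
      case True
      then have "a = inverse fract_var * Fract 0 B" using ab by (simp add: fract_var_def eq_fract)
      moreover have "Fract 0 B \<in> ?R" using ab(2) by (intro Fract_mem_Infinity) simp_all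
      ultimately show ?thesis by blast
    next
      case nz: False
      then have "inverse a \<in> ?R" using ab False by (simp add: Fract_mem_Infinity del: local_ring.simps)
      then show ?thesis ..
    qed
  qed
qed

lemma dvr_over_point: "q \<in> closed_points \<Longrightarrow> dvr_over (local_ring q) (uniformizer q)"
  by (auto simp: closed_points_def dvr_over_Infinity dvr_over_Finite simp del: local_ring.simps)

lemma max_ideal_eq:
  assumes "dvr (local_ring q) \<pi>" shows "max_ideal q = dvr.mpow (local_ring q) \<pi> 1"
  using dvr.nonunits[OF assms] by (simp add: max_ideal_def)

text \<open>The left side mentions no uniformizer, so this also transports powers between two
  uniformizers of the same point.\<close>

lemma max_ideal_pow_eq:
  assumes "dvr (local_ring q) \<pi>" shows "max_ideal_pow q n = dvr.mpow (local_ring q) \<pi> n"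
proof -
  interpret dvr "local_ring q" \<pi> by fact
  show ?thesis
  proof (induction n)
    case (Suc n)
    then show ?case
      unfolding max_ideal_pow.simps max_ideal_eq[OF assms] by (simp add: mpow_def ideal_prod_multiples)
  qed simp
qed

subsection \<open>Tangent and cotangent bundle\<close>

lemma degree_pderiv_le: "degree (pderiv A) \<le> degree A - 1" for A :: "'l::field poly"
  by (rule degree_le) (auto simp: coeff_pderiv intro!: coeff_eq_0)

lemma fract_deriv_Finite:
  assumes "irreducible P" "z \<in> local_ring (Finite P)"
  shows "fract_deriv z \<in> local_ring (Finite P)"
proof -
  obtain A B where z: "z = Fract A B" "\<not> P dvd B" using assms(2) by auto
  then have "B \<noteq> 0" by auto
  then show ?thesis using z irreducible_dvd_mult[OF assms(1)] by (auto simp: fract_deriv_Fract)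
qed

lemma residue_Infinity:
  assumes "z \<in> local_ring Infinity"
  obtains c A B where "z = fract_const c + Fract A B" "B \<noteq> 0" "A = 0 \<or> degree A < degree B"
proof -
  obtain A B where z: "z = Fract A B" "B \<noteq> 0" "degree A \<le> degree B" using assms by auto
  \<comment> \<open>The value at infinity. Taking the coefficient at the degree of B, not the
    leading one of A, gives 0 when the fraction is already proper.\<close>
  let ?c = "coeff A (degree B) / lead_coeff B"
  let ?A = "A - Polynomial.smult ?c B"
  have "z = fract_const ?c + Fract ?A B"
    using z by (simp add: fract_const_def eq_fract)
  moreover have "?A = 0 \<or> degree ?A < degree B"
  proof (cases "degree B = 0")
    case True
    then show ?thesis using z by (auto elim!: degree_eq_zeroE)
  next
    case False
    have "degree ?A \<le> degree B" using z(3) by (intro degree_diff_le) (auto intro: degree_smult_le)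
    moreover have "coeff ?A (degree B) = 0" using z(2) by simp
    ultimately show ?thesis using False by (metis le_neq_implies_less leading_coeff_0_iff)
  qed
  ultimately show thesis using that z(2) by blast
qed

lemma residue_Infinity_mpow:
  assumes "z \<in> local_ring Infinity"
  obtains c where "z - fract_const c \<in> dvr.mpow (local_ring Infinity) (inverse fract_var) 1"
proof -
  interpret dvr_over "local_ring Infinity" "inverse fract_var :: 'a poly fract" by (rule dvr_over_Infinity)
  obtain c A B where z: "z = fract_const c + Fract A B" "B \<noteq> 0" "A = 0 \<or> degree A < degree B"
    using residue_Infinity[OF assms] .
  have "Fract A B = inverse fract_var * Fract ([:0, 1:] * A) B"
    using z by (simp add: fract_var_def eq_fract)
  moreover have "degree ([:0, 1:] * A) \<le> degree B" using z(3) by (auto simp: degree_pCons_eq_if)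
  then have "Fract ([:0, 1:] * A) B \<in> local_ring Infinity" using z(2) by (intro Fract_mem_Infinity)
  ultimately have "z - fract_const c \<in> mpow 1" using z(1) mpow_1I by simp
  then show thesis by (rule that)
qed

text \<open>With w = 1/y the derivation y^2 d/dy is -d/dw. After the constant is removed the
  fraction is proper, and properness together with differentiation gains the two degrees that y^2
  costs.\<close>

lemma fract_deriv_Infinity:
  assumes "z \<in> local_ring Infinity"
  shows "fract_var\<^sup>2 * fract_deriv z \<in> local_ring Infinity"
proof -
  obtain c A B where z: "z = fract_const c + Fract A B" "B \<noteq> 0" "A = 0 \<or> degree A < degree B"
    using residue_Infinity[OF assms] .
  let ?N = "pderiv A * B - A * pderiv B"
  have "fract_var\<^sup>2 * fract_deriv z = Fract ([:0, 0, 1:] * ?N) (B * B)"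
    using z(1,2) by (simp add: fract_deriv_add fract_deriv_Fract fract_var_def power2_eq_square)
  moreover have "degree ([:0, 0, 1:] * ?N) \<le> degree (B * B)"
  proof (cases "?N = 0")
    case False
    then have A: "A \<noteq> 0" and lt: "degree A < degree B" using z(3) by auto
    have "degree (pderiv A * B) \<le> 2 * degree B - 2"
    proof (cases "degree A = 0")
      case True
      then show ?thesis by (auto elim!: degree_eq_zeroE simp: pderiv_pCons)
    next
      case False
      then show ?thesis using degree_mult_le[of "pderiv A" B] degree_pderiv_le[of A] lt by linarith
    qed
    moreover have "degree (A * pderiv B) \<le> 2 * degree B - 2"
      using degree_mult_le[of A "pderiv B"] degree_pderiv_le[of B] lt by linarith
    ultimately have "degree ?N \<le> 2 * degree B - 2" by (rule degree_diff_le)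
    moreover have "degree ([:0, 0, 1:] * ?N) \<le> 2 + degree ?N"
      using degree_mult_le[of "[:0, 0, 1:]" ?N] by simp
    ultimately show ?thesis using lt z(2) by (simp add: degree_mult_eq)
  qed simp
  ultimately show ?thesis using z(2) by (metis Fract_mem_Infinity mult_eq_0_iff)
qed

lemma cotangent_Finite:
  assumes P: "irreducible P" shows "cotangent (Finite P) = local_ring (Finite P)"
proof -
  interpret dvr_over "local_ring (Finite P)" "to_fract P" by (rule dvr_over_Finite[OF P])
  have "1 \<in> fract_deriv ` local_ring (Finite P)"
    by (rule image_eqI[of _ _ fract_var]) (simp_all add: fract_var_conv P pderiv_pCons del: local_ring.simps flip: one_pCons)
  then have "cotangent (Finite P) = (\<lambda>z. 1 * z) ` local_ring (Finite P)"
    unfolding cotangent_def differentials_def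
    by (intro ideal_prod_principal) (auto simp: fract_deriv_Finite[OF P] simp del: local_ring.simps)
  then show ?thesis by simp
qed

lemma fract_var_nz [simp]: "fract_var \<noteq> 0"
  by (simp add: fract_var_conv)

lemma fract_deriv_inverse_var: "fract_deriv (inverse fract_var) = - inverse (fract_var\<^sup>2)"
  using fract_deriv_divide[of fract_var 1] by (simp add: inverse_eq_divide)

text \<open>The differential of -1/y is y^(-2) dy, and by \<open>fract_deriv_Infinity\<close> it
  divides every other differential of a regular function.\<close>

lemma cotangent_Infinity:
  "cotangent Infinity = (\<lambda>z. inverse (fract_var\<^sup>2) * z) ` local_ring Infinity"
proof -
  interpret dvr_over "local_ring Infinity" "inverse fract_var" by (rule dvr_over_Infinity)
  show ?thesis unfolding cotangent_def differentials_def
  proof (rule ideal_prod_principal)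
    have "fract_deriv (- inverse fract_var) = inverse (fract_var\<^sup>2)"
      by (simp add: fract_deriv_uminus fract_deriv_inverse_var)
    moreover have "- inverse fract_var \<in> local_ring Infinity" by (intro uminus_mem unif_mem)
    ultimately show "inverse (fract_var\<^sup>2) \<in> fract_deriv ` local_ring Infinity" by (metis imageI)
    show "fract_deriv ` local_ring Infinity \<subseteq> (\<lambda>z. inverse (fract_var\<^sup>2) * z) ` local_ring Infinity"
    proof
      fix w assume "w \<in> fract_deriv ` local_ring Infinity"
      then obtain z where "z \<in> local_ring Infinity" "w = fract_deriv z" by blast
      then show "w \<in> (\<lambda>z. inverse (fract_var\<^sup>2) * z) ` local_ring Infinity"
        using fract_deriv_Infinity by (intro image_eqI[of _ _ "fract_var\<^sup>2 * fract_deriv z"]) simp_all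
    qed
  qed
qed

lemma tangent_Finite:
  assumes P: "irreducible P" shows "tangent (Finite P) = local_ring (Finite P)"
proof -
  interpret dvr_over "local_ring (Finite P)" "to_fract P" by (rule dvr_over_Finite[OF P])
  have "h \<in> local_ring (Finite P)" if "h \<in> tangent (Finite P)" for h
  proof -
    have "h * fract_deriv fract_var \<in> local_ring (Finite P)"
      using that to_fract_mem_local_ring[OF P, of "[:0, 1:]"] unfolding tangent_def fract_var_conv by blast
    then show ?thesis by simp
  qed
  then show ?thesis using fract_deriv_Finite[OF P] mult_mem unfolding tangent_def by blast
qed

lemma tangent_Infinity: "tangent Infinity = (\<lambda>z. fract_var\<^sup>2 * z) ` local_ring Infinity"
proof (intro subset_antisym subsetI)
  interpret dvr_over "local_ring Infinity" "inverse fract_var :: 'a poly fract" by (rule dvr_over_Infinity)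
  fix h :: "'a poly fract" assume "h \<in> tangent Infinity"
  then have "h * fract_deriv (inverse fract_var) \<in> local_ring Infinity"
    unfolding tangent_def using unif_mem by blast
  then have "- (h * - inverse (fract_var\<^sup>2)) \<in> local_ring Infinity"
    unfolding fract_deriv_inverse_var by (rule uminus_mem)
  then show "h \<in> (\<lambda>z. fract_var\<^sup>2 * z) ` local_ring Infinity"
    by (intro image_eqI[of _ _ "- (h * - inverse (fract_var\<^sup>2))"]) simp_all
next
  interpret dvr_over "local_ring Infinity" "inverse fract_var :: 'a poly fract" by (rule dvr_over_Infinity)
  fix h :: "'a poly fract" assume "h \<in> (\<lambda>z. fract_var\<^sup>2 * z) ` local_ring Infinity"
  then obtain w where w: "w \<in> local_ring Infinity" "h = fract_var\<^sup>2 * w" by blast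
  have "h * fract_deriv z \<in> local_ring Infinity" if "z \<in> local_ring Infinity" for z
    using mult_mem[OF w(1) fract_deriv_Infinity[OF that]] w(2) by (simp add: mult_ac)
  then show "h \<in> tangent Infinity" unfolding tangent_def by blast
qed


declare local_ring.simps [simp del]

section \<open>The residue form of a localized polynomial ring\<close>

lemma linear_form_onD:
  assumes "linear_form_on R \<mu>"
  shows "a \<in> R \<Longrightarrow> b \<in> R \<Longrightarrow> \<mu> (a + b) = \<mu> a + \<mu> b"
    and "a \<in> R \<Longrightarrow> \<mu> (fract_const c * a) = c * \<mu> a"
  using assms by (simp_all add: linear_form_on_def)

context dvr_over
begin

lemma linear_form_on_0:
  assumes "linear_form_on R \<mu>" shows "\<mu> 0 = 0"
  using linear_form_onD(2)[OF assms zero_mem, of 0] by simp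

lemma linear_form_on_uminus:
  assumes "linear_form_on R \<mu>" "a \<in> R" shows "\<mu> (- a) = - \<mu> a"
  using linear_form_onD(2)[OF assms, of "- 1"] by simp

lemma linear_form_on_diff:
  assumes "linear_form_on R \<mu>" "a \<in> R" "b \<in> R" shows "\<mu> (a - b) = \<mu> a - \<mu> b"
  using linear_form_onD(1)[OF assms(1), of a "- b"] linear_form_on_uminus assms by (simp add: uminus_mem)

lemma linear_form_on_sum:
  assumes "linear_form_on R \<mu>" "\<And>i. i \<in> A \<Longrightarrow> f i \<in> R" shows "\<mu> (sum f A) = (\<Sum>i\<in>A. \<mu> (f i))"
  using assms(2)
  by (induction A rule: infinite_finite_induct)
    (simp_all add: linear_form_on_0[OF assms(1)] linear_form_onD[OF assms(1)] sum_mem)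

lemma sum_list_mem: "(\<And>z. z \<in> set xs \<Longrightarrow> f z \<in> R) \<Longrightarrow> sum_list (map f xs) \<in> R"
  by (induction xs) (simp_all add: add_mem)

lemma linear_form_on_sum_list:
  assumes "linear_form_on R \<mu>" "\<And>z. z \<in> set xs \<Longrightarrow> f z \<in> R"
  shows "\<mu> (sum_list (map f xs)) = (\<Sum>z\<leftarrow>xs. \<mu> (f z))"
  using assms(2)
  by (induction xs)
    (simp_all add: linear_form_on_0[OF assms(1)] linear_form_onD[OF assms(1)] sum_list_mem)

lemma linear_form_on_mult:
  assumes "linear_form_on R \<mu>" "u \<in> R" shows "linear_form_on R (\<lambda>z. \<mu> (u * z))"
  unfolding linear_form_on_def
  by (simp add: distrib_left linear_form_onD(1)[OF assms(1)] linear_form_onD(2)[OF assms(1)]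
      mult_mem assms(2) mult.left_commute[of u])

end

text \<open>Since F = G^n u with u a unit, the ideal (F) and hence Q see only G^n. The quotient of
  the localization R is then L[s]/(G^n), so everything can be computed with polynomial
  remainders.\<close>

locale primary_quotient =
  fixes G :: "'l::field poly" and n :: nat
  assumes irr: "irreducible G" and monic: "lead_coeff G = 1" and n_pos: "n > 0"
begin

abbreviation "R \<equiv> local_ring (Finite G)"

sublocale dvr_over R "to_fract G" by (rule dvr_over_Finite[OF irr])

abbreviation "H \<equiv> G ^ n"

abbreviation "d \<equiv> degree H"

lemma G_nz: "G \<noteq> 0" using irr by auto

lemma degree_G_pos: "degree G > 0"
  using irr G_nz by (metis irreducible_not_unit is_unit_iff_degree neq0_conv)

lemma degree_G_power_pos: "m > 0 \<Longrightarrow> degree (G ^ m) > 0"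
  using degree_G_pos by (simp add: degree_power_eq G_nz)

lemma d_pos: "d > 0" using degree_G_power_pos n_pos .

lemma lead_coeff_H: "coeff H d = 1"
  using monic by (simp add: lead_coeff_power)

lemma to_fract_mem [simp]: "to_fract A \<in> R" by (rule to_fract_mem_local_ring[OF irr])

lemma fract_var_mem [simp]: "fract_var \<in> R" by (simp add: fract_var_conv)

lemma to_fract_mpow: "to_fract A \<in> mpow m \<longleftrightarrow> G ^ m dvd A"
proof
  assume "to_fract A \<in> mpow m"
  then obtain w where w: "w \<in> R" "to_fract A = to_fract G ^ m * w" by (elim mpow_memE)
  then obtain C D where CD: "w = Fract C D" "\<not> G dvd D" by (auto simp: local_ring.simps)
  then have "D \<noteq> 0" by auto
  then have "to_fract (A * D) = to_fract (G ^ m * C)"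
    using w(2) CD(1) by (simp add: Fract_conv_to_fract)
  then have eq: "A * D = G ^ m * C" by (simp only: to_fract_eq_iff)
  \<comment> \<open>D is invertible modulo G^m, which cancels it from A D = G^m C.\<close>
  obtain E where "G ^ m dvd 1 - D * E" using irreducible_inverse_mod[OF irr CD(2)] .
  then have "G ^ m dvd A * (1 - D * E) + A * D * E" unfolding eq by simp
  then show "G ^ m dvd A" by (simp add: algebra_simps)
next
  assume "G ^ m dvd A"
  then show "to_fract A \<in> mpow m" by (auto simp: mpow_memI elim!: dvdE)
qed

subsection \<open>Representatives of residue classes\<close>

text \<open>The polynomial remainder that realizes R/(G^m) = L[s]/(G^m). The exponent is a parameter
  because Q needs m = n, whereas the Bezoutian of F, an element that vanishes modulo G^n, has to be
  read off modulo G^(2n).\<close>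

definition rep :: "nat \<Rightarrow> 'l poly fract \<Rightarrow> 'l poly" where
  "rep m b = (THE r. r mod G ^ m = r \<and> b - to_fract r \<in> mpow m)"

lemma rep_eqI:
  assumes "b - to_fract A \<in> mpow m" shows "rep m b = A mod G ^ m"
  unfolding rep_def
proof (rule the_equality)
  have "to_fract A - to_fract (A mod G ^ m) = to_fract (G ^ m * (A div G ^ m))"
    by (metis to_fract_diff minus_mod_eq_mult_div)
  also have "\<dots> \<in> mpow m" unfolding to_fract_mpow by simp
  finally have "b - to_fract A + (to_fract A - to_fract (A mod G ^ m)) \<in> mpow m"
    by (rule mpow_add[OF assms])
  then show "A mod G ^ m mod G ^ m = A mod G ^ m \<and> b - to_fract (A mod G ^ m) \<in> mpow m" by simp
  fix r assume r: "r mod G ^ m = r \<and> b - to_fract r \<in> mpow m"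
  then have "(b - to_fract A) - (b - to_fract r) \<in> mpow m" using mpow_diff assms by blast
  then have "to_fract (r - A) \<in> mpow m" by simp
  then have "r mod G ^ m = A mod G ^ m" unfolding to_fract_mpow by (simp add: mod_eq_dvd_iff)
  with r show "r = A mod G ^ m" by simp
qed

lemma rep_exists:
  assumes "b \<in> R" obtains A where "b - to_fract A \<in> mpow m"
proof -
  obtain C D where CD: "b = Fract C D" "\<not> G dvd D" using assms by (auto simp: local_ring.simps)
  then have D0: "D \<noteq> 0" by auto
  obtain E where E: "G ^ m dvd 1 - D * E" using irreducible_inverse_mod[OF irr CD(2)] .
  have "b - to_fract (C * E) = to_fract (1 - D * E) * b"
    using D0 by (simp add: CD(1) Fract_conv_to_fract field_simps)
  moreover have "to_fract (1 - D * E) * b \<in> mpow m"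
    using E assms by (intro mpow_mult_right) (simp_all only: to_fract_mpow)
  ultimately have "b - to_fract (C * E) \<in> mpow m" by (simp only:)
  then show thesis by (rule that)
qed

lemma rep_cong: "b \<in> R \<Longrightarrow> b - to_fract (rep m b) \<in> mpow m"
  and rep_mod: "b \<in> R \<Longrightarrow> rep m b mod G ^ m = rep m b"
proof -
  assume b: "b \<in> R"
  then obtain A where A: "b - to_fract A \<in> mpow m" by (rule rep_exists)
  then have r: "rep m b = A mod G ^ m" by (rule rep_eqI)
  then show "rep m b mod G ^ m = rep m b" by simp
  have "to_fract A - to_fract (A mod G ^ m) = to_fract (G ^ m * (A div G ^ m))"
    by (metis to_fract_diff minus_mod_eq_mult_div)
  also have "\<dots> \<in> mpow m" unfolding to_fract_mpow by simp
  finally have "b - to_fract A + (to_fract A - to_fract (A mod G ^ m)) \<in> mpow m"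
    by (rule mpow_add[OF A])
  then show "b - to_fract (rep m b) \<in> mpow m" unfolding r by simp
qed

lemma degree_mod_G_power: "m > 0 \<Longrightarrow> degree (A mod G ^ m) < degree (G ^ m)"
  using degree_mod_less[of "G ^ m" A] degree_G_power_pos[of m] G_nz by fastforce

lemma degree_rep: "b \<in> R \<Longrightarrow> m > 0 \<Longrightarrow> degree (rep m b) < degree (G ^ m)"
  using degree_mod_G_power by (metis rep_mod)

lemma rep_to_fract: "rep m (to_fract A) = A mod G ^ m"
  by (rule rep_eqI) simp

lemma rep_add: "b \<in> R \<Longrightarrow> c \<in> R \<Longrightarrow> rep m (b + c) = rep m b + rep m c"
  by (subst rep_eqI[of _ "rep m b + rep m c"])
    (use mpow_add[OF rep_cong[of b m] rep_cong[of c m]] in \<open>simp_all add: algebra_simps poly_mod_add_left rep_mod\<close>)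

lemma rep_mult_to_fract:
  "b \<in> R \<Longrightarrow> rep m (to_fract A * b) = A * rep m b mod G ^ m"
  by (rule rep_eqI)
    (use mpow_mult_left[OF to_fract_mem rep_cong[of b m], of A] in \<open>simp add: algebra_simps\<close>)

lemma rep_scale: "b \<in> R \<Longrightarrow> rep m (fract_const e * b) = Polynomial.smult e (rep m b)"
  unfolding fract_const_conv by (simp add: rep_mult_to_fract mod_smult_left rep_mod)

lemma rep_eq_0_iff: "b \<in> R \<Longrightarrow> rep m b = 0 \<longleftrightarrow> b \<in> mpow m"
  using rep_cong[of b m] rep_eqI[of b 0 m] by auto

lemma linear_form_rep_coeff: "linear_form_on R (\<lambda>b. coeff (rep m b) j)"
  by (simp add: linear_form_on_def rep_add rep_scale)

subsection \<open>Inverting the Bezoutian\<close>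

text \<open>These are the elements of Hom(Q, L), viewed as forms on R.\<close>

definition vanishing_form :: "('l poly fract \<Rightarrow> 'l) \<Rightarrow> bool" where
  "vanishing_form \<mu> \<longleftrightarrow> linear_form_on R \<mu> \<and> (\<forall>z \<in> mpow n. \<mu> z = 0)"

lemma vanishing_formD:
  assumes "vanishing_form \<mu>"
  shows "linear_form_on R \<mu>" "z \<in> mpow n \<Longrightarrow> \<mu> z = 0"
  using assms by (simp_all add: vanishing_form_def)

lemma vanishing_form_cong:
  assumes "vanishing_form \<mu>" "a \<in> R" "b \<in> R" "a - b \<in> mpow n" shows "\<mu> a = \<mu> b"
  using linear_form_on_diff[OF vanishing_formD(1)[OF assms(1)] assms(2,3)] vanishing_formD(2)[OF assms(1,4)]
  by simp

lemma vanishing_form_mult: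
  assumes "vanishing_form \<mu>" "u \<in> R" shows "vanishing_form (\<lambda>z. \<mu> (u * z))"
  using assms linear_form_on_mult mpow_mult_left unfolding vanishing_form_def by blast

lemma vanishing_form_rep_coeff: "vanishing_form (\<lambda>b. coeff (rep n b) j)"
proof -
  have "rep n z = 0" if "z \<in> mpow n" for z using rep_eq_0_iff[OF mpow_mem[OF that]] that by simp
  then show ?thesis unfolding vanishing_form_def using linear_form_rep_coeff by simp
qed

text \<open>The value of \<open>\<mu> \<otimes> \<lambda>\<close> on \<open>c\<close> times the Bezoutian \<open>(b \<otimes> 1 - 1 \<otimes> b) / (s \<otimes> 1 - 1 \<otimes> s)\<close> of the
  polynomial \<open>b\<close>, with \<open>c\<close> acting on the right factor.\<close>

definition bez_form ::
  "('l poly fract \<Rightarrow> 'l) \<Rightarrow> ('l poly fract \<Rightarrow> 'l) \<Rightarrow> 'l poly \<Rightarrow> 'l poly fract \<Rightarrow> 'l" where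
  "bez_form \<mu> \<kappa> b c = (\<Sum>i<degree b. \<mu> (to_fract (poly_shift (Suc i) b)) * \<kappa> (fract_var ^ i * c))"

lemma poly_shift_Suc_pCons: "poly_shift (Suc i) (pCons e b) = poly_shift i b"
  by (simp add: poly_eq_iff coeff_poly_shift)

lemma bez_form_0 [simp]: "bez_form \<mu> \<kappa> 0 c = 0"
  by (simp add: bez_form_def)

text \<open>Horner recursion: s b \<otimes> 1 - 1 \<otimes> s b = (s \<otimes> 1 - 1 \<otimes> s)(b
  \<otimes> 1) + (1 \<otimes> s)(b \<otimes> 1 - 1 \<otimes> b), while the constant e contributes
  nothing.\<close>

lemma bez_form_pCons:
  assumes "linear_form_on R \<mu>"
  shows "bez_form \<mu> \<kappa> (pCons e b) c = \<mu> (to_fract b) * \<kappa> c + bez_form \<mu> \<kappa> b (fract_var * c)"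
proof (cases "b = 0")
  case True
  then show ?thesis using linear_form_on_0[OF assms] by (simp add: bez_form_def)
next
  case False
  then show ?thesis
    by (simp add: bez_form_def poly_shift_Suc_pCons sum.lessThan_Suc_shift power_commutes mult.assoc
        del: sum.lessThan_Suc)
      (simp add: mult_ac)
qed

lemma bez_form_add_right:
  assumes "linear_form_on R \<kappa>" "c \<in> R" "c' \<in> R"
  shows "bez_form \<mu> \<kappa> b (c + c') = bez_form \<mu> \<kappa> b c + bez_form \<mu> \<kappa> b c'"
  unfolding bez_form_def
  by (simp add: distrib_left linear_form_onD(1)[OF assms(1)] assms mult_mem power_mem sum.distrib)

lemma bez_form_scale_right:
  assumes "linear_form_on R \<kappa>" "c \<in> R"
  shows "bez_form \<mu> \<kappa> b (fract_const e * c) = e * bez_form \<mu> \<kappa> b c"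
  unfolding bez_form_def
  by (simp add: mult.left_commute[of _ "fract_const e"] linear_form_onD(2)[OF assms(1)] assms mult_mem
      power_mem sum_distrib_left mult.left_commute[of _ e])

lemma bez_form_add_left:
  assumes "linear_form_on R \<mu>"
  shows "bez_form \<mu> \<kappa> (b + b') c = bez_form \<mu> \<kappa> b c + bez_form \<mu> \<kappa> b' c"
proof (induction b arbitrary: b' c)
  case (pCons e b)
  obtain e' b'' where b': "b' = pCons e' b''" by (cases b')
  show ?case unfolding b' add_pCons bez_form_pCons[OF assms]
    by (simp add: linear_form_onD(1)[OF assms] pCons.IH distrib_right)
qed simp

lemma bez_form_scale_left:
  assumes "linear_form_on R \<mu>"
  shows "bez_form \<mu> \<kappa> (Polynomial.smult e b) c = e * bez_form \<mu> \<kappa> b c"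
proof (induction b arbitrary: c)
  case (pCons e' b)
  show ?case unfolding smult_pCons bez_form_pCons[OF assms]
    by (simp add: to_fract_smult linear_form_onD(2)[OF assms] pCons.IH algebra_simps)
qed simp

text \<open>Twisted Leibniz rule: b b' \<otimes> 1 - 1 \<otimes> b b' = (b \<otimes> 1 - 1 \<otimes>
  b)(b' \<otimes> 1) + (1 \<otimes> b)(b' \<otimes> 1 - 1 \<otimes> b').\<close>

lemma bez_form_mult:
  assumes \<mu>: "linear_form_on R \<mu>" and \<kappa>: "linear_form_on R \<kappa>" and c: "c \<in> R"
  shows "bez_form \<mu> \<kappa> (b * b') c
    = bez_form (\<lambda>z. \<mu> (to_fract b' * z)) \<kappa> b c + bez_form \<mu> \<kappa> b' (to_fract b * c)"
  using c
proof (induction b arbitrary: c)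
  case 0
  then show ?case using bez_form_scale_right[OF \<kappa> zero_mem, of \<mu> b' 0] by simp
next
  case (pCons e b)
  note \<mu>' = linear_form_on_mult[OF \<mu> to_fract_mem, of b']
  have sc: "fract_var * c \<in> R" using pCons.prems by (simp add: mult_mem)
  have "bez_form \<mu> \<kappa> (pCons e b * b') c
      = e * bez_form \<mu> \<kappa> b' c + (\<mu> (to_fract (b * b')) * \<kappa> c + bez_form \<mu> \<kappa> (b * b') (fract_var * c))"
    by (simp add: bez_form_add_left[OF \<mu>] bez_form_scale_left[OF \<mu>] bez_form_pCons[OF \<mu>] del: to_fract_mult)
  moreover have "bez_form \<mu> \<kappa> b' (to_fract (pCons e b) * c)
      = e * bez_form \<mu> \<kappa> b' c + bez_form \<mu> \<kappa> b' (to_fract b * (fract_var * c))"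
  proof -
    have "to_fract (pCons e b) * c = fract_const e * c + to_fract b * (fract_var * c)"
      by (simp add: to_fract_pCons algebra_simps)
    then show ?thesis using pCons.prems sc
      by (simp add: mult_mem bez_form_add_right[OF \<kappa>] bez_form_scale_right[OF \<kappa>])
  qed
  ultimately show ?case unfolding pCons.IH[OF sc] bez_form_pCons[OF \<mu>']
    by (simp add: mult_ac)
qed

context
  fixes \<mu> \<kappa>
  assumes \<mu>: "vanishing_form \<mu>" and \<kappa>: "vanishing_form \<kappa>"
begin

lemmas lin = vanishing_formD(1)[OF \<mu>] vanishing_formD(1)[OF \<kappa>]

lemma bez_form_vanish_right: "c \<in> mpow n \<Longrightarrow> bez_form \<mu> \<kappa> b c = 0"
  unfolding bez_form_def
  by (intro sum.neutral) (simp add: vanishing_formD(2)[OF \<kappa>] mpow_mult_left power_mem)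

lemma bez_form_H_mult:
  assumes "c \<in> R"
  shows "bez_form \<mu> \<kappa> (H * b) c = bez_form (\<lambda>z. \<mu> (to_fract b * z)) \<kappa> H c"
proof -
  have "to_fract H * c \<in> mpow n" using mpow_memI[OF assms, of n] by simp
  then show ?thesis using bez_form_mult[OF lin assms, of H b] bez_form_vanish_right by simp
qed

text \<open>By the Leibniz rule the Bezoutian of a multiple of H^2 lies in the ideal generated by H
  \<otimes> 1 and 1 \<otimes> H, on which \<mu> \<otimes> \<kappa> vanishes. Reducing modulo H alone
  would lose the Bezoutian of H itself.\<close>

lemma bez_form_mod:
  assumes "c \<in> R" shows "bez_form \<mu> \<kappa> (b mod G ^ (2 * n)) c = bez_form \<mu> \<kappa> b c"
proof -
  have "to_fract (H * e) * to_fract z \<in> mpow n" for e z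
    unfolding to_fract_mult[symmetric] to_fract_mpow by (simp add: mult.assoc)
  then have "bez_form \<mu> \<kappa> (H * (H * e)) c = 0" for e
    unfolding bez_form_H_mult[OF assms] unfolding bez_form_def
    by (intro sum.neutral) (simp add: vanishing_formD(2)[OF \<mu>] del: to_fract_mult)
  moreover have "b = b mod G ^ (2 * n) + H * (H * (b div G ^ (2 * n)))"
    by (simp add: mult_2 power_add mult.assoc[symmetric])
  ultimately show ?thesis using bez_form_add_left[OF lin(1)] by (metis add.right_neutral)
qed

text \<open>The test form to be fed into \<open>tensor_eq\<close>; the reduction by
  \<open>rep (2 * n)\<close> extends it from polynomials to all of R.\<close>

lemma bilinear_form_bez_form: "bilinear_form_on R (\<lambda>b. bez_form \<mu> \<kappa> (rep (2 * n) b))"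
  unfolding bilinear_form_on_def
proof (intro conjI ballI)
  fix b assume "b \<in> R"
  show "linear_form_on R (bez_form \<mu> \<kappa> (rep (2 * n) b))"
    unfolding linear_form_on_def by (simp add: bez_form_add_right[OF lin(2)] bez_form_scale_right[OF lin(2)])
  show "linear_form_on R (\<lambda>b'. bez_form \<mu> \<kappa> (rep (2 * n) b') b)"
    unfolding linear_form_on_def
    by (simp add: rep_add rep_scale bez_form_add_left[OF lin(1)] bez_form_scale_left[OF lin(1)])
qed

text \<open>The form \<beta> undoes multiplication by s \<otimes> 1 - 1 \<otimes> s: its value on
  such a product is the value of \<mu> \<otimes> \<kappa> on the other factor. Testing the defining
  identity of \<open>a\<close> against it evaluates \<mu> \<otimes> \<kappa> on \<open>a\<close>,
  whichever Bezoutian \<open>a\<close> is, as the Bezoutian of H with u acting on the left.\<close>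

lemma bezoutian_contract:
  assumes u: "u \<in> R" and a: "is_bezoutian R (to_fract G ^ n * u) a"
  shows "(\<Sum>(b, c)\<leftarrow>a. \<mu> b * \<kappa> c) = bez_form (\<lambda>z. \<mu> (u * z)) \<kappa> H 1"
proof -
  let ?F = "to_fract G ^ n * u"
  define \<beta> where "\<beta> = (\<lambda>b. bez_form \<mu> \<kappa> (rep (2 * n) b))"
  have aR: "b \<in> R" "c \<in> R" if "(b, c) \<in> set a" for b c
    using a that by (auto simp: is_bezoutian_def)
  have step: "\<beta> (b * fract_var) c + \<beta> (- b) (c * fract_var) = \<mu> b * \<kappa> c" if "b \<in> R" "c \<in> R" for b c
  proof -
    let ?r = "rep (2 * n) b"
    have "rep (2 * n) (b * fract_var) = pCons 0 ?r mod G ^ (2 * n)"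
      using rep_mult_to_fract[OF that(1), of "2 * n" "[:0, 1:]"] by (simp add: fract_var_conv mult.commute)
    then have "\<beta> (b * fract_var) c = bez_form \<mu> \<kappa> (pCons 0 ?r) c"
      by (simp add: \<beta>_def bez_form_mod that)
    also have "\<dots> = \<mu> (to_fract ?r) * \<kappa> c + \<beta> b (c * fract_var)"
      by (simp add: bez_form_pCons[OF lin(1)] \<beta>_def mult.commute)
    also have "\<mu> (to_fract ?r) = \<mu> b"
      using rep_cong[OF that(1), of "2 * n"] mpow_antimono[of n "2 * n"]
      by (intro vanishing_form_cong[OF \<mu>]) (auto simp: that mpow_diff_commute)
    moreover have "rep (2 * n) (- b) = Polynomial.smult (- 1) ?r"
      using rep_scale[OF that(1), of "2 * n" "- 1"] by simp
    then have "\<beta> (- b) (c * fract_var) = - \<beta> b (c * fract_var)"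
      unfolding \<beta>_def by (simp only: bez_form_scale_left[OF lin(1)] mult_minus1)
    ultimately show ?thesis by simp
  qed
  have "tensor_eq R [(?F, 1), (- 1, ?F)]
       (map (\<lambda>(b, c). (b * fract_var, c)) a @ map (\<lambda>(b, c). (- b, c * fract_var)) a)"
    using a by (simp add: is_bezoutian_def)
  then have "\<beta> ?F 1 + \<beta> (- 1) ?F
      = (\<Sum>(b, c)\<leftarrow>map (\<lambda>(b, c). (b * fract_var, c)) a. \<beta> b c)
      + (\<Sum>(b, c)\<leftarrow>map (\<lambda>(b, c). (- b, c * fract_var)) a. \<beta> b c)"
    unfolding tensor_eq_def \<beta>_def using bilinear_form_bez_form by (fastforce simp del: map_map)
  also have "\<dots> = (\<Sum>(b, c)\<leftarrow>a. \<beta> (b * fract_var) c + \<beta> (- b) (c * fract_var))"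
    by (induction a) auto
  also have "\<dots> = (\<Sum>(b, c)\<leftarrow>a. \<mu> b * \<kappa> c)"
    using aR step by (intro arg_cong[of _ _ sum_list] map_cong) auto
  finally have sum: "(\<Sum>(b, c)\<leftarrow>a. \<mu> b * \<kappa> c) = \<beta> ?F 1 + \<beta> (- 1) ?F" ..
  \<comment> \<open>The term -1 \<otimes> F drops out, because constants have zero
    Bezoutian.\<close>
  have "rep (2 * n) (to_fract (- 1)) = (- 1) mod G ^ (2 * n)" by (rule rep_to_fract)
  also have "\<dots> = - 1"
    using degree_G_power_pos[of "2 * n"] n_pos by (intro mod_poly_less) simp
  finally have "\<beta> (- 1) ?F = 0" by (simp add: \<beta>_def bez_form_def)
  moreover have "\<beta> ?F 1 = bez_form (\<lambda>z. \<mu> (u * z)) \<kappa> H 1"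
  proof -
    \<comment> \<open>Knowing u modulo G^n determines F = G^n u modulo G^(2n), which is all that
      \<beta> sees.\<close>
    let ?U = "rep n u"
    have "?F - to_fract (H * ?U) = to_fract G ^ n * (u - to_fract ?U)" by (simp add: algebra_simps)
    also have "\<dots> \<in> mpow (n + n)" using rep_cong[OF u] by (intro mpow_mult) simp_all
    finally have "rep (2 * n) ?F = H * ?U mod G ^ (2 * n)" by (intro rep_eqI) (simp add: mult_2)
    then have "\<beta> ?F 1 = bez_form (\<lambda>z. \<mu> (to_fract ?U * z)) \<kappa> H 1"
      by (simp add: \<beta>_def bez_form_mod bez_form_H_mult)
    moreover have "\<mu> (to_fract ?U * to_fract z) = \<mu> (u * to_fract z)" for z
    proof (rule vanishing_form_cong[OF \<mu>])
      have "(to_fract ?U - u) * to_fract z \<in> mpow n"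
        using rep_cong[OF u] by (intro mpow_mult_right) (simp_all add: mpow_diff_commute)
      then show "to_fract ?U * to_fract z - u * to_fract z \<in> mpow n" by (simp add: algebra_simps)
    qed (simp_all add: mult_mem u)
    ultimately show ?thesis by (simp add: bez_form_def)
  qed
  ultimately show ?thesis using sum by simp
qed

end

text \<open>The coefficient forms are dual to the basis 1, s, ..., s^(d-1) of Q, so each picks a
  single summand of the Bezoutian of H.\<close>

lemma bez_form_H_rep_coeff:
  assumes "j < d"
  shows "bez_form \<nu> (\<lambda>b. coeff (rep n b) j) H 1 = \<nu> (to_fract (poly_shift (Suc j) H))"
proof -
  have "coeff (rep n (fract_var ^ i * 1)) j = (if i = j then 1 else 0)" if "i < d" for i
  proof -
    have "fract_var ^ i * 1 = to_fract (monom 1 i :: 'l poly)"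
      by (simp add: fract_var_conv monom_altdef)
    moreover have "monom 1 i mod H = monom 1 i"
      using that by (intro mod_poly_less) (simp add: degree_monom_eq)
    ultimately show ?thesis by (simp add: rep_to_fract)
  qed
  then have "bez_form \<nu> (\<lambda>b. coeff (rep n b) j) H 1
      = (\<Sum>i<d. if i = j then \<nu> (to_fract (poly_shift (Suc j) H)) else 0)"
    unfolding bez_form_def by (intro sum.cong) auto
  also have "\<dots> = \<nu> (to_fract (poly_shift (Suc j) H))" using assms by simp
  finally show ?thesis .
qed

section \<open>The functional with \<Theta>(\<eta>) = 1\<close>

lemma coeff_rep_1: "j < d \<Longrightarrow> coeff (rep n 1) j = (if j = 0 then 1 else 0)"
  using rep_to_fract[of n 1] d_pos by (simp add: mod_poly_less coeff_1)

lemma mpow_eq_multiples: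
  assumes "unit u" shows "(\<lambda>r. to_fract G ^ n * u * r) ` R = mpow n"
  unfolding mpow_def using multiples_eq_iff[of "to_fract G ^ n"] assms G_nz by (simp add: G_nz) blast

lemma theta_coeff:
  assumes "linear_form_on R \<eta>" "set a \<subseteq> R \<times> R" "j < d"
  shows "coeff (rep n ((\<Sum>(b, c)\<leftarrow>a. fract_const (\<eta> b) * c) - 1)) j
    = (\<Sum>(b, c)\<leftarrow>a. \<eta> b * coeff (rep n c) j) - (if j = 0 then 1 else 0)"
proof -
  let ?\<kappa> = "\<lambda>b. coeff (rep n b) j"
  have lin: "linear_form_on R ?\<kappa>" by (rule linear_form_rep_coeff)
  have mem: "(case z of (b, c) \<Rightarrow> fract_const (\<eta> b) * c) \<in> R" if "z \<in> set a" for z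
    using that assms(2) by (auto simp: mult_mem)
  have "?\<kappa> (\<Sum>(b, c)\<leftarrow>a. fract_const (\<eta> b) * c) = (\<Sum>z\<leftarrow>a. ?\<kappa> (case z of (b, c) \<Rightarrow> fract_const (\<eta> b) * c))"
    by (rule linear_form_on_sum_list[OF lin mem])
  also have "\<dots> = (\<Sum>(b, c)\<leftarrow>a. \<eta> b * ?\<kappa> c)"
    using assms(2) by (intro arg_cong[of _ _ sum_list] map_cong) (auto simp: rep_scale)
  finally show ?thesis
    using linear_form_on_diff[OF lin sum_list_mem[of a, OF mem] one_mem] coeff_rep_1[OF assms(3)] by simp
qed

text \<open>In coordinates, \<Theta>(\<eta>) = 1 says that r \<mapsto> \<eta>(u r) is 1 on the first
  shift of H and 0 on the later ones. The shifts are monic of degrees d - 1, ..., 0, hence a basis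
  of the remainders, and the coefficient at s^(d-1) takes the same values on them.\<close>

lemma theta_inverse_one_eval:
  assumes u: "unit u" and a: "is_bezoutian R (to_fract G ^ n * u) a"
    and \<eta>: "is_theta_inverse_one R (to_fract G ^ n * u) a \<eta>"
  shows "\<eta> (u * to_fract A) = coeff (A mod H) (d - 1)" and "vanishing_form \<eta>"
proof -
  let ?F = "to_fract G ^ n * u"
  have lin: "linear_form_on R \<eta>" using \<eta> by (simp add: is_theta_inverse_one_def)
  show van: "vanishing_form \<eta>"
    using \<eta> unfolding vanishing_form_def is_theta_inverse_one_def mpow_eq_multiples[OF u, symmetric] by auto
  have aR: "set a \<subseteq> R \<times> R" using a by (simp add: is_bezoutian_def)
  define \<nu> where "\<nu> = (\<lambda>z. \<eta> (u * z))"
  have \<nu>: "vanishing_form \<nu>" unfolding \<nu>_def using vanishing_form_mult[OF van unit_mem[OF u]] .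
  note \<nu>lin = vanishing_formD(1)[OF \<nu>]
  have shift: "\<nu> (to_fract (poly_shift (Suc j) H)) = (if j = 0 then 1 else 0)" if "j < d" for j
  proof -
    have "(\<Sum>(b, c)\<leftarrow>a. fract_const (\<eta> b) * c) - 1 \<in> mpow n"
      using \<eta> unfolding is_theta_inverse_one_def mpow_eq_multiples[OF u] by simp
    then have "rep n ((\<Sum>(b, c)\<leftarrow>a. fract_const (\<eta> b) * c) - 1) = 0" using rep_eq_0_iff mpow_mem by blast
    then have "(\<Sum>(b, c)\<leftarrow>a. \<eta> b * coeff (rep n c) j) = (if j = 0 then 1 else 0)"
      using theta_coeff[OF lin aR that] by simp
    then show ?thesis
      using bezoutian_contract[OF van vanishing_form_rep_coeff unit_mem[OF u] a, of j]
        bez_form_H_rep_coeff[OF that, of \<nu>] by (simp add: \<nu>_def)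
  qed
  have low: "\<nu> (to_fract B) = coeff B (d - 1)" if "degree B < d" for B
    using that
  proof (induction "degree B" arbitrary: B rule: less_induct)
    case less
    \<comment> \<open>With this index the shift \<open>?S\<close> is monic of the same degree as B,
      so subtracting a multiple of it lowers the degree.\<close>
    let ?j = "d - 1 - degree B"
    let ?S = "poly_shift (Suc ?j) H"
    define C where "C = B - Polynomial.smult (lead_coeff B) ?S"
    have cS: "coeff ?S i = coeff H (i + (d - degree B))" for i
    proof -
      have "Suc ?j = d - degree B" using less.prems by simp
      then show ?thesis by (simp only: coeff_poly_shift)
    qed
    have cB: "coeff C i = 0" if "degree B \<le> i" for i
    proof (cases "i = degree B")
      case True
      have "coeff ?S i = 1" unfolding cS using True less.prems lead_coeff_H by simp
      then show ?thesis using True by (simp add: C_def)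
    next
      case False
      then have "d < i + (d - degree B)" "degree B < i" using that less.prems by auto
      then show ?thesis unfolding C_def coeff_diff coeff_smult cS by (simp add: coeff_eq_0)
    qed
    have \<nu>C: "\<nu> (to_fract C) = coeff C (d - 1)"
    proof (cases "degree B = 0")
      case True
      then have "C = 0" by (intro poly_eqI) (simp add: cB)
      then show ?thesis using linear_form_on_0[OF \<nu>lin] by simp
    next
      case False
      have "degree C < degree B"
        using False cB by (metis bot_nat_0.not_eq_extremum degree_lessI)
      then show ?thesis using less by (meson less_trans)
    qed
    have "to_fract B = to_fract C + fract_const (lead_coeff B) * to_fract ?S"
      by (simp add: C_def to_fract_smult)
    then have "\<nu> (to_fract B) = \<nu> (to_fract C) + lead_coeff B * \<nu> (to_fract ?S)"
      using linear_form_onD[OF \<nu>lin] to_fract_mem mult_mem const_mem by metis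
    moreover have "coeff ?S (d - 1) = (if ?j = 0 then 1 else 0)"
    proof (cases "degree B = d - 1")
      case True
      then show ?thesis unfolding cS using d_pos lead_coeff_H by simp
    next
      case False
      then have "d < d - 1 + (d - degree B)" using less.prems by auto
      then show ?thesis unfolding cS using False less.prems by (simp add: coeff_eq_0)
    qed
    moreover have "coeff B (d - 1) = coeff C (d - 1) + lead_coeff B * coeff ?S (d - 1)"
      by (simp add: C_def)
    ultimately show ?case using \<nu>C shift[of ?j] d_pos by simp
  qed
  have "\<nu> (to_fract A) = \<nu> (to_fract (A mod H))"
  proof (rule vanishing_form_cong[OF \<nu>])
    show "to_fract A - to_fract (A mod H) \<in> mpow n"
      using rep_cong[OF to_fract_mem, of A n] by (simp add: rep_to_fract)
  qed simp_all
  also have "\<dots> = coeff (A mod H) (d - 1)"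
    by (intro low degree_mod_G_power n_pos)
  finally show "\<eta> (u * to_fract A) = coeff (A mod H) (d - 1)" by (simp add: \<nu>_def)
qed

text \<open>The formula for \<eta> forced by \<open>theta_inverse_one_eval\<close> is taken as the
  definition, and \<Theta>(\<eta>) - 1 is shown to vanish coefficient by coefficient.\<close>

lemma theta_inverse_one_exists:
  assumes u: "unit u" and a: "is_bezoutian R (to_fract G ^ n * u) a"
  shows "\<exists>\<eta>. is_theta_inverse_one R (to_fract G ^ n * u) a \<eta>"
proof -
  define \<eta> where "\<eta> = (\<lambda>b. coeff (rep n (inverse u * b)) (d - 1))"
  have van: "vanishing_form \<eta>"
    unfolding \<eta>_def
    by (rule vanishing_form_mult[OF vanishing_form_rep_coeff unit_mem[OF unit_inverse[OF u]]])
  note lin = vanishing_formD(1)[OF van]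
  have aR: "set a \<subseteq> R \<times> R" using a by (simp add: is_bezoutian_def)
  let ?z = "(\<Sum>(b, c)\<leftarrow>a. fract_const (\<eta> b) * c) - 1"
  have z: "?z \<in> R" using aR by (intro diff_mem sum_list_mem one_mem) (auto simp: mult_mem)
  have "rep n ?z = 0"
  proof (rule poly_eqI)
    fix j
    show "coeff (rep n ?z) j = coeff 0 j"
    proof (cases "j < d")
      case True
      have \<eta>u: "\<eta> (u * b) = coeff (rep n b) (d - 1)" for b
        using unit_nz[OF u] by (simp add: \<eta>_def mult.assoc[symmetric])
      have "degree (poly_shift (Suc j) H) < d"
      proof (rule degree_lessI)
        show "\<forall>i\<ge>d. coeff (poly_shift (Suc j) H) i = 0"
          by (simp add: coeff_poly_shift coeff_eq_0)
      qed (use d_pos in simp)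
      then have "poly_shift (Suc j) H mod H = poly_shift (Suc j) H" by (rule mod_poly_less)
      then have "(\<Sum>(b, c)\<leftarrow>a. \<eta> b * coeff (rep n c) j) = coeff (poly_shift (Suc j) H) (d - 1)"
        using bezoutian_contract[OF van vanishing_form_rep_coeff unit_mem[OF u] a, of j]
          bez_form_H_rep_coeff[OF True, of "\<lambda>z. \<eta> (u * z)"] by (simp add: \<eta>u rep_to_fract)
      also have "\<dots> = (if j = 0 then 1 else 0)"
        using d_pos lead_coeff_H by (auto simp: coeff_poly_shift intro!: coeff_eq_0)
      finally show ?thesis using theta_coeff[OF lin aR True] by simp
    next
      case False
      then show ?thesis using degree_rep[OF z n_pos] by (simp add: coeff_eq_0)
    qed
  qed
  then have "?z \<in> mpow n" using rep_eq_0_iff[OF z] by simp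
  moreover have "\<forall>r\<in>R. \<eta> (to_fract G ^ n * u * r) = 0"
    using vanishing_formD(2)[OF van] mpow_eq_multiples[OF u] by blast
  ultimately have "is_theta_inverse_one R (to_fract G ^ n * u) a \<eta>"
    unfolding is_theta_inverse_one_def mpow_eq_multiples[OF u] using lin by blast
  then show ?thesis by (intro exI[of _ \<eta>])
qed

text \<open>Only polynomials are treated: the correction g will be chosen so that F is one, and then
  Horner recursion produces the tensor.\<close>

lemma bezoutian_exists: "\<exists>a. is_bezoutian R (to_fract A) a"
proof -
  have "\<exists>a. set a \<subseteq> R \<times> R \<and> (\<forall>\<beta>. bilinear_form_on R \<beta> \<longrightarrow>
      \<beta> (to_fract A) 1 - \<beta> 1 (to_fract A)
        = (\<Sum>(b, c)\<leftarrow>a. \<beta> (b * fract_var) c - \<beta> b (c * fract_var)))"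
  proof (induction A)
    case 0
    have "\<beta> 0 1 - \<beta> 1 0 = 0" if "bilinear_form_on R \<beta>" for \<beta>
      using that linear_form_on_0[of "\<beta> 1"] linear_form_on_0[of "\<lambda>a. \<beta> a 1"]
      by (simp add: bilinear_form_on_def)
    then show ?case by (intro exI[of _ "[]"]) simp
  next
    case (pCons e A)
    then obtain a where a: "set a \<subseteq> R \<times> R" "\<And>\<beta>. bilinear_form_on R \<beta> \<Longrightarrow>
      \<beta> (to_fract A) 1 - \<beta> 1 (to_fract A)
        = (\<Sum>(b, c)\<leftarrow>a. \<beta> (b * fract_var) c - \<beta> b (c * fract_var))" by blast
    \<comment> \<open>A \<otimes> 1 + (1 \<otimes> s) a, the recursion of
      \<open>bez_form_pCons\<close>.\<close>
    let ?a = "(to_fract A, 1) # map (\<lambda>(b, c). (b, fract_var * c)) a"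
    show ?case
    proof (intro exI[of _ ?a] conjI allI impI)
      show "set ?a \<subseteq> R \<times> R" using a(1) by (auto simp: mult_mem)
      fix \<beta> assume \<beta>: "bilinear_form_on R \<beta>"
      then have l: "linear_form_on R (\<beta> b)" "linear_form_on R (\<lambda>a. \<beta> a b)" if "b \<in> R" for b
        using that by (simp_all add: bilinear_form_on_def)
      \<comment> \<open>The factor 1 \<otimes> s is moved into the test form, so that the induction
        hypothesis for A applies.\<close>
      have "bilinear_form_on R (\<lambda>b c. \<beta> b (fract_var * c))"
        unfolding bilinear_form_on_def
      proof (intro conjI ballI)
        fix b assume b: "b \<in> R"
        show "linear_form_on R (\<lambda>c. \<beta> b (fract_var * c))"
          by (rule linear_form_on_mult[OF l(1)[OF b] fract_var_mem])
        show "linear_form_on R (\<lambda>c. \<beta> c (fract_var * b))"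
          using b by (intro l(2) mult_mem) simp_all
      qed
      note IH = a(2)[OF this]
      have e1: "\<beta> (to_fract (pCons e A)) 1 = e * \<beta> 1 1 + \<beta> (to_fract A * fract_var) 1"
        using linear_form_onD(1)[OF l(2)[OF one_mem], of "fract_const e" "to_fract A * fract_var"]
          linear_form_onD(2)[OF l(2)[OF one_mem] one_mem, of e]
        by (simp add: to_fract_pCons mult_mem mult.commute)
      have e2: "\<beta> 1 (to_fract (pCons e A)) = e * \<beta> 1 1 + \<beta> 1 (fract_var * to_fract A)"
        using linear_form_onD(1)[OF l(1)[OF one_mem], of "fract_const e" "fract_var * to_fract A"]
          linear_form_onD(2)[OF l(1)[OF one_mem] one_mem, of e]
        by (simp add: to_fract_pCons mult_mem)
      have e3: "(\<Sum>(b, c)\<leftarrow>?a. \<beta> (b * fract_var) c - \<beta> b (c * fract_var))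
        = \<beta> (to_fract A * fract_var) 1 - \<beta> (to_fract A) fract_var
          + (\<Sum>(b, c)\<leftarrow>a. \<beta> (b * fract_var) (fract_var * c) - \<beta> b (fract_var * (c * fract_var)))"
        by (simp add: o_def case_prod_unfold mult.assoc)
      show "\<beta> (to_fract (pCons e A)) 1 - \<beta> 1 (to_fract (pCons e A))
        = (\<Sum>(b, c)\<leftarrow>?a. \<beta> (b * fract_var) c - \<beta> b (c * fract_var))"
        unfolding e1 e2 e3 IH[symmetric] by simp
    qed
  qed
  then obtain a where a: "set a \<subseteq> R \<times> R" "\<And>\<beta>. bilinear_form_on R \<beta> \<Longrightarrow>
      \<beta> (to_fract A) 1 - \<beta> 1 (to_fract A)
        = (\<Sum>(b, c)\<leftarrow>a. \<beta> (b * fract_var) c - \<beta> b (c * fract_var))" by blast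
  have "is_bezoutian R (to_fract A) a"
    unfolding is_bezoutian_def tensor_eq_def
  proof (intro conjI allI impI a(1))
    fix \<beta> assume \<beta>: "bilinear_form_on R \<beta>"
    then have neg: "\<beta> (- b) c = - \<beta> b c" if "b \<in> R" "c \<in> R" for b c
      using that linear_form_on_uminus[of "\<lambda>a. \<beta> a c"] by (simp add: bilinear_form_on_def)
    have "(\<Sum>(b, c)\<leftarrow>map (\<lambda>(b, c). (- b, c * fract_var)) a. \<beta> b c)
        = (\<Sum>(b, c)\<leftarrow>a. - \<beta> b (c * fract_var))"
      unfolding map_map using a(1)
      by (intro arg_cong[of _ _ sum_list] map_cong) (auto simp: neg mult_mem)
    then show "(\<Sum>(b, c)\<leftarrow>[(to_fract A, 1), (- 1, to_fract A)]. \<beta> b c) =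
      (\<Sum>(b, c)\<leftarrow>map (\<lambda>(b, c). (b * fract_var, c)) a @ map (\<lambda>(b, c). (- b, c * fract_var)) a. \<beta> b c)"
      using a(2)[OF \<beta>] neg
      by (simp add: o_def case_prod_unfold sum_list_subtractf uminus_sum_list_map[unfolded o_def, symmetric])
  qed
  then show ?thesis ..
qed

end

section \<open>Classes of Gram matrices\<close>

lemma isometric_matI:
  fixes p q :: "nat \<Rightarrow> nat \<Rightarrow> 'l::field"
  assumes A: "A \<in> carrier_mat n n" and B: "B \<in> carrier_mat n n"
    and inv: "\<And>i j. i < n \<Longrightarrow> j < n \<Longrightarrow> (\<Sum>k<n. p i k * q k j) = (if i = j then 1 else 0)"
    and entries: "\<And>i j. i < n \<Longrightarrow> j < n \<Longrightarrow> B $$ (i, j) = (\<Sum>k<n. \<Sum>l<n. p k i * A $$ (k, l) * p l j)"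
  shows "isometric_mat A B"
proof -
  let ?P = "mat n n (\<lambda>(i, j). p i j)" and ?Q = "mat n n (\<lambda>(i, j). q i j)"
  have PQ: "?P * ?Q = 1\<^sub>m n"
    by (rule eq_matI) (simp_all add: scalar_prod_def inv atLeast0LessThan)
  have "?Q * ?P = 1\<^sub>m n" by (rule mat_mult_left_right_inverse[OF _ _ PQ]) simp_all
  then have "invertible_mat ?P" using PQ by (intro invertible_matI[of ?P n ?Q]) simp_all
  moreover have "B = transpose_mat ?P * A * ?P"
  proof (rule eq_matI)
    fix i j assume "i < dim_row (transpose_mat ?P * A * ?P)" "j < dim_col (transpose_mat ?P * A * ?P)"
    then have ij: "i < n" "j < n" by simp_all
    have "(transpose_mat ?P * A * ?P) $$ (i, j) = (\<Sum>l<n. (\<Sum>k<n. p k i * A $$ (k, l)) * p l j)"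
      using ij A by (simp add: scalar_prod_def atLeast0LessThan)
    also have "\<dots> = (\<Sum>k<n. \<Sum>l<n. p k i * A $$ (k, l) * p l j)"
      unfolding sum_distrib_right by (rule sum.swap)
    finally show "B $$ (i, j) = (transpose_mat ?P * A * ?P) $$ (i, j)" using entries[OF ij] by simp
  qed (use A B in simp_all)
  ultimately show ?thesis using A B unfolding isometric_mat_def by (intro exI[of _ ?P]) simp
qed

text \<open>If m < n, pad both matrices with zeros to size n. The one-sided inverse becomes
  two-sided, yet the product in the other order has a zero row. Applied twice, this shows that two
  bases of Q have equal length.\<close>

lemma right_inverse_size:
  fixes p q :: "nat \<Rightarrow> nat \<Rightarrow> 'l::field"
  assumes inv: "\<And>i j. i < n \<Longrightarrow> j < n \<Longrightarrow> (\<Sum>k<m. p i k * q k j) = (if i = j then 1 else 0)"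
  shows "n \<le> m"
proof (rule ccontr)
  assume "\<not> n \<le> m"
  then have mn: "m < n" by simp
  let ?P = "mat n n (\<lambda>(i, j). if j < m then p i j else 0)"
  let ?Q = "mat n n (\<lambda>(i, j). if i < m then q i j else 0)"
  have PQ: "?P * ?Q = 1\<^sub>m n"
  proof (rule eq_matI)
    fix i j assume "i < dim_row (1\<^sub>m n :: 'l mat)" "j < dim_col (1\<^sub>m n :: 'l mat)"
    then have ij: "i < n" "j < n" by simp_all
    have "(?P * ?Q) $$ (i, j) = (\<Sum>k<n. (if k < m then p i k else 0) * (if k < m then q k j else 0))"
      using ij by (simp add: scalar_prod_def atLeast0LessThan)
    also have "\<dots> = (\<Sum>k<m. p i k * q k j)"
      using mn by (intro sum.mono_neutral_cong_right) auto
    finally show "(?P * ?Q) $$ (i, j) = 1\<^sub>m n $$ (i, j)" using ij inv by simp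
  qed simp_all
  have "?Q * ?P = 1\<^sub>m n" by (rule mat_mult_left_right_inverse[OF _ _ PQ]) simp_all
  then have "(?Q * ?P) $$ (m, m) = 1" using mn by simp
  moreover have "(?Q * ?P) $$ (m, m) = 0" using mn by (simp add: scalar_prod_def)
  ultimately show False by simp
qed

definition symmetric_form :: "'l::field mat \<Rightarrow> bool" where
  "symmetric_form A \<longleftrightarrow> invertible_mat A \<and> transpose_mat A = A"

lemma symmetric_form_carrier:
  "symmetric_form A \<Longrightarrow> A \<in> carrier_mat (dim_row A) (dim_row A)"
  by (auto simp: symmetric_form_def invertible_mat_def)

lemma gram_matrix_Symform: "symmetric_form A \<Longrightarrow> gram_matrix (Symform A) = A"
  by (simp add: Symform_inverse symmetric_form_def)

lemma symmetric_form_isometric: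
  assumes A: "symmetric_form A" and iso: "isometric_mat A B" shows "symmetric_form B"
proof -
  obtain P where P: "invertible_mat P" "dim_row P = dim_row A" "B = transpose_mat P * A * P"
    using iso by (auto simp: isometric_mat_def)
  let ?n = "dim_row A"
  note Ac = symmetric_form_carrier[OF A]
  obtain Q where Q: "P \<in> carrier_mat ?n ?n" "Q \<in> carrier_mat ?n ?n" "P * Q = 1\<^sub>m ?n" "Q * P = 1\<^sub>m ?n"
    using P by (elim invertible_matE)
  have "transpose_mat (P * Q) = 1\<^sub>m ?n" "transpose_mat (Q * P) = 1\<^sub>m ?n" unfolding Q(3,4) by simp_all
  then have "transpose_mat Q * transpose_mat P = 1\<^sub>m ?n" "transpose_mat P * transpose_mat Q = 1\<^sub>m ?n"
    unfolding transpose_mult[OF Q(1,2)] transpose_mult[OF Q(2,1)] .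
  then have "invertible_mat (transpose_mat P)"
    using Q by (intro invertible_matI[of _ ?n "transpose_mat Q"]) simp_all
  then have "invertible_mat B" unfolding P(3) using A P Q(1)
    by (intro invertible_mat_mult) (auto simp: symmetric_form_def)
  moreover have "transpose_mat B = B"
  proof -
    have PT: "transpose_mat P \<in> carrier_mat ?n ?n" using Q(1) by simp
    have "transpose_mat B = transpose_mat P * transpose_mat (transpose_mat P * A)"
      unfolding P(3) by (rule transpose_mult[OF mult_carrier_mat[OF PT Ac] Q(1)])
    also have "transpose_mat (transpose_mat P * A) = A * P"
      using transpose_mult[OF PT Ac] A by (simp add: symmetric_form_def)
    also have "transpose_mat P * (A * P) = B"
      unfolding P(3) by (rule assoc_mult_mat[OF PT Ac Q(1), symmetric])
    finally show ?thesis .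
  qed
  ultimately show ?thesis by (simp add: symmetric_form_def)
qed

lemma gw_class_isometric:
  assumes A: "symmetric_form A" and iso: "isometric_mat A B" shows "gw_class A = gw_class B"
proof -
  have "symform_isometric (Symform A) (Symform B)"
    using iso by (simp add: symform_isometric.rep_eq gram_matrix_Symform A symmetric_form_isometric[OF A iso])
  then show ?thesis unfolding gw_class_def by (metis form_class.abs_eq_iff)
qed

lemma completion_of_add: "completion_of (a + b) = completion_of a + completion_of b"
  by transfer (simp add: completion_rel_def)

lemma gw_class_diag_sum:
  assumes "symmetric_form A" "symmetric_form B"
  shows "gw_class (diag_sum A B) = gw_class A + gw_class B"
proof -
  have "symform_sum (Symform A) (Symform B) = Symform (diag_sum A B)"
    using assms by (metis gram_matrix_Symform gram_matrix_inverse symform_sum.rep_eq)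
  then show ?thesis
    unfolding gw_class_def by (metis completion_of_add plus_form_class.abs_eq)
qed

section \<open>Antidiagonal forms in the Grothendieck--Witt group\<close>

definition antidiag :: "'l::field \<Rightarrow> nat \<Rightarrow> 'l mat" where
  "antidiag e d = mat d d (\<lambda>(i, j). if i + j + 1 = d then e else 0)"

lemma antidiag_carrier: "antidiag e d \<in> carrier_mat d d"
  by (simp add: antidiag_def)

lemma symmetric_form_antidiag:
  assumes "e \<noteq> 0" shows "symmetric_form (antidiag e d)"
proof -
  have mult: "antidiag a d * antidiag b d = 1\<^sub>m d" if "a * b = 1" for a b :: 'a
  proof (rule eq_matI)
    fix i j assume "i < dim_row (1\<^sub>m d :: 'a mat)" "j < dim_col (1\<^sub>m d :: 'a mat)"
    then have ij: "i < d" "j < d" by simp_all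
    have "(antidiag a d * antidiag b d) $$ (i, j)
        = (\<Sum>k<d. (if i + k + 1 = d then a else 0) * (if k + j + 1 = d then b else 0))"
      using ij by (simp add: antidiag_def scalar_prod_def atLeast0LessThan)
    also have "\<dots> = (\<Sum>k<d. if k = d - 1 - i then (if i = j then 1 else 0) else 0)"
      using ij that by (intro sum.cong) auto
    also have "\<dots> = 1\<^sub>m d $$ (i, j)" using ij by simp
    finally show "(antidiag a d * antidiag b d) $$ (i, j) = 1\<^sub>m d $$ (i, j)" .
  qed (simp_all add: antidiag_def)
  have "invertible_mat (antidiag e d)"
    using assms by (intro invertible_matI[of _ d "antidiag (inverse e) d"] mult) (simp_all add: antidiag_def)
  moreover have "transpose_mat (antidiag e d) = antidiag e d"
    by (rule eq_matI) (auto simp: antidiag_def)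
  ultimately show ?thesis by (simp add: symmetric_form_def)
qed

lemma antidiag_1: "antidiag e 1 = mat 1 1 (\<lambda>_. e)"
  by (rule eq_matI) (auto simp: antidiag_def)

lemma gw_class_antidiag_2:
  fixes e :: "'l::field"
  assumes e: "e \<noteq> 0" and two: "(2 :: 'l) \<noteq> 0"
  shows "gw_class (antidiag e 2) = gw_h"
proof -
  let ?D = "diag_sum (antidiag 1 1) (antidiag (- 1) 1) :: 'l mat"
  \<comment> \<open>The columns (1, 1/(2e)) and (1, -1/(2e)) are orthogonal with norms 1 and -1, so
    the plane is h whatever e is; \<open>q\<close> is the inverse matrix.\<close>
  define p :: "nat \<Rightarrow> nat \<Rightarrow> 'l" where
    "p = (\<lambda>i j. if i = 0 then 1 else if j = 0 then inverse e * inverse 2 else - (inverse e * inverse 2))"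
  define q :: "nat \<Rightarrow> nat \<Rightarrow> 'l" where
    "q = (\<lambda>i j. if j = 0 then inverse 2 else if i = 0 then e else - e)"
  have lt2: "i < 2 \<longleftrightarrow> i = 0 \<or> i = 1" for i :: nat by auto
  have sum2: "(\<Sum>k<2. f k) = f 0 + f 1" for f :: "nat \<Rightarrow> 'l" by (simp add: numeral_2_eq_2)
  have half: "inverse 2 + inverse 2 = (1 :: 'l)" using two by (simp add: field_simps)
  then have minus_half: "- inverse 2 - inverse 2 = (- 1 :: 'l)" by (metis minus_add_distrib uminus_add_conv_diff add.commute)
  have "isometric_mat (antidiag e 2) ?D"
  proof (rule isometric_matI[where p = p and q = q])
    show "antidiag e 2 \<in> carrier_mat 2 2" by (simp add: antidiag_def)
    show "?D \<in> carrier_mat 2 2" by (metis antidiag_carrier diag_sum_carrier one_add_one)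
    fix i j :: nat assume ij: "i < 2" "j < 2"
    show "(\<Sum>k<2. p i k * q k j) = (if i = j then 1 else 0)"
      using ij e half unfolding sum2 lt2 by (elim disjE) (simp_all add: p_def q_def mult_ac)
    show "?D $$ (i, j) = (\<Sum>k<2. \<Sum>l<2. p k i * antidiag e 2 $$ (k, l) * p l j)"
      using ij e half minus_half unfolding sum2 lt2
      by (elim disjE) (simp_all add: p_def antidiag_def diag_sum_def mult.assoc[symmetric])
  qed
  then have "gw_class (antidiag e 2) = gw_class ?D"
    by (rule gw_class_isometric[OF symmetric_form_antidiag[OF e]])
  also have "\<dots> = gw_class (antidiag 1 1) + gw_class (antidiag (- 1) 1)"
    by (intro gw_class_diag_sum symmetric_form_antidiag) simp_all
  finally show ?thesis by (simp add: gw_h_def gw_unary_def antidiag_1 del: One_nat_def)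
qed

text \<open>The first and last basis vectors pair only with each other, so they span a plane
  orthogonal to the rest, which is again antidiagonal.\<close>

lemma gw_class_antidiag_Suc_Suc:
  fixes e :: "'l::field"
  assumes e: "e \<noteq> 0"
  shows "gw_class (antidiag e (Suc (Suc d))) = gw_class (antidiag e 2) + gw_class (antidiag e d)"
proof -
  let ?n = "Suc (Suc d)"
  let ?D = "diag_sum (antidiag e 2) (antidiag e d)"
  \<comment> \<open>Reorders the basis as 0, d + 1, 1, ..., d, which puts the outer pair in
    front.\<close>
  define \<pi> where "\<pi> = (\<lambda>i. if i = 0 then 0 else if i = 1 then Suc d else i - 1)"
  define \<sigma> where "\<sigma> = (\<lambda>i. if i = 0 then 0 else if i = Suc d then 1 else i + 1)"
  have \<pi>: "\<pi> i < ?n" "\<sigma> (\<pi> i) = i" and \<sigma>: "\<sigma> i < ?n" "\<pi> (\<sigma> i) = i" if "i < ?n" for i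
    using that by (auto simp: \<pi>_def \<sigma>_def)
  have "isometric_mat (antidiag e ?n) ?D"
  proof (rule isometric_matI[where p = "\<lambda>i j. if i = \<pi> j then 1 else 0"
        and q = "\<lambda>i j. if i = \<sigma> j then 1 else 0"])
    show "antidiag e ?n \<in> carrier_mat ?n ?n" by (simp add: antidiag_def)
    show "?D \<in> carrier_mat ?n ?n" by (metis antidiag_carrier diag_sum_carrier add_2_eq_Suc)
    fix i j assume ij: "i < ?n" "j < ?n"
    have "(\<Sum>k<?n. (if i = \<pi> k then 1 else 0) * (if k = \<sigma> j then 1 else 0))
        = (\<Sum>k<?n. if k = \<sigma> j then (if i = j then 1 else 0) else (0 :: 'l))"
      using \<sigma>[OF ij(2)] by (intro sum.cong) auto
    also have "\<dots> = (if i = j then 1 else 0)" using \<sigma>[OF ij(2)] by simp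
    finally show "(\<Sum>k<?n. (if i = \<pi> k then 1 else 0) * (if k = \<sigma> j then 1 else 0))
        = (if i = j then 1 else (0 :: 'l))" .
    have "(\<Sum>k<?n. \<Sum>l<?n. (if k = \<pi> i then 1 else 0) * antidiag e ?n $$ (k, l) * (if l = \<pi> j then 1 else 0))
        = (\<Sum>k<?n. \<Sum>l<?n. if l = \<pi> j then (if k = \<pi> i then antidiag e ?n $$ (\<pi> i, \<pi> j) else 0) else 0)"
      by (intro sum.cong) auto
    also have "\<dots> = antidiag e ?n $$ (\<pi> i, \<pi> j)" using \<pi>[OF ij(1)] \<pi>[OF ij(2)] by simp
    also have "\<dots> = ?D $$ (i, j)"
      using ij \<pi>(1)[OF ij(1)] \<pi>(1)[OF ij(2)]
      by (auto simp: antidiag_def diag_sum_def \<pi>_def)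
    finally show "?D $$ (i, j) = (\<Sum>k<?n. \<Sum>l<?n. (if k = \<pi> i then 1 else 0) *
        antidiag e ?n $$ (k, l) * (if l = \<pi> j then 1 else 0))" ..
  qed
  then have "gw_class (antidiag e ?n) = gw_class ?D"
    by (rule gw_class_isometric[OF symmetric_form_antidiag[OF e]])
  also have "\<dots> = gw_class (antidiag e 2) + gw_class (antidiag e d)"
    by (intro gw_class_diag_sum symmetric_form_antidiag e)
  finally show ?thesis .
qed

lemma zmult_of_nat: "zmult (int m) x = (\<Sum>i<m. x)"
  by (simp add: zmult_def)

lemma gw_class_antidiag:
  fixes e :: "'l::field"
  assumes e: "e \<noteq> 0" and two: "(2 :: 'l) \<noteq> 0"
  shows "gw_class (antidiag e (2 * m + 1)) = zmult (int m) gw_h + gw_unary e"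
proof (induction m)
  case 0
  show ?case by (simp add: zmult_def gw_unary_def antidiag_1 del: One_nat_def)
next
  case (Suc m)
  have "2 * Suc m + 1 = Suc (Suc (2 * m + 1))" by simp
  then show ?case
    using gw_class_antidiag_Suc_Suc[OF e, of "2 * m + 1"] Suc gw_class_antidiag_2[OF e two]
    by (simp only: zmult_of_nat sum.lessThan_Suc ac_simps)
qed

section \<open>Gram matrices of the residue form\<close>

definition gram :: "('l::field poly fract \<Rightarrow> 'l) \<Rightarrow> 'l poly fract list \<Rightarrow> 'l mat" where
  "gram \<eta> bs = mat (length bs) (length bs) (\<lambda>(i, j). \<eta> (bs ! i * bs ! j))"

context dvr_over
begin

context
  fixes n and bs bs' :: "'l poly fract list"
  assumes bs: "is_basis_mod R (mpow n) bs" and bs': "is_basis_mod R (mpow n) bs'"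
begin

lemma basis_change:
  "\<exists>p. \<forall>j<length bs'. bs' ! j - (\<Sum>k<length bs. fract_const (p k j) * bs ! k) \<in> mpow n"
proof -
  have "\<exists>cs. bs' ! j - (\<Sum>k<length bs. fract_const (cs ! k) * bs ! k) \<in> mpow n" if "j < length bs'" for j
  proof -
    have "bs' ! j \<in> R" using that bs' by (auto simp: is_basis_mod_def)
    then show ?thesis using bs unfolding is_basis_mod_def by blast
  qed
  then obtain cs where
    "\<And>j. j < length bs' \<Longrightarrow> bs' ! j - (\<Sum>k<length bs. fract_const (cs j ! k) * bs ! k) \<in> mpow n"
    by metis
  then show ?thesis by (intro exI[of _ "\<lambda>k j. cs j ! k"]) blast
qed

text \<open>Expanding a basis vector in the other basis and back gives a second expansion of it in
  its own basis; uniqueness of coefficients modulo the ideal forces the product matrix to be the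
  identity.\<close>

lemma basis_change_inverse:
  assumes p: "\<And>j. j < length bs' \<Longrightarrow> bs' ! j - (\<Sum>k<length bs. fract_const (p k j) * bs ! k) \<in> mpow n"
    and q: "\<And>k. k < length bs \<Longrightarrow> bs ! k - (\<Sum>j<length bs'. fract_const (q j k) * bs' ! j) \<in> mpow n"
    and ik: "i < length bs" "k < length bs"
  shows "(\<Sum>j<length bs'. p k j * q j i) = (if k = i then 1 else 0)"
proof -
  let ?S = "\<lambda>cs. \<Sum>k<length bs. fract_const (cs ! k) * bs ! k"
  let ?cs = "map (\<lambda>k. \<Sum>j<length bs'. p k j * q j i) [0..<length bs]"
  let ?ds = "map (\<lambda>k. if k = i then 1 else 0) [0..<length bs]"
  have "bs ! i \<in> R" using ik bs by (auto simp: is_basis_mod_def)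
  then have uniq: "\<exists>!cs. length cs = length bs \<and> bs ! i - ?S cs \<in> mpow n"
    using bs by (simp add: is_basis_mod_def)
  have fc_sum: "fract_const (sum f A) = (\<Sum>j\<in>A. fract_const (f j))" for f :: "nat \<Rightarrow> 'l" and A
    by (induction A rule: infinite_finite_induct) simp_all
  have "?S ?ds = (\<Sum>k<length bs. if k = i then bs ! i else 0)" by (intro sum.cong) auto
  also have "\<dots> = bs ! i" using ik by simp
  finally have ds: "bs ! i - ?S ?ds \<in> mpow n" by simp
  have "(\<Sum>j<length bs'. fract_const (q j i) * (bs' ! j - (\<Sum>k<length bs. fract_const (p k j) * bs ! k))) \<in> mpow n"
    using p by (intro mpow_sum mpow_mult_left) simp_all
  from mpow_add[OF q[OF ik(1)] this]
  have "bs ! i - (\<Sum>j<length bs'. \<Sum>k<length bs. fract_const (q j i * p k j) * bs ! k) \<in> mpow n"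
    by (simp add: right_diff_distrib sum_subtractf sum_distrib_left mult.assoc)
  also have "(\<Sum>j<length bs'. \<Sum>k<length bs. fract_const (q j i * p k j) * bs ! k) = ?S ?cs"
    by (subst sum.swap) (simp add: fc_sum sum_distrib_left sum_distrib_right mult_ac)
  finally have cs: "bs ! i - ?S ?cs \<in> mpow n" .
  obtain c0 where c0: "\<And>cs. length cs = length bs \<Longrightarrow> bs ! i - ?S cs \<in> mpow n \<Longrightarrow> cs = c0"
    using uniq by (elim ex1E) blast
  have "?cs = c0" by (rule c0[OF _ cs]) simp
  moreover have "?ds = c0" by (rule c0[OF _ ds]) simp
  ultimately have "?cs ! k = ?ds ! k" by (simp only:)
  then show ?thesis using ik by simp
qed

end

lemma gram_isometric:
  assumes bs: "is_basis_mod R (mpow n) bs" and bs': "is_basis_mod R (mpow n) bs'"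
    and lin: "linear_form_on R \<eta>" and van: "\<And>z. z \<in> mpow n \<Longrightarrow> \<eta> z = 0"
  shows "isometric_mat (gram \<eta> bs) (gram \<eta> bs')"
proof -
  from basis_change[OF bs bs'] obtain p
    where "\<forall>j<length bs'. bs' ! j - (\<Sum>k<length bs. fract_const (p k j) * bs ! k) \<in> mpow n"
    by (rule exE)
  note p = this[rule_format]
  from basis_change[OF bs' bs] obtain q
    where "\<forall>j<length bs. bs ! j - (\<Sum>k<length bs'. fract_const (q k j) * bs' ! k) \<in> mpow n"
    by (rule exE)
  note q = this[rule_format]
  note pq = basis_change_inverse[OF bs bs' p q] and qp = basis_change_inverse[OF bs' bs q p]
  have "length bs \<le> length bs'" by (rule right_inverse_size[where p = p and q = q]) (use pq in simp)
  moreover have "length bs' \<le> length bs" by (rule right_inverse_size[where p = q and q = p]) (use qp in simp)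
  ultimately have len: "length bs' = length bs" by simp
  have R: "bs ! i \<in> R" "bs' ! i \<in> R" if "i < length bs" for i
    using that bs bs' len by (auto simp: is_basis_mod_def)
  show ?thesis
  proof (rule isometric_matI[where p = p and q = q])
    show "gram \<eta> bs \<in> carrier_mat (length bs) (length bs)" "gram \<eta> bs' \<in> carrier_mat (length bs) (length bs)"
      by (simp_all add: gram_def len)
    fix i j assume ij: "i < length bs" "j < length bs"
    show "(\<Sum>k<length bs. p i k * q k j) = (if i = j then 1 else 0)" using pq[of j i] ij len by simp
    let ?e = "\<lambda>j. \<Sum>k<length bs. fract_const (p k j) * bs ! k"
    have e: "?e j \<in> R" for j using R by (intro sum_mem mult_mem) auto
    have "bs' ! i * bs' ! j - ?e i * ?e j = (bs' ! i - ?e i) * bs' ! j + ?e i * (bs' ! j - ?e j)"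
      by (simp add: algebra_simps)
    also have "\<dots> \<in> mpow n"
      using p[of i] p[of j] ij R e len by (intro mpow_add mpow_mult_left mpow_mult_right) simp_all
    finally have "\<eta> (bs' ! i * bs' ! j) = \<eta> (?e i * ?e j)"
      using linear_form_on_diff[OF lin, of "bs' ! i * bs' ! j" "?e i * ?e j"] van ij R e
      by (simp add: mult_mem)
    also have "?e i * ?e j = (\<Sum>k<length bs. \<Sum>l<length bs. fract_const (p k i * p l j) * (bs ! k * bs ! l))"
      by (simp add: sum_product mult_ac)
    also have "\<eta> \<dots> = (\<Sum>k<length bs. \<Sum>l<length bs. \<eta> (fract_const (p k i * p l j) * (bs ! k * bs ! l)))"
      using R
      by (subst linear_form_on_sum[OF lin], (intro sum_mem mult_mem const_mem; simp)+)
        (intro sum.cong refl linear_form_on_sum[OF lin] mult_mem const_mem; simp)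
    also have "\<dots> = (\<Sum>k<length bs. \<Sum>l<length bs. p k i * gram \<eta> bs $$ (k, l) * p l j)"
      using R
      by (intro sum.cong refl, subst linear_form_onD(2)[OF lin]) (simp_all add: mult_mem gram_def mult_ac)
    finally show "gram \<eta> bs' $$ (i, j) = (\<Sum>k<length bs. \<Sum>l<length bs. p k i * gram \<eta> bs $$ (k, l) * p l j)"
      using ij len by (simp add: gram_def)
  qed
qed

text \<open>Newton iteration for u = e rho^2. Only a finite power of the maximal ideal has to be
  reached, so finitely many steps inside R suffice and no completion enters.\<close>

lemma hensel_square:
  assumes two: "(2 :: 'l) \<noteq> 0" and e: "e * e = 1" and u: "u \<in> R"
    and \<rho>: "unit \<rho>" "u - fract_const e * \<rho>\<^sup>2 \<in> mpow 1"
  shows "\<exists>\<rho>. unit \<rho> \<and> u - fract_const e * \<rho>\<^sup>2 \<in> mpow (Suc n)"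
proof (induction n)
  case 0
  then show ?case using \<rho> by auto
next
  case (Suc n)
  then obtain r where r: "unit r" "u - fract_const e * r\<^sup>2 \<in> mpow (Suc n)" by blast
  define h :: "'l poly fract" where "h = fract_const (inverse 2)"
  have h: "h \<in> R" unfolding h_def by (rule const_mem)
  have "inverse 2 + inverse 2 = (1 :: 'l)" using two by (simp add: field_simps)
  then have h2: "h + h = 1" unfolding h_def by (metis fract_const_simps(2,3))
  have ee: "fract_const e * fract_const e = 1" using e by (simp flip: fract_const_simps(6))
  let ?D = "u - fract_const e * r\<^sup>2"
  \<comment> \<open>The Newton correction D / (2 e r), written with e = 1/e; it cancels D and leaves
    only its own square.\<close>
  let ?w = "h * fract_const e * inverse r * ?D"
  have ir: "inverse r \<in> R" "r * inverse r = 1" using r by (auto simp: unit_def)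
  have w: "?w \<in> mpow (Suc n)" using r(2) ir(1) h by (intro mpow_mult_left mult_mem) simp_all
  have "r + ?w \<notin> mpow 1"
  proof
    assume "r + ?w \<in> mpow 1"
    moreover have "?w \<in> mpow 1" using w mpow_antimono[of 1 "Suc n"] by auto
    ultimately have "r + ?w - ?w \<in> mpow 1" by (rule mpow_diff)
    then show False using unit_not_mpow[OF r(1)] by simp
  qed
  then have unit: "unit (r + ?w)"
    unfolding unit_iff using unit_mem[OF r(1)] mpow_mem[OF w] add_mem by blast
  have "fract_const e * (r + ?w)\<^sup>2
      = fract_const e * r\<^sup>2 + (fract_const e * fract_const e) * (h + h) * (r * inverse r) * ?D + fract_const e * (?w * ?w)"
    by (simp add: power2_eq_square algebra_simps)
  then have "u - fract_const e * (r + ?w)\<^sup>2 = - (fract_const e * (?w * ?w))"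
    unfolding h2 ee ir(2) by simp
  also have "\<dots> \<in> mpow (Suc n + Suc n)" by (intro mpow_uminus mpow_mult_left mpow_mult w) simp
  finally have "u - fract_const e * (r + ?w)\<^sup>2 \<in> mpow (Suc (Suc n))"
    using mpow_antimono[of "Suc (Suc n)" "Suc n + Suc n"] by auto
  with unit show ?case by blast
qed

end

lemma pcompose_power: "pcompose (A ^ n) B = pcompose A B ^ n" for A :: "'l::field poly"
  by (induction n) (simp_all add: pcompose_mult pcompose_1)

text \<open>Taylor expansion at b: substituting s + b for s turns the claim into the expansion in
  ordinary monomials.\<close>

lemma shifted_monomial_expansion:
  fixes b :: "'l::field"
  assumes "degree A < d"
  shows "\<exists>!cs. length cs = d \<and> A = (\<Sum>i<d. Polynomial.smult (cs ! i) ([:- b, 1:] ^ i))"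
proof (intro ex1I conjI)
  let ?A = "pcompose A [:b, 1:]"
  have inv: "pcompose (pcompose B [:b, 1:]) [:- b, 1:] = B" "pcompose (pcompose B [:- b, 1:]) [:b, 1:] = B" for B
    by (simp_all add: pcompose_assoc[symmetric] pcompose_pCons)
  have expand: "pcompose (\<Sum>i<d. monom (c i) i) [:- b, 1:] = (\<Sum>i<d. Polynomial.smult (c i) ([:- b, 1:] ^ i))" for c
    by (simp add: pcompose_sum monom_altdef pcompose_smult pcompose_power pcompose_pCons)
  show "length (map (coeff ?A) [0..<d]) = d" by simp
  have "degree ?A < d" using assms by (simp add: degree_pcompose)
  then have "?A = (\<Sum>i<d. monom (coeff ?A i) i)"
    by (intro poly_eqI) (simp add: coeff_sum coeff_eq_0)
  then have "A = pcompose (\<Sum>i<d. monom (coeff ?A i) i) [:- b, 1:]" using inv(1)[of A] by simp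
  then show "A = (\<Sum>i<d. Polynomial.smult (map (coeff ?A) [0..<d] ! i) ([:- b, 1:] ^ i))"
    unfolding expand by simp
  fix cs assume cs: "length cs = d \<and> A = (\<Sum>i<d. Polynomial.smult (cs ! i) ([:- b, 1:] ^ i))"
  then have "A = pcompose (\<Sum>i<d. monom (cs ! i) i) [:- b, 1:]" by (simp only: expand)
  then have "?A = (\<Sum>i<d. monom (cs ! i) i)" by (simp only: inv)
  then have "coeff ?A i = cs ! i" if "i < d" for i using that by (simp add: coeff_sum)
  then show "cs = map (coeff ?A) [0..<d]" using cs by (intro nth_equalityI) auto
qed

context primary_quotient
begin

text \<open>The unit rho is put into the basis so that its square appears in the Gram matrix, where
  it is congruent to e u.\<close>

lemma is_basis_mod_shifted_monomials:
  assumes \<rho>: "unit \<rho>"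
  shows "is_basis_mod R (mpow n) (map (\<lambda>i. \<rho> * to_fract ([:- b, 1:] ^ i)) [0..<d])" (is "is_basis_mod R _ ?bs")
  unfolding is_basis_mod_def
proof (intro conjI ballI)
  show "set ?bs \<subseteq> R" using unit_mem[OF \<rho>] by (auto intro!: mult_mem simp del: to_fract_power)
  fix r assume r: "r \<in> R"
  let ?E = "\<lambda>cs. \<Sum>i<d. Polynomial.smult (cs ! i) ([:- b, 1:] ^ i)"
  let ?A = "rep n (inverse \<rho> * r)"
  have r': "inverse \<rho> * r \<in> R" using r unit_mem[OF unit_inverse[OF \<rho>]] by (rule mult_mem[rotated])
  have "r - (\<Sum>i<length ?bs. fract_const (cs ! i) * ?bs ! i) \<in> mpow n \<longleftrightarrow> ?A = ?E cs" for cs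
  proof -
    have "r - (\<Sum>i<length ?bs. fract_const (cs ! i) * ?bs ! i) = \<rho> * (inverse \<rho> * r - to_fract (?E cs))"
      using unit_nz[OF \<rho>]
      by (simp add: to_fract_smult right_diff_distrib sum_distrib_left mult_ac del: to_fract_power)
    moreover have "\<rho> * z \<in> mpow n \<longleftrightarrow> z \<in> mpow n" for z
    proof
      assume "\<rho> * z \<in> mpow n"
      from mpow_mult_left[OF unit_mem[OF unit_inverse[OF \<rho>]] this] show "z \<in> mpow n"
        using unit_nz[OF \<rho>] by (simp add: mult.assoc[symmetric])
    qed (rule mpow_mult_left[OF unit_mem[OF \<rho>]])
    moreover have "degree (?E cs) < d"
    proof -
      have "degree (?E cs) \<le> d - 1"
        by (intro degree_sum_le) (auto simp: degree_power_eq intro!: order.trans[OF degree_smult_le])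
      then show ?thesis using d_pos by simp
    qed
    then have mod: "?E cs mod H = ?E cs" by (rule mod_poly_less)
    have "inverse \<rho> * r - to_fract (?E cs) \<in> mpow n \<longleftrightarrow> ?A = ?E cs"
    proof
      assume "inverse \<rho> * r - to_fract (?E cs) \<in> mpow n"
      from rep_eqI[OF this] show "?A = ?E cs" unfolding mod .
    next
      assume A: "?A = ?E cs"
      show "inverse \<rho> * r - to_fract (?E cs) \<in> mpow n"
        unfolding A[symmetric] by (rule rep_cong[OF r'])
    qed
    ultimately show ?thesis by simp
  qed
  then show "\<exists>!cs. length cs = length ?bs \<and> r - (\<Sum>i<length ?bs. fract_const (cs ! i) * ?bs ! i) \<in> mpow n"
    using shifted_monomial_expansion[OF degree_rep[OF r' n_pos], of b] by simp
qed

text \<open>Because rho^2 = e u modulo G^n, the entry at (i, j) is e \<eta>(u (s - b)^(i+j)), that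
  is, e times a top coefficient of a remainder. Exponents up to 2d - 2 are the sums i + j that
  occur.\<close>

lemma gw_class_residue_form:
  assumes two: "(2 :: 'l) \<noteq> 0" and e: "e * e = 1" and d: "d = 2 * m + 1"
    and antidiagonal: "\<And>k. k \<le> 2 * d - 2 \<Longrightarrow>
      coeff ([:- b, 1:] ^ k mod H) (d - 1) = (if k + 1 = d then 1 else 0)"
    and u: "unit u" and \<rho>: "unit \<rho>" "u - fract_const e * \<rho>\<^sup>2 \<in> mpow n"
    and a: "is_bezoutian R (to_fract G ^ n * u) a"
    and \<eta>: "is_theta_inverse_one R (to_fract G ^ n * u) a \<eta>"
    and bs: "is_basis_mod R ((\<lambda>r. to_fract G ^ n * u * r) ` R) bs"
  shows "gw_class (gram \<eta> bs) = zmult (int m) gw_h + gw_unary e"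
proof -
  let ?bs = "map (\<lambda>i. \<rho> * to_fract ([:- b, 1:] ^ i)) [0..<d]"
  note van = theta_inverse_one_eval(2)[OF u a \<eta>]
  note lin = vanishing_formD(1)[OF van]
  have ee: "fract_const e * fract_const e = 1" using e by (simp flip: fract_const_simps(6))
  have e0: "e \<noteq> 0" using e by auto
  have "gram \<eta> ?bs = antidiag e d"
  proof (rule eq_matI)
    fix i j assume "i < dim_row (antidiag e d)" "j < dim_col (antidiag e d)"
    then have ij: "i < d" "j < d" by (simp_all add: antidiag_def)
    let ?E = "[:- b, 1:] ^ (i + j) :: 'l poly"
    have "fract_const e * (u - fract_const e * \<rho>\<^sup>2) * to_fract ?E \<in> mpow n"
      by (rule mpow_mult_right[OF mpow_mult_left[OF const_mem \<rho>(2)] to_fract_mem])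
    also have "fract_const e * (u - fract_const e * \<rho>\<^sup>2) * to_fract ?E
        = fract_const e * (u * to_fract ?E) - (fract_const e * fract_const e) * (\<rho>\<^sup>2 * to_fract ?E)"
      by (simp add: algebra_simps)
    finally have "\<eta> (fract_const e * (u * to_fract ?E)) = \<eta> (\<rho>\<^sup>2 * to_fract ?E)"
      using unit_mem[OF u] unit_mem[OF \<rho>(1)] unfolding ee
      by (intro vanishing_form_cong[OF van] mult_mem power_mem) (simp_all add: power_mem)
    moreover have "\<eta> (fract_const e * (u * to_fract ?E)) = e * coeff (?E mod H) (d - 1)"
      using unit_mem[OF u] theta_inverse_one_eval(1)[OF u a \<eta>]
      by (subst linear_form_onD(2)[OF lin]) (simp_all add: mult_mem del: to_fract_power)
    moreover have "i + j \<le> 2 * d - 2" using ij by simp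
    ultimately have "\<eta> (\<rho>\<^sup>2 * to_fract ?E) = (if i + j + 1 = d then e else 0)"
      using antidiagonal by simp
    moreover have "\<rho>\<^sup>2 * to_fract ?E = ?bs ! i * ?bs ! j"
      using ij by (simp add: power_add power2_eq_square mult_ac)
    ultimately show "gram \<eta> ?bs $$ (i, j) = antidiag e d $$ (i, j)"
      using ij by (simp add: gram_def antidiag_def)
  qed (simp_all add: gram_def antidiag_def)
  moreover have "isometric_mat (gram \<eta> ?bs) (gram \<eta> bs)"
    using bs vanishing_formD(2)[OF van] unfolding mpow_eq_multiples[OF u]
    by (intro gram_isometric[OF is_basis_mod_shifted_monomials[OF \<rho>(1)] _ lin])
  ultimately have "gw_class (antidiag e d) = gw_class (gram \<eta> bs)"
    using gw_class_isometric[OF symmetric_form_antidiag[OF e0]] by simp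
  then show ?thesis using gw_class_antidiag[OF e0 two, of m] d by simp
qed

end

section \<open>Nisnevich coordinates and the local index\<close>

declare max_ideal_pow.simps [simp del]

text \<open>G is carried as a parameter so that \<open>target_ring\<close> becomes the concrete ring
  \<open>local_ring (Finite G)\<close>, to which the results on residue forms apply.\<close>

locale nisnevich =
  fixes q :: "'l::field poly point" and x :: "'l poly fract" and G :: "'l poly"
  assumes closed_point: "q \<in> closed_points" and coordinate: "nisnevich_coordinate q x"
    and G_irreducible: "irreducible G" and G_monic: "lead_coeff G = 1"
    and eval_at_max_ideal: "eval_at x B \<in> max_ideal q \<longleftrightarrow> G dvd B"
begin

lemma x_mem: "x \<in> local_ring q"
  using coordinate unfolding nisnevich_coordinate_def by (elim conjE)

lemma x_nonconstant: "nonconstant x"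
  using coordinate unfolding nisnevich_coordinate_def nonconstant_def by (elim conjE)

lemma target_ring_eq: "target_ring q x = local_ring (Finite G)"
  unfolding target_ring_def by (simp add: eval_at_max_ideal local_ring.simps)

lemma target_ideal_eq: "target_ideal q x = {Fract A B | A B. G dvd A \<and> \<not> G dvd B}"
  unfolding target_ideal_def by (simp add: eval_at_max_ideal)

abbreviation "\<pi> \<equiv> eval_at x G"

text \<open>Here unramifiedness is used: the ideal downstairs generates the one upstairs, and
  downstairs everything is G times a fraction whose denominator stays a unit after pullback.\<close>

lemma max_ideal_multiples: "max_ideal q = (\<lambda>z. \<pi> * z) ` local_ring q"
proof -
  interpret P: dvr_over "local_ring q" "uniformizer q" by (rule dvr_over_point[OF closed_point])
  have "max_ideal q = local_ring q \<odot> pullback x ` target_ideal q x"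
    using coordinate unfolding nisnevich_coordinate_def by (elim conjE)
  also have "\<dots> = (\<lambda>z. \<pi> * z) ` local_ring q"
  proof (rule P.ideal_prod_principal)
    have "to_fract G \<in> target_ideal q x"
      unfolding target_ideal_eq to_fract_def
      by (insert irreducible_not_unit[OF G_irreducible], intro CollectI, rule exI[of _ G], rule exI[of _ 1]) simp
    then show "\<pi> \<in> pullback x ` target_ideal q x"
      using pullback_to_fract[OF x_nonconstant, of G] by (metis imageI)
    show "pullback x ` target_ideal q x \<subseteq> (\<lambda>z. \<pi> * z) ` local_ring q"
    proof
      fix w assume "w \<in> pullback x ` target_ideal q x"
      then obtain A B where AB: "w = pullback x (Fract A B)" "G dvd A" "\<not> G dvd B"
        unfolding target_ideal_eq by blast
      then have B0: "B \<noteq> 0" by auto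
      obtain C where C: "A = G * C" using AB(2) by (elim dvdE)
      have "eval_at x B \<in> local_ring q" "eval_at x B \<notin> P.mpow 1"
        using P.eval_at_mem[OF x_mem] eval_at_max_ideal AB(3) max_ideal_eq[OF P.dvr_axioms] by auto
      then have "P.unit (eval_at x B)" unfolding P.unit_iff by blast
      then have "eval_at x C * inverse (eval_at x B) \<in> local_ring q"
        using P.eval_at_mem[OF x_mem] by (simp add: P.mult_mem P.unit_def)
      moreover have "w = \<pi> * (eval_at x C * inverse (eval_at x B))"
        unfolding AB(1) pullback_Fract[OF x_nonconstant B0] C by (simp add: divide_inverse mult.assoc)
      ultimately show "w \<in> (\<lambda>z. \<pi> * z) ` local_ring q" by blast
    qed
  qed
  finally show ?thesis .
qed

sublocale Y: dvr_over "local_ring q" \<pi>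
proof -
  interpret P: dvr_over "local_ring q" "uniformizer q" by (rule dvr_over_point[OF closed_point])
  have mem: "\<pi> \<in> local_ring q" by (rule P.eval_at_mem[OF x_mem])
  show "dvr_over (local_ring q) \<pi>"
  proof
    show "\<pi> \<in> local_ring q" by (rule mem)
    show nz: "\<pi> \<noteq> 0" using G_irreducible by (auto simp: eval_at_eq_0[OF x_nonconstant])
    have "\<pi> \<in> max_ideal q" using eval_at_max_ideal by simp
    then have nonunit: "\<not> (\<exists>w\<in>local_ring q. \<pi> * w = 1)" unfolding max_ideal_def by blast
    show "inverse \<pi> \<notin> local_ring q"
    proof
      assume "inverse \<pi> \<in> local_ring q"
      then have "\<exists>w\<in>local_ring q. \<pi> * w = 1" by (intro bexI[of _ "inverse \<pi>"]) (simp_all add: nz)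
      with nonunit show False ..
    qed
    fix z assume z: "z \<in> local_ring q"
    show "(\<exists>w\<in>local_ring q. z = \<pi> * w) \<or> inverse z \<in> local_ring q"
    proof (cases "z \<in> max_ideal q")
      case True
      then show ?thesis unfolding max_ideal_multiples by blast
    next
      case False
      then have "P.unit z" using z unfolding max_ideal_eq[OF P.dvr_axioms] P.unit_iff by blast
      then show ?thesis by (simp add: P.unit_def)
    qed
  qed (simp_all add: P.add_mem P.mult_mem P.uminus_mem)
qed

sublocale T: dvr_over "local_ring (Finite G)" "to_fract G"
  by (rule dvr_over_Finite[OF G_irreducible])

lemma max_ideal_mpow: "max_ideal q = Y.mpow 1"
  by (rule max_ideal_eq[OF Y.dvr_axioms])

lemma max_ideal_pow_mpow: "max_ideal_pow q m = Y.mpow m"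
  by (rule max_ideal_pow_eq[OF Y.dvr_axioms])

lemma eval_at_unit: "\<not> G dvd B \<Longrightarrow> Y.unit (eval_at x B)"
  unfolding Y.unit_iff using Y.eval_at_mem[OF x_mem] eval_at_max_ideal max_ideal_mpow by blast

lemma pullback_mem:
  assumes "r \<in> local_ring (Finite G)" shows "pullback x r \<in> local_ring q"
proof -
  obtain A B where AB: "r = Fract A B" "\<not> G dvd B" using assms by (auto simp: local_ring.simps)
  then have "B \<noteq> 0" by auto
  then have "pullback x r = eval_at x A * inverse (eval_at x B)"
    unfolding AB(1) by (simp add: pullback_Fract[OF x_nonconstant] divide_inverse)
  then show ?thesis
    using Y.eval_at_mem[OF x_mem] Y.unit_mem[OF Y.unit_inverse[OF eval_at_unit[OF AB(2)]]] by (simp add: Y.mult_mem)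
qed

lemma pullback_unit: "T.unit r \<Longrightarrow> Y.unit (pullback x r)"
  using pullback_mem[of r] pullback_mem[of "inverse r"]
  by (simp add: T.unit_def Y.unit_def pullback_inverse[OF x_nonconstant] pullback_eq_0[OF x_nonconstant])

lemma pullback_mpow_1:
  assumes "r \<in> local_ring (Finite G)" shows "pullback x r \<in> Y.mpow 1 \<longleftrightarrow> r \<in> T.mpow 1"
proof
  assume "pullback x r \<in> Y.mpow 1"
  then have "\<not> T.unit r" using pullback_unit Y.unit_not_mpow by blast
  then show "r \<in> T.mpow 1" using assms T.unit_iff by blast
next
  assume "r \<in> T.mpow 1"
  then obtain w where w: "w \<in> local_ring (Finite G)" "r = to_fract G * w" by (elim T.mpow_1E)
  then show "pullback x r \<in> Y.mpow 1"
    using Y.mpow_1I[OF pullback_mem[OF w(1)]]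
    by (simp only: pullback_mult[OF x_nonconstant] pullback_to_fract[OF x_nonconstant])
qed

lemma residue_field:
  assumes "z \<in> local_ring q"
  obtains r where "r \<in> local_ring (Finite G)" "z - pullback x r \<in> Y.mpow 1"
  using coordinate assms that unfolding nisnevich_coordinate_def target_ring_eq max_ideal_mpow by blast

text \<open>Pullback preserves orders, since G and its pullback G(x) are uniformizers below and
  above, and units and nonunits are respected.\<close>

lemma order_decomposition:
  assumes F: "F \<in> local_ring (Finite G)" "pullback x F \<in> Y.mpow n" "pullback x F \<notin> Y.mpow (Suc n)"
  obtains u where "T.unit u" "F = to_fract G ^ n * u"
proof -
  have pb: "pullback x (to_fract G ^ j * w) = \<pi> ^ j * pullback x w" for j w
    by (simp add: pullback_mult[OF x_nonconstant] pullback_power[OF x_nonconstant] pullback_to_fract[OF x_nonconstant])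
  have "F \<in> T.mpow j" if "j \<le> n" for j
    using that
  proof (induction j)
    case (Suc j)
    then obtain w where w: "w \<in> local_ring (Finite G)" "F = to_fract G ^ j * w" by (auto elim: T.mpow_memE)
    have "\<not> T.unit w"
    proof
      assume "T.unit w"
      from Y.unif_power_unit_mpow[OF pullback_unit[OF this], of j n] F(2) Suc.prems
      show False by (simp add: w(2) pb)
    qed
    then have "w \<in> T.mpow 1" using w(1) T.unit_iff by blast
    then have "F \<in> T.mpow (j + 1)" unfolding w(2) by (intro T.mpow_mult) auto
    then show ?case by simp
  qed (use F in simp)
  then obtain w where w: "w \<in> local_ring (Finite G)" "F = to_fract G ^ n * w" by (auto elim: T.mpow_memE)
  have "w \<notin> T.mpow 1"
  proof
    assume "w \<in> T.mpow 1"
    then have "pullback x w \<in> Y.mpow 1" using pullback_mpow_1[OF w(1)] by blast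
    then have "pullback x F \<in> Y.mpow (n + 1)" unfolding w(2) pb by (intro Y.mpow_mult) auto
    with F(3) show False by simp
  qed
  then show thesis using that w T.unit_iff by blast
qed

text \<open>All data of the index are arbitrary; the hypotheses only fix the leading term of the
  section. The centre b is at the disposal of the caller: 0 for the purinseparable point, the value
  of x at infinity.\<close>

lemma computes_index_unique:
  assumes two: "(2 :: 'l) \<noteq> 0" and e: "e * e = 1" and n: "n > 0"
    and d: "degree (G ^ n) = 2 * m + 1"
    and antidiagonal: "\<And>k. k \<le> 2 * degree (G ^ n) - 2 \<Longrightarrow>
      coeff ([:- b, 1:] ^ k mod G ^ n) (degree (G ^ n) - 1) = (if k + 1 = degree (G ^ n) then 1 else 0)"
    and \<sigma>\<^sub>0: "\<sigma>\<^sub>0 \<in> max_ideal_pow q N" "\<sigma>\<^sub>0 \<notin> max_ideal_pow q (Suc N)"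
    and z: "Y.unit z" "\<sigma>\<^sub>0 - fract_const e * z\<^sup>2 * \<pi> ^ n \<in> Y.mpow (Suc n)"
    and g: "g \<in> max_ideal_pow q (2 * N)"
    and F: "F \<in> target_ring q x" "\<sigma>\<^sub>0 + g = pullback x F"
    and a: "is_bezoutian (target_ring q x) F a"
    and \<eta>: "is_theta_inverse_one (target_ring q x) F a \<eta>"
    and bs: "is_basis_mod (target_ring q x) ((\<lambda>r. F * r) ` target_ring q x) bs"
  shows "gw_class (gram \<eta> bs) = zmult (int m) gw_h + gw_unary e"
proof -
  interpret primary_quotient G n
    by standard (simp_all add: G_irreducible G_monic n)
  have e0: "e \<noteq> 0" using e by auto
  let ?c = "fract_const e * z\<^sup>2"
  have c: "Y.unit ?c" using Y.unit_mult[OF Y.unit_const[OF e0] Y.unit_power[OF z(1)]] .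
  have "\<sigma>\<^sub>0 \<in> Y.mpow j \<longleftrightarrow> j \<le> n" if "j \<le> Suc n" for j
  proof -
    have z': "\<sigma>\<^sub>0 - \<pi> ^ n * ?c \<in> Y.mpow j"
      using z(2) Y.mpow_antimono[OF that] by (auto simp: mult.commute)
    have "\<sigma>\<^sub>0 \<in> Y.mpow j \<longleftrightarrow> \<pi> ^ n * ?c \<in> Y.mpow j"
      using Y.mpow_diff[OF _ z', of \<sigma>\<^sub>0] Y.mpow_add[OF z', of "\<pi> ^ n * ?c"] by auto
    then show ?thesis using Y.unif_power_unit_mpow[OF c] by simp
  qed
  note order = this
  \<comment> \<open>The order used in the data is forced by the leading term.\<close>
  have "N = n"
  proof (rule ccontr)
    assume "N \<noteq> n"
    then consider "Suc N \<le> n" | "Suc n \<le> N" by linarith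
    then show False
    proof cases
      case 1
      then show False using \<sigma>\<^sub>0(2) order[of "Suc N"] by (simp add: max_ideal_pow_mpow)
    next
      case 2
      then have "\<sigma>\<^sub>0 \<in> Y.mpow (Suc n)" using \<sigma>\<^sub>0(1) Y.mpow_antimono[of "Suc n" N] by (auto simp: max_ideal_pow_mpow)
      then show False using order[of "Suc n"] by simp
    qed
  qed
  \<comment> \<open>As n > 0, 2n is at least n + 1, so the correction leaves the leading term
    alone.\<close>
  then have g': "g \<in> Y.mpow (Suc n)"
    using g n Y.mpow_antimono[of "Suc n" "2 * n"] by (auto simp: max_ideal_pow_mpow)
  have "\<sigma>\<^sub>0 + g \<in> Y.mpow n" "\<sigma>\<^sub>0 + g \<notin> Y.mpow (Suc n)"
    using order[of n] order[of "Suc n"] g' Y.mpow_antimono[of n "Suc n"] Y.mpow_add[of \<sigma>\<^sub>0 n g]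
      Y.mpow_diff[of "\<sigma>\<^sub>0 + g" "Suc n" g] by auto
  then obtain u where u: "T.unit u" "F = to_fract G ^ n * u"
    using F unfolding target_ring_eq by (elim order_decomposition) auto
  have "\<pi> ^ n * (pullback x u - ?c) = (\<sigma>\<^sub>0 - ?c * \<pi> ^ n) + g"
    using F(2) unfolding u(2) by (simp add: x_nonconstant algebra_simps)
  also have "\<dots> \<in> Y.mpow (Suc n)" using z(2) g' by (rule Y.mpow_add)
  finally obtain w where w: "w \<in> local_ring q" "\<pi> ^ n * (pullback x u - ?c) = \<pi> ^ Suc n * w"
    by (elim Y.mpow_memE)
  then have "pullback x u - ?c = \<pi> * w" by simp
  then have uc: "pullback x u - ?c \<in> Y.mpow 1" using Y.mpow_1I[OF w(1)] by simp
  \<comment> \<open>The isomorphism of residue fields replaces z, which lives upstairs, by an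
    element r of R; then u = e r^2 holds in the residue field of R.\<close>
  obtain r where r: "r \<in> local_ring (Finite G)" "z - pullback x r \<in> Y.mpow 1"
    using residue_field[OF Y.unit_mem[OF z(1)]] .
  have ur: "u - fract_const e * r\<^sup>2 \<in> local_ring (Finite G)"
    using T.unit_mem[OF u(1)] r(1) by (intro T.diff_mem T.mult_mem T.power_mem) simp_all
  have "pullback x (u - fract_const e * r\<^sup>2)
      = (pullback x u - ?c) + (z - pullback x r) * (fract_const e * (z + pullback x r))"
    by (simp add: x_nonconstant algebra_simps power2_eq_square)
  also have "\<dots> \<in> Y.mpow 1"
    using uc r Y.unit_mem[OF z(1)] pullback_mem[OF r(1)]
    by (intro Y.mpow_add Y.mpow_mult_right Y.mult_mem Y.add_mem) simp_all
  finally have ur1: "u - fract_const e * r\<^sup>2 \<in> T.mpow 1" using pullback_mpow_1[OF ur] by blast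
  have "pullback x r \<notin> Y.mpow 1"
    using Y.mpow_add[OF r(2), of "pullback x r"] Y.unit_not_mpow[OF z(1)] by auto
  then have "T.unit r" using T.unit_iff r(1) pullback_mpow_1[OF r(1)] by blast
  from T.hensel_square[OF two e T.unit_mem[OF u(1)] this ur1, of "n - 1"] n
  obtain \<rho> where "T.unit \<rho>" "u - fract_const e * \<rho>\<^sup>2 \<in> T.mpow n" by auto
  then show ?thesis
    using a \<eta> bs unfolding target_ring_eq u(2)
    by (intro gw_class_residue_form[OF two e d antidiagonal u(1)])
qed

lemma computes_index_exists:
  assumes v: "compatible_trivialization V N c q x v" and \<sigma>: "\<sigma> = \<sigma>\<^sub>0 * v"
    and \<sigma>\<^sub>0: "\<sigma>\<^sub>0 \<in> max_ideal_pow q n" "\<sigma>\<^sub>0 \<notin> max_ideal_pow q (Suc n)" and n: "n > 0"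
    and g: "g \<in> max_ideal_pow q (2 * n)" and A: "\<sigma>\<^sub>0 + g = eval_at x A"
  shows "\<exists>w. computes_index V N c \<sigma> q w"
proof -
  interpret primary_quotient G n
    by standard (simp_all add: G_irreducible G_monic n)
  let ?F = "to_fract A"
  have F: "pullback x ?F = \<sigma>\<^sub>0 + g" by (simp add: x_nonconstant A)
  have g': "g \<in> Y.mpow (Suc n)"
    using g n Y.mpow_antimono[of "Suc n" "2 * n"] by (auto simp: max_ideal_pow_mpow)
  have "pullback x ?F \<in> Y.mpow n" "pullback x ?F \<notin> Y.mpow (Suc n)"
    unfolding F
    using \<sigma>\<^sub>0 g' Y.mpow_antimono[of n "Suc n"] Y.mpow_add[of \<sigma>\<^sub>0 n g]
      Y.mpow_diff[of "\<sigma>\<^sub>0 + g" "Suc n" g] by (auto simp: max_ideal_pow_mpow)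
  then obtain u where u: "T.unit u" "?F = to_fract G ^ n * u"
    by (elim order_decomposition[OF to_fract_mem])
  obtain a where a: "is_bezoutian R ?F a" using bezoutian_exists by blast
  obtain \<eta> where \<eta>: "is_theta_inverse_one R ?F a \<eta>"
    using theta_inverse_one_exists[OF u(1) a[unfolded u(2)]] unfolding u(2) by blast
  obtain bs where bs: "is_basis_mod R ((\<lambda>r. ?F * r) ` R) bs"
    using is_basis_mod_shifted_monomials[OF T.unit_1] unfolding u(2) mpow_eq_multiples[OF u(1)] by blast
  have "computes_index V N c \<sigma> q (gw_class (gram \<eta> bs))"
    unfolding computes_index_def gram_def
    by (rule exI[of _ x], rule exI[of _ v], rule exI[of _ \<sigma>\<^sub>0], rule exI[of _ n], rule exI[of _ g],
        rule exI[of _ ?F], rule exI[of _ a], rule exI[of _ \<eta>], rule exI[of _ bs])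
      (intro conjI coordinate v \<sigma> \<sigma>\<^sub>0 g F[symmetric] refl
        to_fract_mem[folded target_ring_eq] a[folded target_ring_eq] \<eta>[folded target_ring_eq] bs[folded target_ring_eq])
  then show ?thesis by blast
qed

end

text \<open>The polynomials vanishing at q form a prime ideal. Dividing a nonzero member into
  irreducible factors finds G, and G generates because everything else is invertible modulo
  G.\<close>

lemma nisnevich_exists:
  fixes q :: "'l::field poly point"
  assumes q: "q \<in> closed_points" and x: "nisnevich_coordinate q x"
  obtains G where "nisnevich q x G"
proof -
  interpret P: dvr_over "local_ring q" "uniformizer q" by (rule dvr_over_point[OF q])
  have m: "max_ideal q = P.mpow 1" by (rule max_ideal_eq[OF P.dvr_axioms])
  have xm: "x \<in> local_ring q" and nc: "nonconstant x"
    using x unfolding nisnevich_coordinate_def nonconstant_def by blast+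
  have prime: "eval_at x A \<in> max_ideal q \<or> eval_at x B \<in> max_ideal q" if "eval_at x (A * B) \<in> max_ideal q" for A B
  proof (rule ccontr)
    assume "\<not> ?thesis"
    then have "P.unit (eval_at x A)" "P.unit (eval_at x B)"
      unfolding m P.unit_iff using P.eval_at_mem[OF xm] by blast+
    from P.unit_mult[OF this] that show False unfolding m using P.unit_not_mpow by simp
  qed
  \<comment> \<open>Otherwise the target ideal is 0 and, by unramifiedness, so is the maximal ideal
    of q, which contains a uniformizer.\<close>
  have "\<exists>B. B \<noteq> 0 \<and> eval_at x B \<in> max_ideal q"
  proof (rule ccontr)
    assume "\<not> ?thesis"
    then have *: "A = 0" if "eval_at x A \<in> max_ideal q" for A using that by blast
    have "z = 0" if z: "z \<in> target_ideal q x" for z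
    proof -
      obtain A B where "z = Fract A B" "eval_at x A \<in> max_ideal q"
        using z unfolding target_ideal_def by blast
      then show ?thesis using *[of A] by (simp add: Fract_conv_to_fract)
    qed
    then have "pullback x ` target_ideal q x \<subseteq> {0}" using nc by (auto simp: pullback_0)
    then have "s = 0" if s: "s \<in> local_ring q \<odot> pullback x ` target_ideal q x" for s
    proof -
      obtain xs where xs: "s = (\<Sum>(a, b)\<leftarrow>xs. a * b)" "set xs \<subseteq> local_ring q \<times> pullback x ` target_ideal q x"
        using s by (auto simp: ideal_prod_def)
      have "snd ab = 0" if "ab \<in> set xs" for ab
        using that xs(2) \<open>pullback x ` target_ideal q x \<subseteq> {0}\<close> by fastforce
      then have "map (\<lambda>(a, b). a * b) xs = map (\<lambda>_. 0) xs" by (intro map_cong) auto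
      then show "s = 0" unfolding xs(1) by (simp only: sum_list_0)
    qed
    moreover have "uniformizer q \<in> max_ideal q" unfolding m by (rule P.unif_mpow_1)
    ultimately show False using x unfolding nisnevich_coordinate_def by (metis P.unif_nz)
  qed
  then obtain B where B: "B \<noteq> 0" "eval_at x B \<in> max_ideal q" by blast
  then have "\<exists>G. irreducible G \<and> lead_coeff G = 1 \<and> eval_at x G \<in> max_ideal q"
  proof (induction "degree B" arbitrary: B rule: less_induct)
    case less
    have "degree B \<noteq> 0"
    proof
      assume "degree B = 0"
      then obtain c where c: "B = [:c:]" by (auto elim: degree_eq_zeroE)
      with less.prems have "c \<noteq> 0" "fract_const c \<in> P.mpow 1" by (simp_all add: m del: One_nat_def)
      then show False by (simp only: P.const_mpow_1)
    qed
    then obtain P where P: "irreducible P" "lead_coeff P = 1" "P dvd B"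
      using exists_irreducible_factor[of B] by blast
    obtain C where C: "B = P * C" using P(3) by (elim dvdE)
    with less.prems have C0: "C \<noteq> 0" "P \<noteq> 0" by auto
    from prime[of P C] less.prems consider "eval_at x P \<in> max_ideal q" | "eval_at x C \<in> max_ideal q"
      unfolding C by blast
    then show ?case
    proof cases
      case 2
      have "degree P > 0" using P(1) C0 by (metis irreducible_not_unit is_unit_iff_degree neq0_conv)
      then have "degree C < degree B" unfolding C using C0 by (simp add: degree_mult_eq)
      then show ?thesis using less.hyps C0 2 by blast
    qed (use P in blast)
  qed
  then obtain G where G: "irreducible G" "lead_coeff G = 1" "eval_at x G \<in> max_ideal q" by blast
  have iff: "eval_at x B \<in> max_ideal q \<longleftrightarrow> G dvd B" for B
  proof
    assume "G dvd B"
    then obtain C where "B = G * C" by (elim dvdE)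
    then show "eval_at x B \<in> max_ideal q"
      using G(3) P.mpow_mult_right[OF _ P.eval_at_mem[OF xm], of _ 1 C] by (simp add: m del: One_nat_def)
  next
    assume B: "eval_at x B \<in> max_ideal q"
    show "G dvd B"
    proof (rule ccontr)
      assume "\<not> G dvd B"
      from irreducible_inverse_mod[OF G(1) this, of 1] obtain C where "G dvd 1 - B * C" by auto
      then obtain D where D: "1 - B * C = G * D" by (elim dvdE)
      have "eval_at x (B * C) + eval_at x (G * D) = 1" unfolding D[symmetric] by simp
      moreover have "eval_at x (B * C) + eval_at x (G * D) \<in> P.mpow 1"
        unfolding eval_at_mult using B G(3) P.eval_at_mem[OF xm] unfolding m
        by (intro P.mpow_add P.mpow_mult_right)
      ultimately show False using P.unit_not_mpow[OF P.unit_1] by simp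
    qed
  qed
  show thesis by (rule that) (standard; fact q x G(1) G(2) iff)
qed

lemma nisnevichI:
  fixes q :: "'l::field poly point"
  assumes q: "q \<in> closed_points" and x: "x \<in> local_ring q" and nc: "nonconstant x"
    and G: "irreducible G" "lead_coeff G = 1"
    and dvd: "\<And>B. eval_at x B \<in> max_ideal q \<longleftrightarrow> G dvd B"
    and m: "max_ideal q = (\<lambda>z. eval_at x G * z) ` local_ring q"
    and res: "\<And>z. z \<in> local_ring q \<Longrightarrow> \<exists>A. z - eval_at x A \<in> max_ideal q"
  shows "nisnevich q x G"
proof
  interpret P: dvr_over "local_ring q" "uniformizer q" by (rule dvr_over_point[OF q])
  have mP: "max_ideal q = P.mpow 1" by (rule max_ideal_eq[OF P.dvr_axioms])
  show "q \<in> closed_points" "irreducible G" "lead_coeff G = 1"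
    "\<And>B. eval_at x B \<in> max_ideal q \<longleftrightarrow> G dvd B" by fact+
  have tr: "to_fract A \<in> target_ring q x" for A
    unfolding target_ring_def to_fract_def
    by (insert dvd[of 1] irreducible_not_unit[OF G(1)], intro CollectI, rule exI[of _ A], rule exI[of _ 1]) simp
  have "local_ring q \<odot> pullback x ` target_ideal q x = (\<lambda>z. eval_at x G * z) ` local_ring q"
  proof (rule P.ideal_prod_principal)
    have "to_fract G \<in> target_ideal q x"
      unfolding target_ideal_def to_fract_def
      by (insert dvd[of 1] dvd[of G] irreducible_not_unit[OF G(1)], intro CollectI, rule exI[of _ G], rule exI[of _ 1]) simp
    then show "eval_at x G \<in> pullback x ` target_ideal q x"
      using pullback_to_fract[OF nc, of G] by (metis imageI)
    show "pullback x ` target_ideal q x \<subseteq> (\<lambda>z. eval_at x G * z) ` local_ring q"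
    proof
      fix w assume "w \<in> pullback x ` target_ideal q x"
      then obtain A B where AB: "w = pullback x (Fract A B)" "eval_at x A \<in> max_ideal q" "eval_at x B \<notin> max_ideal q"
        unfolding target_ideal_def by blast
      then have B0: "B \<noteq> 0" using dvd by auto
      have "P.unit (eval_at x B)" using AB(3) P.eval_at_mem[OF x] unfolding mP P.unit_iff by blast
      then have "eval_at x A * inverse (eval_at x B) \<in> max_ideal q"
        using AB(2) P.unit_mem[OF P.unit_inverse] unfolding mP by (intro P.mpow_mult_right)
      then show "w \<in> (\<lambda>z. eval_at x G * z) ` local_ring q"
        unfolding m AB(1) pullback_Fract[OF nc B0] divide_inverse .
    qed
  qed
  then show "nisnevich_coordinate q x"
    unfolding nisnevich_coordinate_def
    using x nc m res tr pullback_to_fract[OF nc] unfolding nonconstant_def by metis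
qed

lemma local_index_eqI:
  assumes "\<exists>w. computes_index V N c \<sigma> q w" "\<And>w. computes_index V N c \<sigma> q w \<Longrightarrow> w = w'"
  shows "local_index V N c \<sigma> q = w'"
  unfolding local_index_def using assms by (metis the_equality)

section \<open>Pulling back the cotangent bundle\<close>

lemma closed_points_cases:
  assumes "q \<in> closed_points"
  obtains "q = Infinity" | Q where "q = Finite Q" "irreducible Q" "lead_coeff Q = 1"
  using assms by (auto simp: closed_points_def)

text \<open>The image point is infinity, where x^(-2) dx generates the differentials; its pullback
  is f^(-2) times the generator dx.\<close>

lemma pullback_cotangent_pole:
  assumes R: "dvr_over (local_ring q) \<pi>" and f: "f \<noteq> 0" "inverse f \<in> dvr.mpow (local_ring q) \<pi> 1"
  shows "pullback_cotangent f q = (\<lambda>z. inverse (f\<^sup>2) * z) ` local_ring q"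
proof -
  interpret dvr_over "local_ring q" \<pi> by (rule R)
  note nc = nonconstant_of_pole[OF f]
  have eq: "{z. pullback f z \<in> local_ring q} = local_ring Infinity"
    using pullback_mem_iff_of_pole[OF f] by blast
  have "differentials {z. pullback f z \<in> local_ring q} = (\<lambda>z. inverse (fract_var\<^sup>2) * z) ` local_ring Infinity"
    unfolding eq using cotangent_Infinity unfolding cotangent_def .
  then have img: "pullback f ` differentials {z. pullback f z \<in> local_ring q}
      = (\<lambda>z. inverse (f\<^sup>2) * pullback f z) ` local_ring Infinity"
    by (simp add: image_image nc)
  show ?thesis unfolding pullback_cotangent_def img
  proof (rule ideal_prod_principal)
    interpret I: dvr_over "local_ring Infinity" "inverse fract_var" by (rule dvr_over_Infinity)
    show "inverse (f\<^sup>2) \<in> (\<lambda>z. inverse (f\<^sup>2) * pullback f z) ` local_ring Infinity"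
      by (rule image_eqI[of _ _ 1]) (simp_all add: nc)
    show "(\<lambda>z. inverse (f\<^sup>2) * pullback f z) ` local_ring Infinity \<subseteq> (\<lambda>z. inverse (f\<^sup>2) * z) ` local_ring q"
      using pullback_mem_iff_of_pole[OF f] by blast
  qed
qed

text \<open>The image point is finite, so dx should generate. What has to be checked is that the
  local ring there is closed under d/dx: in lowest terms the denominator B satisfies U(f) A(f) +
  V(f) B(f) = 1, so if B(f) vanished at q, then so would A(f), a contradiction.\<close>

lemma pullback_cotangent_regular:
  assumes R: "dvr_over (local_ring q) \<pi>" and f: "nonconstant f" "f \<in> local_ring q"
  shows "pullback_cotangent f q = local_ring q"
proof -
  interpret dvr_over "local_ring q" \<pi> by (rule R)
  let ?A = "{z. pullback f z \<in> local_ring q}"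
  have deriv: "fract_deriv z \<in> ?A" if z: "z \<in> ?A" for z
  proof -
    obtain A B U V where AB: "z = Fract A B" "B \<noteq> 0" "U * A + V * B = 1" by (rule fract_coprime_repr)
    have pz: "eval_at f A = pullback f z * eval_at f B"
      using AB(2) unfolding AB(1) by (simp add: pullback_Fract[OF f(1)] f(1))
    have "unit (eval_at f B)"
    proof (rule ccontr)
      assume "\<not> unit (eval_at f B)"
      then have B: "eval_at f B \<in> mpow 1" using eval_at_mem[OF f(2)] unit_iff by blast
      then have A: "eval_at f A \<in> mpow 1" unfolding pz using z by (intro mpow_mult_left) auto
      have "eval_at f U * eval_at f A + eval_at f V * eval_at f B \<in> mpow 1"
        by (intro mpow_add mpow_mult_left A B eval_at_mem[OF f(2)])
      also have "eval_at f U * eval_at f A + eval_at f V * eval_at f B = 1"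
        unfolding eval_at_mult[symmetric] eval_at_add[symmetric] AB(3) by simp
      finally show False using unit_not_mpow[OF unit_1] by simp
    qed
    then have "unit (eval_at f (B * B))" by (simp add: unit_mult)
    then have "eval_at f (pderiv A * B - A * pderiv B) * inverse (eval_at f (B * B)) \<in> local_ring q"
      using eval_at_mem[OF f(2)] unfolding unit_def by (intro mult_mem) blast+
    moreover have "pullback f (fract_deriv z)
        = eval_at f (pderiv A * B - A * pderiv B) * inverse (eval_at f (B * B))"
      unfolding AB(1) fract_deriv_Fract[OF AB(2)] using AB(2)
      by (subst pullback_Fract[OF f(1)]) (simp_all add: divide_inverse)
    ultimately show ?thesis by simp
  qed
  have sub: "differentials ?A \<subseteq> ?A"
  proof
    fix s assume "s \<in> differentials ?A"
    then obtain xs where xs: "s = (\<Sum>(a, b)\<leftarrow>xs. a * b)" "set xs \<subseteq> ?A \<times> fract_deriv ` ?A"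
      by (auto simp: differentials_def ideal_prod_def)
    from xs(2) have "(\<Sum>(a, b)\<leftarrow>xs. a * b) \<in> ?A"
    proof (induction xs)
      case Nil
      then show ?case by (simp add: f(1))
    next
      case (Cons ab xs)
      obtain a b where ab: "ab = (a, b)" by (cases ab)
      with Cons.prems have "a \<in> ?A" "b \<in> ?A" using deriv by auto
      then have "pullback f a * pullback f b \<in> local_ring q" by (intro mult_mem) simp_all
      moreover have "(\<Sum>(a, b)\<leftarrow>xs. a * b) \<in> ?A" using Cons by simp
      ultimately show ?case by (simp add: ab f(1) add_mem)
    qed
    then show "s \<in> ?A" by (simp only: xs(1))
  qed
  have "1 \<in> differentials ?A"
    unfolding differentials_def ideal_prod_def
  proof (intro CollectI exI[of _ "[(1, fract_deriv fract_var)]"] conjI)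
    show "set [(1, fract_deriv fract_var)] \<subseteq> ?A \<times> fract_deriv ` ?A"
    proof -
      have "1 \<in> ?A" "fract_var \<in> ?A" using f by simp_all
      then have "(1, fract_deriv fract_var) \<in> ?A \<times> fract_deriv ` ?A" by (intro SigmaI imageI)
      then show ?thesis by (simp only: list.set insert_subset empty_subsetI simp_thms)
    qed
  qed simp
  then have "pullback_cotangent f q = (\<lambda>z. 1 * z) ` local_ring q"
    unfolding pullback_cotangent_def
    using sub by (intro ideal_prod_principal) (force simp: f(1) image_iff)+
  then show ?thesis by simp
qed

section \<open>The map \<open>y \<mapsto> (t - y^p) / y\<close>\<close>

lemma of_nat_fract_const: "of_nat n = fract_const (of_nat n)"
  by (induction n) simp_all

text \<open>The computation runs over any field of odd characteristic p in which t is not a p-th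
  power; k(t) is inserted at the very end.\<close>

locale frobenius_quotient =
  fixes p :: nat and t :: "'l::field"
  assumes p_prime: "prime p" and p_odd: "odd p" and CHAR_p: "CHAR('l) = p"
    and not_power: "\<nexists>c. c ^ p = t"
begin

abbreviation y :: "'l poly fract" where "y \<equiv> fract_var"

definition f :: "'l poly fract" where "f = (fract_const t - y ^ p) / y"

definition P :: "'l poly" where "P = monom 1 p - [:t:]"

text \<open>Hom(TY, V) is generated by y^(2p-6) at infinity, by y^(-2) at 0 and by 1 elsewhere.
  These are squares, so N takes their square roots and the orientation is multiplication by
  1.\<close>

definition N :: "'l stalks" where
  "N q = (if q = Infinity then (\<lambda>z. y ^ (p - 3) * z) ` local_ring q
    else if q = Finite [:0, 1:] then (\<lambda>z. inverse y * z) ` local_ring q else local_ring q)"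

lemma p_ge_3: "p \<ge> 3"
  using p_prime p_odd prime_ge_2_nat[OF p_prime] by (cases "p = 2") auto

lemma p_cases:
  obtains k where "p = Suc (Suc (Suc k))"
proof -
  have "p = Suc (Suc (Suc (p - 3)))" using p_ge_3 by simp
  then show thesis by (rule that)
qed

lemma p_pos: "p > 0" using p_ge_3 by simp

lemma t_nz: "t \<noteq> 0"
proof
  assume "t = 0"
  then have "0 ^ p = t" using p_pos by (simp add: power_0_left)
  with not_power show False by blast
qed

lemma two_nz: "(2 :: 'l) \<noteq> 0"
proof
  assume "(2 :: 'l) = 0"
  then have "of_nat 2 = (0 :: 'l)" by simp
  then have "p dvd 2" by (simp only: of_nat_eq_0_iff_char_dvd CHAR_p)
  then show False using p_ge_3 by (auto dest: dvd_imp_le)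
qed

lemma P_irreducible: "irreducible P"
  unfolding P_def by (rule irreducible_monom_minus_const[OF p_prime CHAR_p not_power])

lemma to_fract_P: "to_fract P = y ^ p - fract_const t"
  by (simp add: P_def fract_const_conv fract_var_conv monom_altdef)

lemma degree_P: "degree P = p" and monic_P: "lead_coeff P = 1"
  unfolding P_def by (rule degree_monom_minus_const[OF p_pos])+

lemma not_P_dvd_var: "\<not> P dvd [:0, 1:]"
  using dvd_imp_degree_le[of P "[:0, 1:]"] degree_P p_ge_3 by auto

lemma not_var_dvd_P: "\<not> [:0, 1:] dvd P"
proof
  assume "[:0, 1:] dvd P"
  then have "poly P 0 = 0" using poly_eq_0_iff_dvd[of P 0] by simp
  then show False using t_nz p_pos by (simp add: P_def poly_monom power_0_left)
qed

lemma var_irreducible: "irreducible [:0, 1 :: 'l:]"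
  by (rule irreducible_linear_field_poly) simp_all

lemma monic_irreducible_dvd:
  fixes Q Q' :: "'l poly"
  assumes "irreducible Q" "lead_coeff Q = 1" "irreducible Q'" "lead_coeff Q' = 1" "Q dvd Q'"
  shows "Q = Q'"
proof -
  obtain C where C: "Q' = Q * C" using assms(5) by (elim dvdE)
  then have "C dvd 1" using irreducibleD[OF assms(3) C] irreducible_not_unit[OF assms(1)] by blast
  then obtain c where c: "C = [:c:]" by (auto simp: is_unit_poly_iff)
  have "lead_coeff Q' = lead_coeff Q * lead_coeff C" unfolding C by (rule lead_coeff_mult)
  then have "c = 1" using assms(2,4) c by simp
  then show ?thesis using C c by (simp flip: one_pCons)
qed

lemma f_eq: "f = - (to_fract P / y)"
  by (simp add: f_def to_fract_P minus_divide_left)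

lemma f_nz: "f \<noteq> 0"
  using P_irreducible by (auto simp: f_eq)

text \<open>The numerator t - y^p has derivative 0 in characteristic p; only the denominator
  contributes.\<close>

lemma d_section_f: "d_section f = to_fract P / y\<^sup>2"
proof -
  have "of_nat p = (0 :: 'l poly fract)"
    using of_nat_CHAR[where 'a = 'l] unfolding of_nat_fract_const CHAR_p by simp
  then have "fract_deriv (fract_const t - y ^ p) = 0" by (simp add: fract_deriv_diff fract_deriv_power)
  then show ?thesis
    unfolding d_section_def f_def by (subst fract_deriv_divide) (simp_all add: to_fract_P)
qed

lemma f_pole_zero: "inverse f \<in> dvr.mpow (local_ring (Finite [:0, 1:])) (to_fract [:0, 1:]) 1"
proof -
  interpret dvr_over "local_ring (Finite [:0, 1:])" "to_fract [:0, 1 :: 'l:]"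
    by (rule dvr_over_Finite[OF var_irreducible])
  have "inverse (to_fract P) \<in> local_ring (Finite [:0, 1:])"
    using inverse_to_fract_mem_local_ring[OF var_irreducible] not_var_dvd_P by blast
  then have "to_fract [:0, 1:] * (- inverse (to_fract P)) \<in> mpow 1" by (intro mpow_1I uminus_mem)
  also have "to_fract [:0, 1:] * (- inverse (to_fract P)) = inverse f"
    by (simp add: f_eq fract_var_conv divide_inverse)
  finally show ?thesis .
qed

lemma f_nonconstant: "nonconstant f"
  by (rule dvr_over.nonconstant_of_pole[OF dvr_over_Finite[OF var_irreducible] f_nz f_pole_zero])

text \<open>The unit in y^p - t = y^p \<epsilon> at infinity, with value 1 there.\<close>

definition \<epsilon> :: "'l poly fract" where "\<epsilon> = 1 - fract_const t * inverse y ^ p"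

lemma unit_Infinity:
  "dvr.unit (local_ring Infinity) \<epsilon>"
proof -
  interpret dvr_over "local_ring Infinity" "inverse y" by (rule dvr_over_Infinity)
  have m: "fract_const t * inverse y ^ p \<in> mpow 1"
    using mpow_mult_left[OF const_mem unif_power_mpow[of p], of t] mpow_antimono[of 1 p] p_pos by auto
  show ?thesis unfolding unit_iff \<epsilon>_def
  proof
    show "1 - fract_const t * inverse y ^ p \<in> local_ring Infinity"
      by (intro diff_mem one_mem mult_mem power_mem const_mem unif_mem)
    show "1 - fract_const t * inverse y ^ p \<notin> mpow 1"
    proof
      assume "1 - fract_const t * inverse y ^ p \<in> mpow 1"
      from mpow_add[OF this m] show False using unit_not_mpow[OF unit_1] by simp
    qed
  qed
qed

lemma to_fract_P_Infinity: "to_fract P = y ^ p * \<epsilon>"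
  by (simp add: to_fract_P \<epsilon>_def field_simps)

lemma f_pole_Infinity: "inverse f \<in> dvr.mpow (local_ring Infinity) (inverse y) 1"
proof -
  interpret dvr_over "local_ring Infinity" "inverse y" by (rule dvr_over_Infinity)
  obtain k where k: "p = Suc (Suc k)" by (rule p_cases) blast
  have "inverse f = inverse y * (- (inverse y ^ k * inverse \<epsilon>))"
    unfolding f_eq to_fract_P_Infinity by (simp add: k power_inverse)
  also have "\<dots> \<in> mpow 1"
    using unit_Infinity by (intro mpow_1I uminus_mem mult_mem power_mem unif_mem) (simp add: unit_def)
  finally show ?thesis .
qed

subsection \<open>The line bundle and its orientation\<close>

lemma f_regular:
  assumes "irreducible Q" "lead_coeff Q = 1" "Q \<noteq> [:0, 1:]"
  shows "f \<in> local_ring (Finite Q)" "inverse y \<in> local_ring (Finite Q)"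
proof -
  interpret dvr_over "local_ring (Finite Q)" "to_fract Q" by (rule dvr_over_Finite[OF assms(1)])
  have "\<not> Q dvd [:0, 1:]"
    using monic_irreducible_dvd[OF assms(1,2) var_irreducible] assms(3) by auto
  then show y: "inverse y \<in> local_ring (Finite Q)"
    unfolding fract_var_conv using inverse_to_fract_mem_local_ring[OF assms(1)] by blast
  show "f \<in> local_ring (Finite Q)"
    unfolding f_eq divide_inverse
    by (intro uminus_mem mult_mem to_fract_mem_local_ring assms(1) y)
qed

lemma V_Finite:
  assumes "irreducible Q" "lead_coeff Q = 1" "Q \<noteq> [:0, 1:]"
  shows "hom_cotangent f (Finite Q) = local_ring (Finite Q)"
proof -
  interpret dvr_over "local_ring (Finite Q)" "to_fract Q" by (rule dvr_over_Finite[OF assms(1)])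
  show ?thesis
    using hom_multiples[of 1 1]
    unfolding hom_cotangent_def hom_bundle_def cotangent_Finite[OF assms(1)]
      pullback_cotangent_regular[OF dvr_over_axioms f_nonconstant f_regular(1)[OF assms]] by simp
qed

lemma V_zero: "hom_cotangent f (Finite [:0, 1:]) = (\<lambda>z. inverse (y\<^sup>2) * z) ` local_ring (Finite [:0, 1:])"
proof -
  interpret dvr_over "local_ring (Finite [:0, 1:])" "to_fract [:0, 1 :: 'l:]"
    by (rule dvr_over_Finite[OF var_irreducible])
  have "hom_cotangent f (Finite [:0, 1:]) = (\<lambda>z. 1 / inverse (f\<^sup>2) * z) ` local_ring (Finite [:0, 1:])"
    using hom_multiples[of "inverse (f\<^sup>2)" 1] f_nz
    unfolding hom_cotangent_def hom_bundle_def cotangent_Finite[OF var_irreducible]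
      pullback_cotangent_pole[OF dvr_over_axioms f_nz f_pole_zero] by simp
  also have "\<dots> = (\<lambda>z. inverse (y\<^sup>2) * z) ` local_ring (Finite [:0, 1:])"
  proof (rule multiples_eq_iff[THEN iffD2, symmetric])
    have "unit (to_fract P)"
      unfolding unit_def using inverse_to_fract_mem_local_ring[OF var_irreducible] not_var_dvd_P P_irreducible
        to_fract_mem_local_ring[OF var_irreducible] by auto
    then have "unit ((to_fract P)\<^sup>2)" by (rule unit_power)
    moreover have "1 / inverse (f\<^sup>2) = inverse (y\<^sup>2) * (to_fract P)\<^sup>2"
      by (simp add: f_eq field_simps)
    ultimately show "\<exists>u. unit u \<and> 1 / inverse (f\<^sup>2) = inverse (y\<^sup>2) * u" by blast
  qed simp
  finally show ?thesis .
qed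

text \<open>The generator is y^(-2) divided by f^(-2), and f is y^(p-1) times a unit.\<close>

lemma V_Infinity: "hom_cotangent f Infinity = (\<lambda>z. y ^ (2 * p - 4) * z) ` local_ring Infinity"
proof -
  interpret dvr_over "local_ring Infinity" "inverse y" by (rule dvr_over_Infinity)
  have "hom_cotangent f Infinity = (\<lambda>z. inverse (y\<^sup>2) / inverse (f\<^sup>2) * z) ` local_ring Infinity"
    using hom_multiples[of "inverse (f\<^sup>2)" "inverse (y\<^sup>2)"] f_nz
    unfolding hom_cotangent_def hom_bundle_def cotangent_Infinity
      pullback_cotangent_pole[OF dvr_over_axioms f_nz f_pole_Infinity] by simp
  also have "\<dots> = (\<lambda>z. y ^ (2 * p - 4) * z) ` local_ring Infinity"
  proof (rule multiples_eq_iff[THEN iffD2, symmetric])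
    obtain k where k: "p = Suc (Suc k)" by (rule p_cases) blast
    have f2: "f = - (y ^ Suc k * \<epsilon>)"
      unfolding f_eq to_fract_P_Infinity by (simp add: k)
    have "inverse (y\<^sup>2) / inverse (f\<^sup>2) = y ^ (k + k) * \<epsilon>\<^sup>2"
      unfolding f2 by (simp add: power2_eq_square power_add field_simps)
    moreover have "2 * p - 4 = k + k" using k by simp
    ultimately show "\<exists>u. unit u \<and> inverse (y\<^sup>2) / inverse (f\<^sup>2) = y ^ (2 * p - 4) * u"
      using unit_power[OF unit_Infinity] by auto
  qed simp
  finally show ?thesis .
qed

lemma relative_orientation_N: "relative_orientation (hom_cotangent f) N 1"
  unfolding relative_orientation_def line_bundle_def
proof (intro conjI ballI)
  fix q :: "'l poly point" assume q: "q \<in> closed_points"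
  let ?e = "if q = Infinity then y ^ (p - 3) else if q = Finite [:0, 1:] then inverse y else 1"
  have "?e \<noteq> 0 \<and> N q = (\<lambda>z. ?e * z) ` local_ring q" by (simp add: N_def)
  then show "\<exists>e. e \<noteq> 0 \<and> N q = (\<lambda>z. e * z) ` local_ring q" by blast
next
  have "{q \<in> closed_points. N q \<noteq> local_ring q} \<subseteq> {Infinity, Finite [:0, 1:]}" by (auto simp: N_def)
  then show "finite {q \<in> closed_points. N q \<noteq> local_ring q}" by (rule finite_subset) simp
next
  fix q :: "'l poly point" assume "q \<in> closed_points"
  then show "(\<lambda>w. 1 * w) ` hom_bundle tangent (hom_cotangent f) q = N q \<odot> N q"
  proof (cases rule: closed_points_cases)
    case 1
    interpret dvr_over "local_ring Infinity" "inverse y" by (rule dvr_over_Infinity)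
    obtain k where k: "p = Suc (Suc (Suc k))" by (rule p_cases)
    have "hom_bundle tangent (hom_cotangent f) Infinity = (\<lambda>z. y ^ (2 * p - 4) / y\<^sup>2 * z) ` local_ring Infinity"
      unfolding hom_bundle_def tangent_Infinity V_Infinity by (rule hom_multiples) simp
    moreover have "y ^ (2 * p - 4) / y\<^sup>2 = y ^ (p - 3) * y ^ (p - 3)"
      by (simp add: k power2_eq_square power_add mult_2)
    ultimately show ?thesis by (simp add: 1 N_def ideal_prod_multiples)
  next
    case (2 Q)
    interpret dvr_over "local_ring (Finite Q)" "to_fract Q" by (rule dvr_over_Finite[OF 2(2)])
    show ?thesis
    proof (cases "Q = [:0, 1:]")
      case True
      have "hom_bundle tangent (hom_cotangent f) (Finite Q) = (\<lambda>z. inverse (y\<^sup>2) / 1 * z) ` local_ring (Finite Q)"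
        using hom_multiples[of 1 "inverse (y\<^sup>2)"]
        unfolding hom_bundle_def True tangent_Finite[OF var_irreducible] V_zero by simp
      then show ?thesis using 2(1) True ideal_prod_multiples[of "inverse y" "inverse y"]
        by (simp add: N_def power2_eq_square)
    next
      case False
      have "hom_bundle tangent (hom_cotangent f) (Finite Q) = (\<lambda>z. 1 / 1 * z) ` local_ring (Finite Q)"
        using hom_multiples[of 1 1]
        unfolding hom_bundle_def tangent_Finite[OF 2(2)] V_Finite[OF 2(2,3) False] by simp
      moreover have "local_ring (Finite Q) \<odot> local_ring (Finite Q) = local_ring (Finite Q)"
        using ideal_prod_multiples[of 1 1] by simp
      ultimately show ?thesis using 2(1) False by (simp add: N_def)
    qed
  qed
qed simp

text \<open>Relative to a generator of V, df is y^p - t times a unit at every finite point, and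
  y^(-(p-2)) times a unit at infinity, where p - 2 is positive.\<close>

lemma zeros_df: "zeros (hom_cotangent f) (d_section f) = {Finite P, Infinity}"
proof -
  have mem: "d_section f \<in> max_ideal q \<odot> (\<lambda>z. e * z) ` local_ring q \<longleftrightarrow> d_section f / e \<in> dvr.mpow (local_ring q) \<pi> 1"
    if "dvr_over (local_ring q) \<pi>" "e \<noteq> 0" for q \<pi> e
  proof -
    interpret dvr_over "local_ring q" \<pi> by fact
    have "max_ideal q \<odot> (\<lambda>z. e * z) ` local_ring q = (\<lambda>z. \<pi> * e * z) ` local_ring q"
      unfolding max_ideal_eq[OF dvr_axioms] mpow_def using ideal_prod_multiples[of \<pi> e] by simp
    moreover have "s \<in> (\<lambda>z. \<pi> * e * z) ` local_ring q \<longleftrightarrow> s / e \<in> mpow 1" for s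
    proof
      assume "s \<in> (\<lambda>z. \<pi> * e * z) ` local_ring q"
      then obtain z where "z \<in> local_ring q" "s = \<pi> * e * z" by blast
      then show "s / e \<in> mpow 1" using mpow_1I that(2) by simp
    next
      assume "s / e \<in> mpow 1"
      then obtain z where "z \<in> local_ring q" "s / e = \<pi> * z" by (rule mpow_1E)
      then show "s \<in> (\<lambda>z. \<pi> * e * z) ` local_ring q"
        using that(2) by (intro image_eqI[of _ _ z]) (simp_all add: field_simps)
    qed
    ultimately show ?thesis by simp
  qed
  have "d_section f \<in> max_ideal q \<odot> hom_cotangent f q \<longleftrightarrow> q = Finite P \<or> q = Infinity" if "q \<in> closed_points" for q
    using that
  proof (cases rule: closed_points_cases)
    case 1
    interpret dvr_over "local_ring Infinity" "inverse y" by (rule dvr_over_Infinity)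
    obtain k where k: "p = Suc (Suc (Suc k))" by (rule p_cases)
    have "d_section f / y ^ (2 * p - 4) = inverse y * (inverse y ^ k * \<epsilon>)"
    proof -
      have "d_section f = y ^ Suc k * \<epsilon>"
        unfolding d_section_f to_fract_P_Infinity by (simp add: k power2_eq_square)
      moreover have "y ^ (2 * p - 4) = y ^ Suc k * (y * y ^ k)"
        by (simp add: k mult_2 power_add)
      ultimately show ?thesis by (simp add: field_simps)
    qed
    also have "\<dots> \<in> mpow 1"
      using unit_mem[OF unit_Infinity] by (intro mpow_1I mult_mem power_mem unif_mem)
    finally show ?thesis using mem[OF dvr_over_axioms, of "y ^ (2 * p - 4)"] by (simp add: 1 V_Infinity)
  next
    case (2 Q)
    interpret dvr_over "local_ring (Finite Q)" "to_fract Q" by (rule dvr_over_Finite[OF 2(2)])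
    have dvd: "to_fract P \<in> mpow 1 \<longleftrightarrow> Q = P"
    proof -
      have "to_fract P \<in> mpow 1 \<longleftrightarrow> \<not> unit (to_fract P)"
        using unit_iff to_fract_mem_local_ring[OF 2(2)] by blast
      also have "\<dots> \<longleftrightarrow> Q dvd P"
        unfolding unit_def using inverse_to_fract_mem_local_ring[OF 2(2), of P] to_fract_mem_local_ring[OF 2(2)]
          P_irreducible by auto
      also have "\<dots> \<longleftrightarrow> Q = P" using monic_irreducible_dvd[OF 2(2,3) P_irreducible monic_P] by auto
      finally show ?thesis .
    qed
    show ?thesis
    proof (cases "Q = [:0, 1:]")
      case True
      have "d_section f / inverse (y\<^sup>2) = to_fract P" by (simp add: d_section_f)
      then show ?thesis
        using mem[OF dvr_over_axioms, of "inverse (y\<^sup>2)"] dvd V_zero 2(1) True by simp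
    next
      case False
      have "to_fract P = d_section f * y\<^sup>2" "d_section f = to_fract P * inverse (y\<^sup>2)"
        by (simp_all add: d_section_f divide_inverse)
      moreover have "y\<^sup>2 \<in> local_ring (Finite Q)" "inverse (y\<^sup>2) \<in> local_ring (Finite Q)"
        using f_regular(2)[OF 2(2,3) False] to_fract_mem_local_ring[OF 2(2), of "[:0, 1:]"]
        by (simp_all only: power_mem fract_var_conv[symmetric] power_inverse[symmetric])
      ultimately have "d_section f \<in> mpow 1 \<longleftrightarrow> to_fract P \<in> mpow 1"
        using mpow_mult_right by metis
      then show ?thesis
        using mem[OF dvr_over_axioms, of 1] dvd V_Finite[OF 2(2,3) False] 2(1) by simp
    qed
  qed
  then show ?thesis
    unfolding zeros_def using P_irreducible monic_P by (auto simp: closed_points_def)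
qed

end

section \<open>The local indices\<close>

lemma (in nisnevich) mpow_eq:
  assumes "dvr (local_ring q) \<rho>" shows "Y.mpow m = dvr.mpow (local_ring q) \<rho> m"
  using max_ideal_pow_mpow max_ideal_pow_eq[OF assms] by simp

lemma computes_indexE:
  assumes "computes_index V N c \<sigma> q w"
  obtains x v \<sigma>\<^sub>0 n g F a \<eta> bs where
    "nisnevich_coordinate q x" "compatible_trivialization V N c q x v" "\<sigma> = \<sigma>\<^sub>0 * v"
    "\<sigma>\<^sub>0 \<in> max_ideal_pow q n" "\<sigma>\<^sub>0 \<notin> max_ideal_pow q (Suc n)" "g \<in> max_ideal_pow q (2 * n)"
    "F \<in> target_ring q x" "\<sigma>\<^sub>0 + g = pullback x F"
    "is_bezoutian (target_ring q x) F a" "is_theta_inverse_one (target_ring q x) F a \<eta>"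
    "is_basis_mod (target_ring q x) ((\<lambda>r. F * r) ` target_ring q x) bs"
    "w = gw_class (gram \<eta> bs)"
  using assms unfolding computes_index_def
  by (elim exE conjE) (rule that, assumption+, simp add: gram_def)

context frobenius_quotient
begin

section \<open>Expansion of p-th powers at y^p = t\<close>

lemma freshman_add: "(A + B) ^ p = A ^ p + B ^ p" for A B :: "'l poly"
  by (rule freshmans_dream) (simp_all add: p_prime CHAR_p)

lemma freshman_diff: "(A - B) ^ p = A ^ p - B ^ p" for A B :: "'l poly"
  using freshman_add[of "A - B" B] by simp

lemmas freshman_pCons = power_CHAR_pCons[OF p_prime CHAR_p]

text \<open>First-order Taylor expansion: A^p is the polynomial with coefficients a_i^p evaluated at
  y^p = t + P. Its derivative at y^p is (A')^p, because i^p = i in the prime field, and replacing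
  y^p by t changes that only modulo P.\<close>

lemma poly_frobenius_expansion: "\<exists>b. P\<^sup>2 dvd A ^ p - [:b:] - P * (pderiv A) ^ p"
proof (induction A)
  case 0
  then show ?case using p_pos by (intro exI[of _ 0]) (simp add: power_0_left)
next
  case (pCons c A)
  then obtain b where b: "P\<^sup>2 dvd A ^ p - [:b:] - P * (pderiv A) ^ p" by blast
  have m: "monom 1 p = P + [:t:]" by (simp add: P_def)
  have "pderiv (pCons c A) = A + pCons 0 (pderiv A)" by (simp add: pderiv_pCons)
  then have "(pderiv (pCons c A)) ^ p = A ^ p + (pCons 0 (pderiv A)) ^ p"
    by (simp only: freshman_add)
  also have "(pCons 0 (pderiv A)) ^ p = (P + [:t:]) * (pderiv A) ^ p"
    using p_pos unfolding freshman_pCons m by (simp add: power_0_left)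
  finally have d: "(pderiv (pCons c A)) ^ p = A ^ p + (P + [:t:]) * (pderiv A) ^ p" .
  have const: "[:c ^ p + t * b:] = [:c ^ p:] + [:t:] * [:b:]" by simp
  have "(pCons c A) ^ p - [:c ^ p + t * b:] - P * (pderiv (pCons c A)) ^ p
      = [:t:] * (A ^ p - [:b:] - P * (pderiv A) ^ p) - P\<^sup>2 * (pderiv A) ^ p"
    unfolding freshman_pCons[of c] m d const by (simp only: algebra_simps power2_eq_square)
  then have "P\<^sup>2 dvd (pCons c A) ^ p - [:c ^ p + t * b:] - P * (pderiv (pCons c A)) ^ p"
    using b by (metis dvd_diff dvd_mult dvd_triv_left)
  then show ?case by blast
qed

text \<open>The expansions of numerator and denominator are combined by the quotient rule; the
  constant is the quotient b1/b2 of the two constants.\<close>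

lemma frobenius_expansion:
  assumes x: "x \<in> local_ring (Finite P)"
  obtains b where
    "x ^ p - fract_const b - to_fract P * fract_deriv x ^ p \<in> dvr.mpow (local_ring (Finite P)) (to_fract P) 2"
proof -
  interpret dvr_over "local_ring (Finite P)" "to_fract P" by (rule dvr_over_Finite[OF P_irreducible])
  obtain A B where AB: "x = Fract A B" "\<not> P dvd B" using x by (auto simp: local_ring.simps)
  then have B0: "B \<noteq> 0" by auto
  let ?\<pi> = "to_fract P"
  define \<alpha> \<gamma> \<alpha>' \<gamma>' where "\<alpha> = to_fract (A ^ p)" "\<gamma> = to_fract (B ^ p)"
    "\<alpha>' = to_fract (pderiv A ^ p)" "\<gamma>' = to_fract (pderiv B ^ p)"
  have tm: "to_fract C \<in> local_ring (Finite P)" for C by (rule to_fract_mem_local_ring[OF P_irreducible])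
  have expand: "\<exists>b e. to_fract (C ^ p) = fract_const b + ?\<pi> * to_fract (pderiv C ^ p) + ?\<pi>\<^sup>2 * e \<and> e \<in> local_ring (Finite P)" for C
  proof -
    obtain b where "P\<^sup>2 dvd C ^ p - [:b:] - P * (pderiv C) ^ p" using poly_frobenius_expansion by blast
    then obtain E where "C ^ p - [:b:] - P * (pderiv C) ^ p = P\<^sup>2 * E" by (elim dvdE)
    then have "to_fract (C ^ p - [:b:] - P * (pderiv C) ^ p) = to_fract (P\<^sup>2 * E)" by (rule arg_cong)
    then have "to_fract (C ^ p) = fract_const b + ?\<pi> * to_fract (pderiv C ^ p) + ?\<pi>\<^sup>2 * to_fract E"
      by (simp add: fract_const_conv algebra_simps)
    then show ?thesis using tm by blast
  qed
  obtain b1 e1 where e1: "\<alpha> = fract_const b1 + ?\<pi> * \<alpha>' + ?\<pi>\<^sup>2 * e1" "e1 \<in> local_ring (Finite P)"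
    using expand[of A] unfolding \<alpha>_\<gamma>_\<alpha>'_\<gamma>'_def by blast
  obtain b2 e2 where e2: "\<gamma> = fract_const b2 + ?\<pi> * \<gamma>' + ?\<pi>\<^sup>2 * e2" "e2 \<in> local_ring (Finite P)"
    using expand[of B] unfolding \<alpha>_\<gamma>_\<alpha>'_\<gamma>'_def by blast
  have mem: "\<alpha> \<in> local_ring (Finite P)" "\<gamma> \<in> local_ring (Finite P)"
    "\<alpha>' \<in> local_ring (Finite P)" "\<gamma>' \<in> local_ring (Finite P)"
    unfolding \<alpha>_\<gamma>_\<alpha>'_\<gamma>'_def by (rule tm)+
  have "unit (to_fract B)"
    unfolding unit_def using tm inverse_to_fract_mem_local_ring[OF P_irreducible, of B] AB(2) B0 by simp
  then have \<gamma>unit: "unit \<gamma>" unfolding \<alpha>_\<gamma>_\<alpha>'_\<gamma>'_def using unit_power by simp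
  have b2: "b2 \<noteq> 0"
  proof
    assume "b2 = 0"
    then have "\<gamma> = ?\<pi> * (\<gamma>' + ?\<pi> * e2)" using e2(1) by (simp add: algebra_simps power2_eq_square)
    then have "\<gamma> \<in> mpow 1" using mpow_1I[of "\<gamma>' + ?\<pi> * e2"] mem(4) e2(2) by (simp add: add_mem mult_mem)
    with \<gamma>unit show False using unit_not_mpow by blast
  qed
  let ?U = "fract_const b2 * \<gamma> ^ 2"
  have U: "unit ?U" using unit_mult[OF unit_const[OF b2] unit_power[OF \<gamma>unit]] .
  have x_p: "x ^ p = \<alpha> / \<gamma>"
    unfolding AB(1) \<alpha>_\<gamma>_\<alpha>'_\<gamma>'_def Fract_conv_to_fract by (simp add: power_divide)
  have "fract_deriv x ^ p = to_fract ((pderiv A * B - A * pderiv B) ^ p) / to_fract ((B * B) ^ p)"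
    unfolding AB(1) fract_deriv_Fract[OF B0] unfolding Fract_conv_to_fract by (simp add: power_divide)
  also have "\<dots> = (\<alpha>' * \<gamma> - \<alpha> * \<gamma>') / \<gamma>\<^sup>2"
    unfolding freshman_diff power_mult_distrib \<alpha>_\<gamma>_\<alpha>'_\<gamma>'_def to_fract_diff to_fract_mult power2_eq_square ..
  finally have x'_p: "fract_deriv x ^ p = (\<alpha>' * \<gamma> - \<alpha> * \<gamma>') / \<gamma>\<^sup>2" .
  let ?c1 = "fract_const b1" and ?c2 = "fract_const b2"
  \<comment> \<open>Clearing the denominator b2 \<gamma>^2 from x^p - b1/b2 - P x'^p leaves P^2 K:
    the terms of order 0 and 1 cancel.\<close>
  define K where "K = \<gamma>' * (?c2 * \<alpha>' - ?c1 * \<gamma>') + (\<gamma> + ?\<pi> * \<gamma>') * (?c2 * e1 - ?c1 * e2)"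
  have K: "K \<in> local_ring (Finite P)"
    unfolding K_def by (intro add_mem mult_mem diff_mem const_mem unif_mem mem e1(2) e2(2))
  have lin: "?c2 * \<alpha> - ?c1 * \<gamma> = ?\<pi> * (?c2 * \<alpha>' - ?c1 * \<gamma>') + ?\<pi>\<^sup>2 * (?c2 * e1 - ?c1 * e2)"
    unfolding e1(1) e2(1) by (simp add: algebra_simps)
  have "\<gamma> * (?c2 * \<alpha> - ?c1 * \<gamma>) - ?c2 * ?\<pi> * (\<alpha>' * \<gamma> - \<alpha> * \<gamma>')
      = \<gamma> * ((?c2 * \<alpha> - ?c1 * \<gamma>) - ?\<pi> * (?c2 * \<alpha>' - ?c1 * \<gamma>')) + ?\<pi> * \<gamma>' * (?c2 * \<alpha> - ?c1 * \<gamma>)"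
    by (simp add: algebra_simps)
  also have "\<dots> = ?\<pi>\<^sup>2 * K"
    unfolding lin K_def by (simp add: algebra_simps power2_eq_square)
  finally have num: "\<gamma> * (?c2 * \<alpha> - ?c1 * \<gamma>) - ?c2 * ?\<pi> * (\<alpha>' * \<gamma> - \<alpha> * \<gamma>') = ?\<pi>\<^sup>2 * K" .
  have c2: "?c2 \<noteq> 0" and g0: "\<gamma> \<noteq> 0" using b2 unit_nz[OF \<gamma>unit] by simp_all
  have "x ^ p - fract_const (b1 / b2) - ?\<pi> * fract_deriv x ^ p
      = (\<gamma> * (?c2 * \<alpha> - ?c1 * \<gamma>) - ?c2 * ?\<pi> * (\<alpha>' * \<gamma> - \<alpha> * \<gamma>')) / ?U"
    unfolding x_p x'_p fract_const_divide using c2 g0 by (simp add: field_simps power2_eq_square)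
  also have "\<dots> = ?\<pi>\<^sup>2 * (K * inverse ?U)" unfolding num by (simp add: divide_inverse)
  also have "\<dots> \<in> mpow 2" using K U by (intro mpow_memI mult_mem) (simp_all only: unit_def)
  finally show thesis by (rule that)
qed

section \<open>The index at y^p = t\<close>

lemma P_closed_point: "Finite P \<in> closed_points"
  using P_irreducible monic_P by (simp add: closed_points_def)

lemma P_neq_var: "P \<noteq> [:0, 1:]"
  using not_P_dvd_var by auto

lemma primary_quotient_P: "primary_quotient P 1"
  by standard (simp_all add: P_irreducible monic_P)

lemma V_P: "hom_cotangent f (Finite P) = local_ring (Finite P)"
  by (rule V_Finite[OF P_irreducible monic_P P_neq_var])

lemma N_P: "N (Finite P) = local_ring (Finite P)"
  using P_neq_var by (simp add: N_def)

text \<open>The expansion shows that G divides s^p - b, so only irreducibility of the latter is at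
  stake. If b were c^p, then G = s - c and the residue field below would be L, whereas the residue
  of y has degree p over L.\<close>

lemma coordinate_generator_P:
  assumes "nisnevich (Finite P) x G"
    and b: "x ^ p - fract_const b - to_fract P * fract_deriv x ^ p \<in> dvr.mpow (local_ring (Finite P)) (to_fract P) 2"
  shows "G = monom 1 p - [:b:]"
proof -
  interpret nisnevich "Finite P" x G by fact
  interpret O: dvr_over "local_ring (Finite P)" "to_fract P" by (rule dvr_over_Finite[OF P_irreducible])
  note meq = mpow_eq[OF O.dvr_axioms]
  let ?H = "monom 1 p - [:b:]"
  have x': "fract_deriv x \<in> local_ring (Finite P)" by (rule fract_deriv_Finite[OF P_irreducible x_mem])
  have "(x ^ p - fract_const b - to_fract P * fract_deriv x ^ p) + to_fract P * fract_deriv x ^ p \<in> O.mpow 1"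
    using b O.mpow_antimono[of 1 2] by (intro O.mpow_add O.mpow_1I O.power_mem x') auto
  then have "eval_at x ?H \<in> max_ideal (Finite P)" unfolding max_ideal_mpow meq by simp
  then have dvd: "G dvd ?H" by (simp only: eval_at_max_ideal)
  have "\<nexists>c. c ^ p = b"
  proof
    assume "\<exists>c. c ^ p = b"
    then obtain c where c: "c ^ p = b" by blast
    have "[:- c, 1:] ^ p = ?H"
    proof -
      have "[:- c, 1:] = [:0, 1:] - [:c:]" by simp
      then show ?thesis by (simp only: freshman_diff) (simp add: poly_const_pow c monom_altdef)
    qed
    then have "G dvd [:- c, 1:] ^ p" using dvd by simp
    then have "G dvd [:- c, 1:]"
      using field_poly_irreducible_imp_prime[OF G_irreducible] by (rule prime_elem_dvd_power[rotated])
    moreover have "irreducible [:- c, 1:]" by (rule irreducible_linear_field_poly) simp_all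
    ultimately have G: "G = [:- c, 1:]"
      using monic_irreducible_dvd[OF G_irreducible G_monic] by simp
    interpret Q: primary_quotient G 1
      by standard (simp_all add: G_irreducible G_monic)
    interpret O1: primary_quotient P 1 by (rule primary_quotient_P)
    have "y \<in> local_ring (Finite P)" unfolding fract_var_conv by (rule to_fract_mem_local_ring[OF P_irreducible])
    then obtain r where r: "r \<in> local_ring (Finite G)" "y - pullback x r \<in> Y.mpow 1"
      by (rule residue_field)
    have "degree (Q.rep 1 r) < 1" using Q.degree_rep[OF r(1), of 1] by (simp add: G)
    then obtain e where e: "Q.rep 1 r = [:e:]" by (auto elim: degree_eq_zeroE)
    have "r - fract_const e \<in> T.mpow 1"
      using Q.rep_cong[OF r(1), of 1] unfolding e fract_const_conv .
    then have "pullback x (r - fract_const e) \<in> Y.mpow 1"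
      using pullback_mpow_1[OF T.diff_mem[OF r(1) T.const_mem]] by blast
    then have "(y - pullback x r) + pullback x (r - fract_const e) \<in> Y.mpow 1" by (rule Y.mpow_add[OF r(2)])
    also have "(y - pullback x r) + pullback x (r - fract_const e) = to_fract [:- e, 1:]"
      by (simp add: x_nonconstant fract_var_conv fract_const_conv flip: to_fract_diff)
    finally have "P dvd [:- e, 1:]" unfolding meq using O1.to_fract_mpow[of _ 1] by simp
    then have "degree P \<le> 1" using dvd_imp_degree_le[of P "[:- e, 1:]"] by simp
    then show False using degree_P p_ge_3 by simp
  qed
  from irreducible_monom_minus_const[OF p_prime CHAR_p this]
  show ?thesis
    using monic_irreducible_dvd[OF G_irreducible G_monic _ _ dvd] degree_monom_minus_const(2)[OF p_pos] by blast
qed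

lemma computes_index_P:
  assumes "computes_index (hom_cotangent f) N 1 (d_section f) (Finite P) w"
  shows "w = zmult (int ((p - 1) div 2)) gw_h + gw_unary 1"
  using assms
proof (rule computes_indexE)
  fix x v \<sigma>\<^sub>0 n g F a \<eta> bs
  assume coord: "nisnevich_coordinate (Finite P) x"
    and comp: "compatible_trivialization (hom_cotangent f) N 1 (Finite P) x v"
    and \<sigma>: "d_section f = \<sigma>\<^sub>0 * v"
    and data: "\<sigma>\<^sub>0 \<in> max_ideal_pow (Finite P) n" "\<sigma>\<^sub>0 \<notin> max_ideal_pow (Finite P) (Suc n)"
      "g \<in> max_ideal_pow (Finite P) (2 * n)"
      "F \<in> target_ring (Finite P) x" "\<sigma>\<^sub>0 + g = pullback x F"
      "is_bezoutian (target_ring (Finite P) x) F a" "is_theta_inverse_one (target_ring (Finite P) x) F a \<eta>"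
      "is_basis_mod (target_ring (Finite P) x) ((\<lambda>r. F * r) ` target_ring (Finite P) x) bs"
    and w: "w = gw_class (gram \<eta> bs)"
  obtain G where "nisnevich (Finite P) x G" by (rule nisnevich_exists[OF P_closed_point coord])
  then interpret nisnevich "Finite P" x G .
  interpret O: dvr_over "local_ring (Finite P)" "to_fract P" by (rule dvr_over_Finite[OF P_irreducible])
  note meq = mpow_eq[OF O.dvr_axioms]
  have ueq: "Y.unit z \<longleftrightarrow> O.unit z" for z by (simp add: Y.unit_def O.unit_def)
  obtain b where b: "x ^ p - fract_const b - to_fract P * fract_deriv x ^ p \<in> O.mpow 2"
    by (rule frobenius_expansion[OF x_mem])
  have G: "G = monom 1 p - [:b:]" by (rule coordinate_generator_P[OF nisnevich_axioms b])
  have deg: "degree G = p" unfolding G by (rule degree_monom_minus_const(1)[OF p_pos])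
  have \<pi>: "eval_at x G = x ^ p - fract_const b" by (simp add: G)
  let ?x' = "fract_deriv x"
  have x'_mem: "?x' \<in> local_ring (Finite P)" by (rule fract_deriv_Finite[OF P_irreducible x_mem])
  \<comment> \<open>If x' vanished at the point, the expansion would make the uniformizer G(x)
    vanish to order 2.\<close>
  have "O.unit ?x'"
  proof (rule ccontr)
    assume "\<not> O.unit ?x'"
    then have "?x' \<in> O.mpow 1" using x'_mem O.unit_iff by blast
    then have "?x' * ?x' ^ (p - 1) \<in> O.mpow 1" by (intro O.mpow_mult_right O.power_mem x'_mem)
    then have "to_fract P * (?x' * ?x' ^ (p - 1)) \<in> O.mpow (1 + 1)" by (rule O.mpow_mult[OF O.unif_mpow_1])
    also have "?x' * ?x' ^ (p - 1) = ?x' ^ p" using p_pos by (cases p) simp_all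
    finally have "to_fract P * ?x' ^ p \<in> O.mpow 2" by (simp add: numeral_2_eq_2)
    from O.mpow_add[OF b this] have "eval_at x G ^ 1 * 1 \<in> Y.mpow 2" unfolding meq by (simp add: \<pi>)
    then show False using Y.unif_power_unit_mpow[OF Y.unit_1, of 1 2] by simp
  qed
  note x' = this
  have "(\<lambda>z. 1 * z) ` local_ring (Finite P) = (\<lambda>z. v * z) ` local_ring (Finite P)"
    using comp unfolding compatible_trivialization_def V_P by simp
  then have v: "O.unit v" using O.multiples_eq_iff[of 1 v] by auto
  obtain l where l: "l \<in> local_ring (Finite P)" "v * ?x' = l * l"
    using comp unfolding compatible_trivialization_def N_P by auto
  have "O.unit (l * l)" using O.unit_mult[OF v x'] by (simp only: l(2))
  then have lu: "O.unit l" by (rule O.unit_factors[OF _ l(1) l(1)])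
  have y: "O.unit y"
    unfolding O.unit_def fract_var_conv
    using inverse_to_fract_mem_local_ring[OF P_irreducible, of "[:0, 1:]"] not_P_dvd_var
      to_fract_mem_local_ring[OF P_irreducible] by simp
  obtain j where j: "p = Suc (2 * j)" using p_odd by (elim oddE) simp
  \<comment> \<open>From v x' = l^2 one gets that the section is P x' / (y l)^2, and P is G(x) /
    x'^p to leading order. With p = 2j + 1 the coefficient x'^(1-p) / (y l)^2 is the square of
    z.\<close>
  define z where "z = inverse ?x' ^ j * inverse (y * l)"
  have z: "O.unit z" unfolding z_def
    by (intro O.unit_mult O.unit_power O.unit_inverse x' y lu)
  have nz: "v \<noteq> 0" "?x' \<noteq> 0" "l \<noteq> 0" using v x' lu O.unit_nz by blast+
  have "\<sigma>\<^sub>0 = to_fract P / (y\<^sup>2 * v)"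
    using \<sigma> nz unfolding d_section_f by (simp add: field_simps)
  also have "\<dots> = z\<^sup>2 * (to_fract P * ?x' ^ p)"
  proof -
    have x'_eq: "?x' = l * l / v" using l(2) nz by (simp add: field_simps)
    have zz: "z\<^sup>2 * ?x' ^ p = ?x' * inverse (y * l) ^ 2"
      using nz unfolding z_def j by (simp add: power_mult_distrib power_mult power2_eq_square field_simps)
    have "z\<^sup>2 * (to_fract P * ?x' ^ p) = to_fract P * (?x' * inverse (y * l) ^ 2)"
      unfolding zz[symmetric] by (simp only: mult_ac)
    also have "\<dots> = to_fract P / (y\<^sup>2 * v)"
      unfolding x'_eq using nz by (simp add: field_simps power2_eq_square)
    finally show ?thesis ..
  qed
  finally have "\<sigma>\<^sub>0 - fract_const 1 * z\<^sup>2 * eval_at x G ^ 1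
      = - z\<^sup>2 * (x ^ p - fract_const b - to_fract P * ?x' ^ p)"
    unfolding \<pi> by (simp add: algebra_simps)
  also have "\<dots> \<in> O.mpow 2"
    using O.unit_mem[OF z] by (intro O.mpow_mult_left O.uminus_mem O.power_mem b)
  finally have \<sigma>\<^sub>0: "\<sigma>\<^sub>0 - fract_const 1 * z\<^sup>2 * eval_at x G ^ 1 \<in> Y.mpow (Suc 1)"
    unfolding meq by (simp only: numeral_2_eq_2 One_nat_def)
  \<comment> \<open>For p \<le> k \<le> 2p - 2 the remainder of s^k modulo s^p - b is b s^(k-p), of
    degree at most p - 2, so the coefficient at s^(p-1) vanishes.\<close>
  have anti: "coeff ([:- 0, 1:] ^ k mod G ^ 1) (degree (G ^ 1) - 1) = (if k + 1 = degree (G ^ 1) then 1 else 0)"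
    if "k \<le> 2 * degree (G ^ 1) - 2" for k
  proof (cases "k < p")
    case True
    have "monom 1 k mod G = monom 1 k" using True by (intro mod_poly_less) (simp add: degree_monom_eq deg)
    then show ?thesis using True p_pos by (auto simp: deg monom_altdef[of 1, simplified, symmetric])
  next
    case False
    then obtain i where i: "k = p + i" using le_Suc_ex not_less by blast
    have ip: "i < p - 1" using that deg i p_ge_3 by simp
    have "monom 1 k = monom b i + G * monom 1 i"
      unfolding G i by (simp add: algebra_simps mult_monom smult_monom)
    then have "monom 1 k mod G = monom b i mod G" by simp
    also have "\<dots> = monom b i"
    proof (rule mod_poly_less)
      show "degree (monom b i) < degree G" using degree_monom_le[of b i] ip by (simp add: deg)
    qed
    finally show ?thesis using i ip p_pos by (simp add: deg monom_altdef[of 1, simplified, symmetric])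
  qed
  have "gw_class (gram \<eta> bs) = zmult (int j) gw_h + gw_unary 1"
    by (rule computes_index_unique[OF two_nz _ _ _ anti data(1,2) ueq[THEN iffD2, OF z] \<sigma>\<^sub>0 data(3-8)])
      (simp_all add: deg j)
  then show ?thesis using w j by simp
qed

lemma local_index_P:
  "local_index (hom_cotangent f) N 1 (d_section f) (Finite P) = zmult (int ((p - 1) div 2)) gw_h + gw_unary 1"
proof (rule local_index_eqI)
  interpret primary_quotient P 1 by (rule primary_quotient_P)
  have me: "max_ideal_pow (Finite P) n = mpow n" for n by (rule max_ideal_pow_eq[OF dvr_axioms])
  have m1: "max_ideal (Finite P) = mpow 1" by (rule max_ideal_eq[OF dvr_axioms])
  have "nisnevich (Finite P) y P"
  proof (rule nisnevichI)
    show "Finite P \<in> closed_points" by (rule P_closed_point)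
    show "y \<in> R" by simp
    show "nonconstant y" by (rule nonconstant_var)
    show "irreducible P" "lead_coeff P = 1" using P_irreducible monic_P by simp_all
    show "eval_at y B \<in> max_ideal (Finite P) \<longleftrightarrow> P dvd B" for B
      unfolding m1 eval_at_var using to_fract_mpow[of B 1] by simp
    show "max_ideal (Finite P) = (\<lambda>z. eval_at y P * z) ` R"
      unfolding m1 eval_at_var mpow_def by simp
    show "\<exists>A. z - eval_at y A \<in> max_ideal (Finite P)" if "z \<in> R" for z
      unfolding m1 eval_at_var using rep_exists[OF that, of 1] by metis
  qed
  then interpret nisnevich "Finite P" y P .
  have y: "unit y"
    unfolding unit_def using inverse_to_fract_mem_local_ring[OF P_irreducible, of "[:0, 1:]"] not_P_dvd_var
    by (simp add: fract_var_conv)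
  have \<sigma>: "d_section f = to_fract P ^ 1 * inverse (y\<^sup>2)" by (simp add: d_section_f divide_inverse)
  have order: "d_section f \<in> mpow m \<longleftrightarrow> m \<le> 1" for m
    unfolding \<sigma> by (rule unif_power_unit_mpow[OF unit_inverse[OF unit_power[OF y]]])
  \<comment> \<open>The section P y^(-2) is not a polynomial in y. Since y^p = t modulo P, y^(-2) is
    congruent to y^(p-2) / t, and \<open>?g\<close>, of order 2, is exactly the difference.\<close>
  let ?A = "Polynomial.smult (inverse t) (P * monom 1 (p - 2))"
  let ?g = "to_fract P ^ 2 * (fract_const (inverse t) * inverse (y\<^sup>2))"
  have g: "?g \<in> mpow 2"
    by (intro mpow_memI mult_mem const_mem unit_mem[OF unit_inverse[OF unit_power[OF y]]])
  obtain k where k: "p = Suc (Suc k)" by (rule p_cases) blast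
  have A: "d_section f + ?g = eval_at y ?A"
  proof -
    have "d_section f + ?g = to_fract P * inverse (y\<^sup>2) * (1 + fract_const (inverse t) * to_fract P)"
      by (simp add: \<sigma> power2_eq_square algebra_simps)
    also have "1 + fract_const (inverse t) * to_fract P = fract_const (inverse t) * y ^ p"
      using t_nz by (simp add: to_fract_P right_diff_distrib)
    also have "y ^ p = y\<^sup>2 * y ^ (p - 2)" by (simp add: k power2_eq_square)
    also have "to_fract P * inverse (y\<^sup>2) * (fract_const (inverse t) * (y\<^sup>2 * y ^ (p - 2)))
        = fract_const (inverse t) * (to_fract P * (fract_const 1 * y ^ (p - 2)))"
      by (simp add: field_simps)
    also have "\<dots> = eval_at y ?A"
      unfolding eval_at_smult eval_at_mult eval_at_monom eval_at_var[of P] ..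
    finally show ?thesis .
  qed
  show "\<exists>w. computes_index (hom_cotangent f) N 1 (d_section f) (Finite P) w"
  proof (rule computes_index_exists)
    show "compatible_trivialization (hom_cotangent f) N 1 (Finite P) y 1"
      unfolding compatible_trivialization_def V_P N_P by (auto intro!: bexI[of _ 1])
    show "d_section f = d_section f * 1" by simp
    show "d_section f \<in> max_ideal_pow (Finite P) 1" "d_section f \<notin> max_ideal_pow (Finite P) (Suc 1)"
      unfolding me order by simp_all
    show "?g \<in> max_ideal_pow (Finite P) (2 * 1)" unfolding me using g by simp
    show "d_section f + ?g = eval_at y ?A" by (rule A)
  qed simp
qed (rule computes_index_P)

section \<open>The index at infinity\<close>

lemma computes_index_Infinity:
  assumes "computes_index (hom_cotangent f) N 1 (d_section f) Infinity w"
  shows "w = zmult (int ((p - 3) div 2)) gw_h + gw_unary (- 1)"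
  using assms
proof (rule computes_indexE)
  fix x v \<sigma>\<^sub>0 n g F a \<eta> bs
  assume coord: "nisnevich_coordinate Infinity x"
    and comp: "compatible_trivialization (hom_cotangent f) N 1 Infinity x v"
    and \<sigma>: "d_section f = \<sigma>\<^sub>0 * v"
    and data: "\<sigma>\<^sub>0 \<in> max_ideal_pow Infinity n" "\<sigma>\<^sub>0 \<notin> max_ideal_pow Infinity (Suc n)"
      "g \<in> max_ideal_pow Infinity (2 * n)"
      "F \<in> target_ring Infinity x" "\<sigma>\<^sub>0 + g = pullback x F"
      "is_bezoutian (target_ring Infinity x) F a" "is_theta_inverse_one (target_ring Infinity x) F a \<eta>"
      "is_basis_mod (target_ring Infinity x) ((\<lambda>r. F * r) ` target_ring Infinity x) bs"
    and w: "w = gw_class (gram \<eta> bs)"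
  have cp: "Infinity \<in> closed_points" by (simp add: closed_points_def)
  obtain G where "nisnevich Infinity x G" by (rule nisnevich_exists[OF cp coord])
  then interpret nisnevich Infinity x G .
  let ?w = "inverse y"
  interpret O: dvr_over "local_ring Infinity" ?w by (rule dvr_over_Infinity)
  note meq = mpow_eq[OF O.dvr_axioms]
  have ueq: "Y.unit z \<longleftrightarrow> O.unit z" for z by (simp add: Y.unit_def O.unit_def)
  obtain b where b: "x - fract_const b \<in> O.mpow 1" by (rule residue_Infinity_mpow[OF x_mem])
  have "eval_at x [:- b, 1:] \<in> max_ideal Infinity"
    unfolding max_ideal_mpow meq using b by simp
  then have "G dvd [:- b, 1:]" by (simp only: eval_at_max_ideal)
  moreover have "irreducible [:- b, 1:]" by (rule irreducible_linear_field_poly) simp_all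
  ultimately have G: "G = [:- b, 1:]" using monic_irreducible_dvd[OF G_irreducible G_monic] by simp
  have \<pi>: "eval_at x G = x - fract_const b" by (simp add: G)
  have "(\<lambda>z. ?w * z) ` local_ring Infinity = (\<lambda>z. eval_at x G * z) ` local_ring Infinity"
    using max_ideal_multiples max_ideal_eq[OF O.dvr_axioms] by (simp add: O.mpow_def)
  then obtain e where e: "O.unit e" "x - fract_const b = ?w * e"
    using O.multiples_eq_iff[of ?w] unfolding \<pi> by auto
  \<comment> \<open>The derivative of the unit e is w^2 \<delta> with \<delta> regular, so x' is
    -w^2 e up to higher order.\<close>
  define \<delta> where "\<delta> = y\<^sup>2 * fract_deriv e"
  have \<delta>: "\<delta> \<in> local_ring Infinity" unfolding \<delta>_def by (rule fract_deriv_Infinity[OF O.unit_mem[OF e(1)]])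
  have "fract_deriv x = fract_deriv (?w * e)" unfolding e(2)[symmetric] by (simp add: fract_deriv_diff)
  also have "\<dots> = - inverse (y\<^sup>2) * e + ?w * fract_deriv e"
    by (simp only: fract_deriv_mult fract_deriv_inverse_var)
  also have "\<dots> = - (?w\<^sup>2 * (e - ?w * \<delta>))"
    by (simp add: \<delta>_def power2_eq_square field_simps)
  finally have x': "fract_deriv x = - (?w\<^sup>2 * (e - ?w * \<delta>))" .
  have eu: "O.unit (e - ?w * \<delta>)"
  proof -
    have "?w * \<delta> \<in> O.mpow 1" using \<delta> by (rule O.mpow_1I)
    then have "e - ?w * \<delta> \<notin> O.mpow 1"
      using O.mpow_add[of "e - ?w * \<delta>" 1 "?w * \<delta>"] O.unit_not_mpow[OF e(1)] by auto
    then show ?thesis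
      unfolding O.unit_iff using O.diff_mem[OF O.unit_mem[OF e(1)] O.mult_mem[OF O.unif_mem \<delta>]] by blast
  qed
  obtain k where k: "p = Suc (Suc (Suc k))" by (rule p_cases)
  obtain j where j: "k = 2 * j" using p_odd unfolding k by (auto elim: evenE)
  have "(\<lambda>z. y ^ (2 * p - 4) * z) ` local_ring Infinity = (\<lambda>z. v * z) ` local_ring Infinity"
    using comp unfolding compatible_trivialization_def V_Infinity by simp
  then obtain \<nu> where \<nu>: "O.unit \<nu>" "v = y ^ (2 * p - 4) * \<nu>"
    using O.multiples_eq_iff[of "y ^ (2 * p - 4)" v] by auto
  have exps: "2 * p - 4 = k + k + 2" "p - 3 = k" by (simp_all add: k)
  have y_powers: "y ^ p = y ^ Suc k * y\<^sup>2" "y ^ (k + k + 2) = y ^ Suc k * y ^ Suc k"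
    by (simp_all add: k power2_eq_square power_add)
  obtain \<kappa> where \<kappa>: "\<kappa> \<in> local_ring Infinity" "v * fract_deriv x = (y ^ k * \<kappa>) * (y ^ k * \<kappa>)"
    using comp unfolding compatible_trivialization_def N_def exps by auto
  have "y ^ k * y ^ k * (\<kappa> * \<kappa>) = (y ^ k * \<kappa>) * (y ^ k * \<kappa>)" by (simp only: mult_ac)
  also have "\<dots> = y ^ k * y ^ k * (- (\<nu> * (e - ?w * \<delta>)))"
    unfolding \<kappa>(2)[symmetric] \<nu>(2) x' exps by (simp add: power_add power2_eq_square field_simps)
  finally have \<kappa>2: "\<kappa> * \<kappa> = - (\<nu> * (e - ?w * \<delta>))"
    by (subst (asm) mult_cancel_left) simp
  then have "O.unit (\<kappa> * \<kappa>)" using O.unit_uminus[OF O.unit_mult[OF \<nu>(1) eu]] by simp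
  then have \<kappa>u: "O.unit \<kappa>" by (rule O.unit_factors[OF _ \<kappa>(1) \<kappa>(1)])
  \<comment> \<open>To leading order the section is -w^(k+1) e / \<kappa>^2, and w is G(x) / e. What
    remains is -e^(-k) / \<kappa>^2, minus the square of z, as k = p - 3 = 2j is even.\<close>
  define z where "z = inverse e ^ j * inverse \<kappa>"
  have z: "O.unit z" unfolding z_def by (intro O.unit_mult O.unit_power O.unit_inverse e(1) \<kappa>u)
  have nz: "\<nu> \<noteq> 0" "\<kappa> \<noteq> 0" "e \<noteq> 0" "e - ?w * \<delta> \<noteq> 0" using \<nu>(1) \<kappa>u e(1) eu O.unit_nz by blast+
  have v0: "v \<noteq> 0" using \<nu>(2) nz by simp
  \<comment> \<open>The sign of the index arises here: compatibility with the orientation makes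
    \<nu> minus a square divided by e - w \<delta>.\<close>
  have inv\<nu>: "inverse \<nu> = - ((e - ?w * \<delta>) * inverse (\<kappa> * \<kappa>))"
    unfolding \<kappa>2 using nz by simp
  have "\<sigma>\<^sub>0 = d_section f / v" using \<sigma> v0 by simp
  also have "\<dots> = ?w ^ Suc k * (\<epsilon> * inverse \<nu>)"
  proof -
    have aux: "Y * s * a / s / (Y * Y * m) = inverse Y * (a * inverse m)" if "Y \<noteq> 0" "s \<noteq> 0" "m \<noteq> 0"
      for Y s a m :: "'l poly fract" using that by (simp add: field_simps)
    show ?thesis
      unfolding d_section_f to_fract_P_Infinity \<nu>(2) exps y_powers power_inverse
      by (rule aux) (simp_all add: nz(1))
  qed
  finally have \<sigma>\<^sub>0: "\<sigma>\<^sub>0 = ?w ^ Suc k * (\<epsilon> * inverse \<nu>)" .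
  have z2: "z\<^sup>2 * eval_at x G ^ Suc k = ?w ^ Suc k * (e * inverse (\<kappa> * \<kappa>))"
  proof -
    have "e ^ Suc k = e * (e ^ j * e ^ j)" by (simp add: j mult_2 power_add)
    moreover have "inverse a * inverse a * (e * (a * a)) = e" if "a \<noteq> 0" for a
      using that by (simp add: field_simps)
    ultimately have ej: "(inverse e ^ j) * (inverse e ^ j) * e ^ Suc k = e"
      using nz(3) by (simp only: power_inverse power_not_zero not_False_eq_True)
    have "z\<^sup>2 * eval_at x G ^ Suc k
        = ?w ^ Suc k * ((inverse e ^ j) * (inverse e ^ j) * e ^ Suc k * (inverse \<kappa> * inverse \<kappa>))"
      unfolding \<pi> e(2) z_def power_mult_distrib power2_eq_square by (simp only: mult_ac)
    then show ?thesis unfolding ej by simp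
  qed
  have "\<sigma>\<^sub>0 - fract_const (- 1) * z\<^sup>2 * eval_at x G ^ Suc k
      = ?w ^ Suc k * (\<epsilon> * inverse \<nu> + e * inverse (\<kappa> * \<kappa>))"
    using z2 by (simp add: \<sigma>\<^sub>0 distrib_left)
  \<comment> \<open>Both 1 - \<epsilon> and w \<delta> vanish at infinity, which supplies the one
    extra order.\<close>
  also have "\<epsilon> * inverse \<nu> + e * inverse (\<kappa> * \<kappa>)
      = ((1 - \<epsilon>) * (e - ?w * \<delta>) + ?w * \<delta>) * inverse (\<kappa> * \<kappa>)"
    unfolding inv\<nu> by (simp add: algebra_simps)
  also have "?w ^ Suc k * \<dots> \<in> O.mpow (Suc k + 1)"
  proof (intro O.mpow_mult O.mpow_mult_right O.mpow_add O.unif_power_mpow)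
    show "1 - \<epsilon> \<in> O.mpow 1"
      unfolding \<epsilon>_def using O.mpow_mult_left[OF O.const_mem O.unif_power_mpow[of p], of t]
        O.mpow_antimono[of 1 p] p_pos by auto
    show "e - ?w * \<delta> \<in> local_ring Infinity" using O.unit_mem[OF eu] .
    show "?w \<in> O.mpow 1" by (rule O.unif_mpow_1)
    show "\<delta> \<in> local_ring Infinity" by (rule \<delta>)
    show "inverse (\<kappa> * \<kappa>) \<in> local_ring Infinity"
      using O.unit_mem[OF O.unit_inverse[OF O.unit_mult[OF \<kappa>u \<kappa>u]]] .
  qed
  finally have fin: "\<sigma>\<^sub>0 - fract_const (- 1) * z\<^sup>2 * eval_at x G ^ Suc k \<in> Y.mpow (Suc (Suc k))"
    unfolding meq by simp
  have deg: "degree (G ^ m) = m" for m unfolding G by (simp add: degree_power_eq)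
  have anti: "coeff ([:- b, 1:] ^ i mod G ^ Suc k) (degree (G ^ Suc k) - 1) = (if i + 1 = degree (G ^ Suc k) then 1 else 0)" for i
  proof (cases "i < Suc k")
    case True
    have "[:- b, 1:] ^ i mod G ^ Suc k = [:- b, 1:] ^ i"
      using True deg[of i] deg[of "Suc k"] by (intro mod_poly_less) (simp add: G del: power_Suc)
    moreover have "coeff ([:- b, 1:] ^ i) k = (if i = k then 1 else 0)"
    proof (cases "i = k")
      case True
      have "lead_coeff ([:- b, 1:] ^ k) = 1" by (simp add: lead_coeff_power)
      then show ?thesis using deg[of k] True by (simp add: G)
    next
      case False
      then show ?thesis using True deg[of i] by (simp add: G coeff_eq_0)
    qed
    ultimately show ?thesis unfolding deg by simp
  next
    case False
    then have "G ^ Suc k dvd [:- b, 1:] ^ i" unfolding G by (intro le_imp_power_dvd) simp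
    then have "[:- b, 1:] ^ i mod G ^ Suc k = 0" by (simp add: mod_eq_0_iff_dvd del: power_Suc)
    then show ?thesis unfolding deg using False by (simp del: power_Suc)
  qed
  have "gw_class (gram \<eta> bs) = zmult (int j) gw_h + gw_unary (- 1)"
    by (rule computes_index_unique[OF two_nz _ _ _ anti data(1,2) ueq[THEN iffD2, OF z] fin data(3-8)])
      (simp_all add: deg j del: power_Suc)
  then show ?thesis using w j k by simp
qed

lemma local_index_Infinity:
  "local_index (hom_cotangent f) N 1 (d_section f) Infinity = zmult (int ((p - 3) div 2)) gw_h + gw_unary (- 1)"
proof (rule local_index_eqI)
  let ?w = "inverse y"
  interpret O: dvr_over "local_ring Infinity" ?w by (rule dvr_over_Infinity)
  have me: "max_ideal_pow Infinity n = O.mpow n" for n by (rule max_ideal_pow_eq[OF O.dvr_axioms])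
  have m1: "max_ideal Infinity = O.mpow 1" by (rule max_ideal_eq[OF O.dvr_axioms])
  have nc: "nonconstant ?w"
  proof (rule dvr_over.nonconstant_of_pole[OF dvr_over_Finite[OF var_irreducible]])
    interpret Z: dvr_over "local_ring (Finite [:0, 1:])" "to_fract [:0, 1 :: 'l:]"
      by (rule dvr_over_Finite[OF var_irreducible])
    show "?w \<noteq> 0" by simp
    show "inverse ?w \<in> Z.mpow 1" using Z.unif_mpow_1 by (simp only: inverse_inverse_eq fract_var_conv)
  qed
  have "nisnevich Infinity ?w [:0, 1:]"
  proof (rule nisnevichI)
    show "Infinity \<in> closed_points" by (simp add: closed_points_def)
    show "?w \<in> local_ring Infinity" by (rule O.unif_mem)
    show "nonconstant ?w" by (rule nc)
    show "irreducible [:0, 1 :: 'l:]" by (rule var_irreducible)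
    show "lead_coeff [:0, 1 :: 'l:] = 1" by simp
    show "eval_at ?w B \<in> max_ideal Infinity \<longleftrightarrow> [:0, 1:] dvd B" for B
    proof -
      obtain c B' where B: "B = pCons c B'" by (cases B)
      have m: "?w * eval_at ?w B' \<in> O.mpow 1" by (intro O.mpow_1I O.eval_at_mem O.unif_mem)
      have "eval_at ?w B \<in> max_ideal Infinity \<longleftrightarrow> fract_const c \<in> O.mpow 1"
        unfolding B m1 eval_at_pCons
        using O.mpow_add[OF _ m, of "fract_const c"] O.mpow_diff[OF _ m, of "fract_const c + ?w * eval_at ?w B'"] by auto
      also have "\<dots> \<longleftrightarrow> c = 0" by (rule O.const_mpow_1)
      also have "\<dots> \<longleftrightarrow> [:0, 1:] dvd B" using poly_eq_0_iff_dvd[of B 0] by (simp add: B)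
      finally show ?thesis .
    qed
    show "max_ideal Infinity = (\<lambda>z. eval_at ?w [:0, 1:] * z) ` local_ring Infinity"
      unfolding m1 O.mpow_def by simp
    show "\<exists>A. z - eval_at ?w A \<in> max_ideal Infinity" if z: "z \<in> local_ring Infinity" for z
    proof -
      obtain c where "z - fract_const c \<in> O.mpow 1" by (rule residue_Infinity_mpow[OF z])
      then show ?thesis unfolding m1 by (intro exI[of _ "[:c:]"]) simp
    qed
  qed
  then interpret nisnevich Infinity ?w "[:0, 1:]" .
  obtain k where k: "p = Suc (Suc (Suc k))" by (rule p_cases)
  have exps: "2 * p - 4 = k + k + 2" "p - 3 = k" by (simp_all add: k)
  have y_powers: "y ^ p = y ^ Suc k * y\<^sup>2" "y ^ (k + k + 2) = y ^ Suc k * y ^ Suc k"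
    by (simp_all add: k power2_eq_square power_add)
  \<comment> \<open>The sign of v cancels that of d(1/y), so that v w' = y^(2p-6) is a square. The
    section then becomes a polynomial in w, and the correction g can be 0.\<close>
  let ?v = "- (y ^ (2 * p - 4))" and ?\<sigma> = "?w ^ Suc k * (- \<epsilon>)"
  let ?A = "monom 1 (Suc k) * (monom t p - 1)"
  have order: "?\<sigma> \<in> O.mpow m \<longleftrightarrow> m \<le> Suc k" for m
    by (rule O.unif_power_unit_mpow[OF O.unit_uminus[OF unit_Infinity]])
  show "\<exists>w. computes_index (hom_cotangent f) N 1 (d_section f) Infinity w"
  proof (rule computes_index_exists)
    show "compatible_trivialization (hom_cotangent f) N 1 Infinity ?w ?v"
      unfolding compatible_trivialization_def
    proof (intro conjI)
      show "?v \<noteq> 0" by simp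
      show "hom_cotangent f Infinity = (\<lambda>z. ?v * z) ` local_ring Infinity"
        unfolding V_Infinity
      proof (rule O.multiples_eq_iff[THEN iffD2])
        show "\<exists>u. O.unit u \<and> ?v = y ^ (2 * p - 4) * u"
          using O.unit_uminus[OF O.unit_1] by (intro exI[of _ "- 1"]) simp
      qed simp
      show "\<exists>l\<in>N Infinity. 1 * (?v * fract_deriv ?w) = l * l"
      proof (rule bexI)
        show "y ^ k * 1 \<in> N Infinity" unfolding N_def exps by (simp add: O.one_mem)
        show "1 * (?v * fract_deriv ?w) = (y ^ k * 1) * (y ^ k * 1)"
          unfolding exps fract_deriv_inverse_var by (simp add: power_add power2_eq_square field_simps)
      qed
    qed
    show "d_section f = ?\<sigma> * ?v"
    proof -
      have aux: "Y * s * a / s = inverse Y * (- a) * (- (Y * Y))" if "Y \<noteq> 0" "s \<noteq> 0"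
        for Y s a :: "'l poly fract" using that by simp
      show ?thesis
        unfolding d_section_f to_fract_P_Infinity exps y_powers power_inverse by (rule aux) simp_all
    qed
    show "?\<sigma> \<in> max_ideal_pow Infinity (Suc k)" "?\<sigma> \<notin> max_ideal_pow Infinity (Suc (Suc k))"
      unfolding me order by simp_all
    show "(0 :: 'l poly fract) \<in> max_ideal_pow Infinity (2 * Suc k)" unfolding me by (rule O.mpow_zero)
    show "?\<sigma> + 0 = eval_at ?w ?A" by (simp add: \<epsilon>_def algebra_simps)
  qed simp
qed (rule computes_index_Infinity)

end

section \<open>Genus and degree\<close>

lemma vector_space_fract_scale: "vector_space (\<lambda>c z. fract_const c * z)"
  by standard (simp_all add: algebra_simps)

text \<open>A global differential has no finite poles, so it is a polynomial times dy; regularity at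
  infinity would ask that polynomial to have degree at most -2.\<close>

lemma genus_eq_0: "genus TYPE('l::field) = 0"
proof -
  interpret vs: vector_space "\<lambda>(c :: 'l) z. fract_const c * z" by (rule vector_space_fract_scale)
  have "z = 0" if z: "z \<in> (\<Inter>q \<in> closed_points. cotangent q)" for z :: "'l poly fract"
  proof (rule ccontr)
    assume nz: "z \<noteq> 0"
    obtain A B U V where AB: "z = Fract A B" "B \<noteq> 0" "U * A + V * B = 1" by (rule fract_coprime_repr)
    have "degree B = 0"
    proof (rule ccontr)
      assume "degree B \<noteq> 0"
      then obtain Q where Q: "irreducible Q" "lead_coeff Q = 1" "Q dvd B"
        using exists_irreducible_factor[of B] by blast
      then have "Finite Q \<in> closed_points" by (simp add: closed_points_def)
      then have "z \<in> local_ring (Finite Q)" using z cotangent_Finite[OF Q(1)] by blast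
      then show False using fract_mem_local_ring_Finite[OF Q(1) AB(2,3)] Q(3) AB(1) by blast
    qed
    have "Infinity \<in> (closed_points :: 'l poly point set)" by (simp add: closed_points_def)
    then have "z \<in> (\<lambda>z. inverse (fract_var\<^sup>2) * z) ` local_ring Infinity"
      using z cotangent_Infinity by blast
    then obtain C D where CD: "z = inverse (fract_var\<^sup>2) * Fract C D" "D \<noteq> 0" "degree C \<le> degree D"
      by (auto simp: local_ring.simps)
    have "Fract A B = Fract C ([:0, 0, 1:] * D)"
      using CD(1) unfolding AB(1) by (simp add: fract_var_def power2_eq_square)
    then have eq: "A * ([:0, 0, 1:] * D) = C * B" using AB(2) CD(2) by (simp add: eq_fract)
    have A0: "A \<noteq> 0" using nz AB(1) by (auto simp: Fract_conv_to_fract)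
    have "degree (A * ([:0, 0, 1:] * D)) = degree A + (2 + degree D)"
      using A0 CD(2) by (subst degree_mult_eq; simp add: degree_mult_eq del: mult_pCons_left)+
    moreover have "degree (C * B) \<le> degree D"
      using degree_mult_le[of C B] CD(3) \<open>degree B = 0\<close> by simp
    ultimately show False unfolding eq by simp
  qed
  moreover have "0 \<in> cotangent q" if "q \<in> closed_points" for q :: "'l poly point"
    using that
  proof (cases rule: closed_points_cases)
    case 1
    interpret dvr_over "local_ring Infinity" "inverse fract_var :: 'l poly fract" by (rule dvr_over_Infinity)
    show ?thesis unfolding 1 cotangent_Infinity by (rule image_eqI[of _ _ 0]) simp_all
  next
    case (2 Q)
    interpret dvr_over "local_ring (Finite Q)" "to_fract Q" by (rule dvr_over_Finite[OF 2(2)])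
    show ?thesis unfolding 2(1) cotangent_Finite[OF 2(2)] by (rule zero_mem)
  qed
  ultimately have eq: "(\<Inter>q \<in> closed_points. cotangent q) = {0 :: 'l poly fract}" by blast
  have "vs.dim {0} = card ({} :: 'l poly fract set)"
    by (rule vs.dim_eq_card) (simp_all add: vs.independent_empty)
  then show ?thesis unfolding genus_def eq by simp
qed

lemma euler_char_P1_eq: "euler_char_P1 = gw_h"
  by (simp add: euler_char_P1_def genus_eq_0 zmult_def)

lemma common_denominator:
  fixes r :: "nat \<Rightarrow> 'l::field poly fract"
  shows "\<exists>C a. C \<noteq> 0 \<and> (\<forall>i<n. r i * to_fract C = to_fract (a i))"
proof (induction n)
  case 0
  show ?case by (intro exI[of _ 1]) simp
next
  case (Suc n)
  then obtain C a where C: "C \<noteq> 0" "\<And>i. i < n \<Longrightarrow> r i * to_fract C = to_fract (a i)" by blast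
  obtain A B where AB: "B \<noteq> 0" "r n = to_fract A / to_fract B" by (rule fract_repr)
  show ?case
  proof (intro exI[of _ "C * B"] exI[of _ "\<lambda>i. if i = n then A * C else a i * B"] conjI allI impI)
    show "C * B \<noteq> 0" using C AB by simp
    fix i assume "i < Suc n"
    then consider "i < n" | "i = n" by linarith
    then show "r i * to_fract (C * B) = to_fract (if i = n then A * C else a i * B)"
    proof cases
      case 1
      then show ?thesis using C(2)[OF 1] by (simp add: mult.assoc[symmetric])
    next
      case 2
      then show ?thesis using AB by simp
    qed
  qed
qed

section \<open>The degree of f\<close>

context frobenius_quotient
begin

text \<open>At infinity the orders of the terms \<open>a\<^sub>i(f) y\<^sup>i\<close> are distinct, except that \<open>i = 0\<close> and \<open>i = p - 1\<close> may
  collide; the term \<open>i = 0\<close> is excluded first, at the point \<open>y = 0\<close>, where \<open>f\<close> has a simple pole.\<close>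

lemma eval_at_f_coeff_zero:
  assumes deg: "\<And>i. i < p \<Longrightarrow> degree (a i) \<le> D" and sum: "(\<Sum>i<p. eval_at f (a i) * y ^ i) = 0"
    and i: "i < p"
  shows "coeff (a i) D = 0"
proof -
  \<comment> \<open>Dividing by f^D makes the coefficients at s^D the values of b_i at both poles of
    f.\<close>
  define b where "b = (\<lambda>i. eval_at f (a i) / f ^ D)"
  have sb: "(\<Sum>i<p. b i * y ^ i) = 0"
  proof -
    have "(\<Sum>i<p. b i * y ^ i) = (\<Sum>i<p. eval_at f (a i) * y ^ i) / f ^ D"
      by (simp add: b_def sum_divide_distrib)
    then show ?thesis using sum by simp
  qed
  have c0: "coeff (a 0) D = 0"
  proof -
    interpret dvr_over "local_ring (Finite [:0, 1:])" "to_fract [:0, 1 :: 'l:]"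
      by (rule dvr_over_Finite[OF var_irreducible])
    have ex: "\<exists>z\<in>local_ring (Finite [:0, 1:]). b i = fract_const (coeff (a i) D) + inverse f * z" if "i < p" for i
      unfolding b_def by (rule eval_at_pole[OF f_nz mpow_mem[OF f_pole_zero] deg[OF that]])
    have mem: "b i \<in> local_ring (Finite [:0, 1:])" if "i < p" for i
      using ex[OF that] mpow_mem[OF f_pole_zero] by (auto intro!: add_mem mult_mem)
    obtain z where z: "z \<in> local_ring (Finite [:0, 1:])" "b 0 = fract_const (coeff (a 0) D) + inverse f * z"
      using ex[OF p_pos] by blast
    have "(\<Sum>i\<in>{..<p} - {0}. b i * y ^ i) \<in> mpow 1"
    proof (rule mpow_sum)
      fix i assume i: "i \<in> {..<p} - {0}"
      have "y ^ i \<in> mpow i" unfolding fract_var_conv by (rule unif_power_mpow)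
      then have "y ^ i \<in> mpow 1" using mpow_antimono[of 1 i] i by auto
      then show "b i * y ^ i \<in> mpow 1" using mem i by (intro mpow_mult_left) simp_all
    qed
    moreover have "(\<Sum>i<p. b i * y ^ i) = b 0 + (\<Sum>i\<in>{..<p} - {0}. b i * y ^ i)"
      using p_pos by (subst sum.remove[of _ 0]) simp_all
    ultimately have "- b 0 \<in> mpow 1" using sb by (metis minus_unique)
    then have "b 0 \<in> mpow 1" using mpow_uminus[of "- b 0" 1] by (simp only: minus_minus)
    moreover have "inverse f * z \<in> mpow 1" by (rule mpow_mult_right[OF f_pole_zero z(1)])
    ultimately have "b 0 - inverse f * z \<in> mpow 1" by (rule mpow_diff)
    then show ?thesis using z(2) const_mpow_1 by (simp del: One_nat_def)
  qed
  show ?thesis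
  proof (rule ccontr)
    assume ci: "coeff (a i) D \<noteq> 0"
    let ?S = "{i. i < p \<and> coeff (a i) D \<noteq> 0}"
    \<comment> \<open>The relation is multiplied by w^m. Terms with i < m gain w^(m-i); terms with i
      > m have zero top coefficient, so they carry 1/f of order p - 1, which outweighs y^(i-m)
      because m > 0. Only b_m is left, and it must vanish at infinity.\<close>
    define m where "m = Max ?S"
    have "finite ?S" "?S \<noteq> {}" using i ci by auto
    then have "m \<in> ?S" unfolding m_def by (rule Max_in)
    then have m: "m < p" "coeff (a m) D \<noteq> 0" "m > 0" using c0 by (auto intro: gr0I)
    have gt: "coeff (a i) D = 0" if "i < p" "m < i" for i
    proof (rule ccontr)
      assume "coeff (a i) D \<noteq> 0"
      then have "i \<le> m" unfolding m_def using \<open>finite ?S\<close> that by (intro Max_ge) auto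
      then show False using that by simp
    qed
    let ?w = "inverse y"
    interpret dvr_over "local_ring Infinity" ?w by (rule dvr_over_Infinity)
    have ex: "\<exists>z\<in>local_ring Infinity. b i = fract_const (coeff (a i) D) + inverse f * z" if "i < p" for i
      unfolding b_def by (rule eval_at_pole[OF f_nz mpow_mem[OF f_pole_Infinity] deg[OF that]])
    have mem: "b i \<in> local_ring Infinity" if "i < p" for i
      using ex[OF that] mpow_mem[OF f_pole_Infinity] by (auto intro!: add_mem mult_mem)
    have inv_f: "inverse f = ?w ^ (p - 1) * (- inverse \<epsilon>)"
    proof -
      obtain k where k: "p = Suc k" using p_pos gr0_conv_Suc by blast
      have "f = - (y ^ (p - 1) * \<epsilon>)" unfolding f_eq to_fract_P_Infinity by (simp add: k)
      then show ?thesis by (simp add: power_inverse)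
    qed
    have term_m: "b i * y ^ i * ?w ^ m \<in> mpow 1" if im: "i < p" "i \<noteq> m" for i
    proof (cases "i < m")
      case True
      then have "y ^ i * ?w ^ m = ?w ^ (m - i)"
        by (simp add: power_inverse power_diff field_simps)
      moreover have "?w ^ (m - i) \<in> mpow 1"
        by (rule subsetD[OF mpow_antimono unif_power_mpow]) (use True in simp)
      ultimately show ?thesis
        using mpow_mult_left[OF mem[OF that(1)]] by (simp only: mult.assoc)
    next
      case False
      then have mi: "m < i" using that by simp
      obtain z where z: "z \<in> local_ring Infinity" "b i = inverse f * z"
        using ex[OF im(1)] gt[OF im(1) mi] by auto
      have exps: "p - 1 + m = i + (p - 1 + m - i)" "p - 1 + m - i \<ge> 1" using that m(3) by simp_all
      have "?w ^ (p - 1) * (y ^ i * ?w ^ m) = ?w ^ (p - 1 + m) * y ^ i"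
        by (simp add: power_add mult_ac)
      also have "\<dots> = ?w ^ (p - 1 + m - i)"
        by (subst exps(1), subst power_add) (simp add: power_inverse)
      finally have "b i * y ^ i * ?w ^ m = ?w ^ (p - 1 + m - i) * (- inverse \<epsilon> * z)"
        unfolding z(2) inv_f by (metis (no_types, lifting) mult.assoc mult.commute)
      moreover have "?w ^ (p - 1 + m - i) \<in> mpow 1"
        by (rule subsetD[OF mpow_antimono[OF exps(2)] unif_power_mpow])
      moreover have "- inverse \<epsilon> * z \<in> local_ring Infinity"
        using unit_Infinity z(1) by (intro mult_mem uminus_mem) (simp_all add: unit_def)
      ultimately show ?thesis by (simp only: mpow_mult_right)
    qed
    have S: "(\<Sum>i\<in>{..<p} - {m}. b i * y ^ i * ?w ^ m) \<in> mpow 1"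
      using term_m by (intro mpow_sum) simp
    have "0 = b m + (\<Sum>i\<in>{..<p} - {m}. b i * y ^ i * ?w ^ m)"
    proof -
      have "0 = (\<Sum>i<p. b i * y ^ i) * ?w ^ m" using sb by simp
      also have "\<dots> = (\<Sum>i<p. b i * y ^ i * ?w ^ m)" by (rule sum_distrib_right)
      also have "\<dots> = b m * y ^ m * ?w ^ m + (\<Sum>i\<in>{..<p} - {m}. b i * y ^ i * ?w ^ m)"
        using m(1) by (subst sum.remove[of _ m]) simp_all
      also have "b m * y ^ m * ?w ^ m = b m" by (simp add: power_inverse)
      finally show ?thesis .
    qed
    then have "- b m = (\<Sum>i\<in>{..<p} - {m}. b i * y ^ i * ?w ^ m)" by (intro minus_unique) (rule sym)
    then have "- b m \<in> mpow 1" using S by (simp only:)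
    then have bm: "b m \<in> mpow 1" using mpow_uminus[of "- b m" 1] by (simp only: minus_minus)
    obtain z where z: "z \<in> local_ring Infinity" "b m = fract_const (coeff (a m) D) + inverse f * z"
      using ex[OF m(1)] by blast
    have "b m - inverse f * z \<in> mpow 1" by (intro mpow_diff bm mpow_mult_right[OF f_pole_Infinity z(1)])
    then show False using z(2) const_mpow_1 m(2) by (simp del: One_nat_def)
  qed
qed

text \<open>Each application of \<open>eval_at_f_coeff_zero\<close> kills the coefficients at the
  common degree bound, which therefore descends to 0.\<close>

lemma powers_independent_poly:
  assumes sum: "(\<Sum>i<p. eval_at f (a i) * y ^ i) = 0" and i: "i < p"
  shows "a i = 0"
proof -
  have "\<forall>i<p. a i = 0" if "\<And>i. i < p \<Longrightarrow> degree (a i) \<le> D" for D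
    using that
  proof (induction D)
    case 0
    then show ?case using eval_at_f_coeff_zero[of a 0, OF 0 sum]
      by (metis le_zero_eq leading_coeff_0_iff)
  next
    case (Suc D)
    have "degree (a i) \<le> D" if "i < p" for i
      using eval_at_f_coeff_zero[OF Suc.prems sum that] Suc.prems[OF that]
        leading_coeff_0_iff[of "a i"] by (cases "degree (a i) = Suc D") auto
    then show ?case by (rule Suc.IH)
  qed
  from this[of "Max ((\<lambda>i. degree (a i)) ` {..<p})"] i show ?thesis by (simp add: Max_ge)
qed

lemma powers_independent:
  assumes sum: "(\<Sum>i<p. pullback f (r i) * y ^ i) = 0" and i: "i < p"
  shows "r i = 0"
proof -
  obtain C a where C: "C \<noteq> 0" "\<And>i. i < p \<Longrightarrow> r i * to_fract C = to_fract (a i)"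
    using common_denominator[of p r] by blast
  have "eval_at f (a i) = pullback f (r i) * eval_at f C" if "i < p" for i
    using C(2)[OF that, symmetric] f_nonconstant by (metis pullback_mult pullback_to_fract)
  then have "(\<Sum>i<p. eval_at f (a i) * y ^ i) = (\<Sum>i<p. pullback f (r i) * y ^ i) * eval_at f C"
    by (simp add: sum_distrib_left sum_distrib_right mult_ac)
  then have "a i = 0" using sum i by (intro powers_independent_poly) simp_all
  then show "r i = 0" using C(1) C(2)[OF i] by simp
qed

lemma map_degree_f: "map_degree f = p"
proof -
  interpret vs: vector_space "\<lambda>r z. pullback f r * z"
    by standard (simp_all add: f_nonconstant algebra_simps)
  \<comment> \<open>The factor b is 1 for the basis itself; b = B gives a second independent family,
    used to invert a polynomial B.\<close>
  let ?b = "\<lambda>b i. b * y ^ i"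
  have inj: "inj_on (?b b) {..<p}" if "b \<noteq> 0" for b
  proof (rule inj_onI)
    fix i j assume "?b b i = ?b b j"
    then have "y ^ i = y ^ j" using that by simp
    then have "to_fract (monom 1 i :: 'l poly) = to_fract (monom 1 j)"
      by (simp add: monom_altdef fract_var_conv)
    then have "degree (monom 1 i :: 'l poly) = degree (monom 1 j :: 'l poly)" by (simp only: to_fract_eq_iff)
    then show "i = j" by (simp add: degree_monom_eq)
  qed
  have indep: "vs.independent (?b b ` {..<p})" if "b \<noteq> 0" for b
  proof
    assume "vs.dependent (?b b ` {..<p})"
    then obtain u i where u: "(\<Sum>v\<in>?b b ` {..<p}. pullback f (u v) * v) = 0" "i < p" "u (?b b i) \<noteq> 0"
      by (subst (asm) vs.dependent_finite) auto
    have "(\<Sum>v\<in>?b b ` {..<p}. pullback f (u v) * v) = b * (\<Sum>i<p. pullback f (u (?b b i)) * y ^ i)"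
      by (subst sum.reindex[OF inj[OF that]]) (simp add: sum_distrib_left mult_ac)
    then have "(\<Sum>i<p. pullback f (u (?b b i)) * y ^ i) = 0" using u(1) that by simp
    from powers_independent[OF this u(2)] u(3) show False by simp
  qed
  let ?S = "vs.span (?b 1 ` {..<p})"
  have basis: "y ^ i \<in> ?S" if "i < p" for i
    using that by (intro vs.span_base image_eqI[of _ _ i]) simp_all
  \<comment> \<open>The equation y^p = t - f y keeps the span closed under multiplication by
    y.\<close>
  have y_power: "y ^ p \<in> ?S"
  proof -
    have "pullback f (fract_const t) * y ^ 0 - pullback f fract_var * y ^ 1 \<in> ?S"
      using p_ge_3 by (intro vs.span_diff vs.span_scale basis) simp_all
    also have "pullback f (fract_const t) * y ^ 0 - pullback f fract_var * y ^ 1 = y ^ p"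
      by (simp add: f_nonconstant) (simp add: f_def)
    finally show ?thesis .
  qed
  have y_mult: "y * z \<in> ?S" if "z \<in> ?S" for z
    using that
  proof (rule vs.span_induct)
    show "vs.subspace {z. y * z \<in> ?S}"
    proof (rule vs.subspaceI)
      show "0 \<in> {z. y * z \<in> ?S}" by (simp add: vs.span_zero)
      show "z + w \<in> {z. y * z \<in> ?S}" if "z \<in> {z. y * z \<in> ?S}" "w \<in> {z. y * z \<in> ?S}" for z w
        using that vs.span_add by (simp add: distrib_left)
      show "pullback f r * z \<in> {z. y * z \<in> ?S}" if "z \<in> {z. y * z \<in> ?S}" for r z
        using that vs.span_scale[of "y * z" _ r] by (simp add: mult.left_commute)
    qed
    fix z assume "z \<in> ?b 1 ` {..<p}"
    then obtain i where i: "i < p" "z = y ^ i" by auto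
    show "y * z \<in> ?S"
    proof (cases "Suc i = p")
      case True
      then show ?thesis using y_power i(2) by auto
    next
      case False
      then show ?thesis using basis[of "Suc i"] i by simp
    qed
  qed
  have poly_mult: "to_fract A * z \<in> ?S" if "z \<in> ?S" for A z
    using that
  proof (induction A arbitrary: z)
    case 0
    then show ?case by (simp add: vs.span_zero)
  next
    case (pCons c A)
    have "pullback f (fract_const c) * z + to_fract A * (y * z) \<in> ?S"
      by (intro vs.span_add vs.span_scale pCons y_mult)
    then show ?case by (simp add: f_nonconstant to_fract_pCons algebra_simps)
  qed
  have one: "1 \<in> ?S" using basis[of 0] p_pos by simp
  have inverse: "inverse (to_fract B) \<in> ?S" if "B \<noteq> 0" for B
  proof -
    let ?C = "?b (to_fract B) ` {..<p}"
    have nz: "to_fract B \<noteq> 0" using that by simp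
    have sub: "?C \<subseteq> ?S" using poly_mult basis by auto
    have card: "card ?C = p" "card (?b 1 ` {..<p}) = p"
      using card_image[OF inj[OF nz]] card_image[OF inj[of 1]] by simp_all
    \<comment> \<open>The p independent elements B y^i lie in a span of p elements; if 1 were
      outside their span there would be p + 1 independent ones. Dividing by B then puts 1/B into the
      span of the powers of y.\<close>
    have "1 \<in> vs.span ?C"
    proof (rule ccontr)
      assume not_mem: "1 \<notin> vs.span ?C"
      then have "vs.independent (insert 1 ?C)" by (rule vs.independent_insertI[OF _ indep[OF nz]])
      moreover have "insert 1 ?C \<subseteq> ?S" using sub one by simp
      ultimately have "card (insert 1 ?C) \<le> card (?b 1 ` {..<p})"
        using vs.independent_span_bound[of "?b 1 ` {..<p}"] by blast
      moreover have "1 \<notin> ?C" using not_mem by (rule contrapos_nn) (rule vs.span_base)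
      then have "card (insert 1 ?C) = Suc (card ?C)" by (intro card_insert_disjoint) simp_all
      ultimately show False unfolding card by simp
    qed
    moreover have "inverse (to_fract B) * z \<in> ?S" if "z \<in> vs.span ?C" for z
      using that
    proof (rule vs.span_induct)
      show "vs.subspace {z. inverse (to_fract B) * z \<in> ?S}"
      proof (rule vs.subspaceI)
        show "0 \<in> {z. inverse (to_fract B) * z \<in> ?S}" by (simp add: vs.span_zero)
        show "z + w \<in> {z. inverse (to_fract B) * z \<in> ?S}"
          if "z \<in> {z. inverse (to_fract B) * z \<in> ?S}" "w \<in> {z. inverse (to_fract B) * z \<in> ?S}" for z w
          using that vs.span_add by (simp add: distrib_left)
        show "pullback f r * z \<in> {z. inverse (to_fract B) * z \<in> ?S}"
          if "z \<in> {z. inverse (to_fract B) * z \<in> ?S}" for r z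
          using that vs.span_scale[of "inverse (to_fract B) * z" _ r] by (simp add: mult.left_commute)
      qed
      fix z assume "z \<in> ?C"
      then obtain i where "i < p" "z = to_fract B * y ^ i" by auto
      then show "inverse (to_fract B) * z \<in> ?S" using basis nz by (simp add: mult.assoc[symmetric])
    qed
    ultimately have "inverse (to_fract B) * 1 \<in> ?S" by blast
    then show ?thesis by simp
  qed
  have "z \<in> ?S" for z
  proof -
    obtain A B where "B \<noteq> 0" "z = to_fract A / to_fract B" by (rule fract_repr)
    then show ?thesis using poly_mult[OF inverse] by (simp add: divide_inverse)
  qed
  then have "?S = UNIV" by blast
  then have "vs.dim UNIV = card (?b 1 ` {..<p})"
    using indep[of 1] by (intro vs.dim_eq_card) (simp_all add: vs.span_UNIV)
  then show ?thesis unfolding map_degree_def using card_image[OF inj[of 1]] by simp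
qed

lemma riemann_hurwitz:
  "euler_char_P1 = zmult (int (map_degree f)) euler_char_P1
    - (\<Sum>z \<in> zeros (hom_cotangent f) (d_section f). local_index (hom_cotangent f) N 1 (d_section f) z)"
proof -
  obtain k where k: "p = Suc (Suc (Suc k))" by (rule p_cases)
  obtain j where j: "k = 2 * j" using p_odd unfolding k by (auto elim: evenE)
  have add: "zmult (int a) h + zmult (int b) h = zmult (int (a + b)) h" for a b and h :: "'l gw"
    unfolding zmult_of_nat by (induction b) (simp_all add: add.assoc[symmetric])
  have one: "zmult (int 1) h = h" for h :: "'l gw" by (simp add: zmult_def)
  have "(\<Sum>z \<in> zeros (hom_cotangent f) (d_section f). local_index (hom_cotangent f) N 1 (d_section f) z)
      = zmult (int (Suc j)) gw_h + gw_unary 1 + (zmult (int j) gw_h + gw_unary (- 1))"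
    unfolding zeros_df using local_index_P local_index_Infinity by (simp add: k j)
  also have "\<dots> = zmult (int (Suc j)) gw_h + zmult (int j) gw_h + gw_h"
    by (simp add: gw_h_def algebra_simps)
  also have "\<dots> = zmult (int (Suc j + j)) gw_h + zmult (int 1) gw_h"
    unfolding one by (subst add) (rule refl)
  also have "\<dots> = zmult (int (Suc j + j + 1)) gw_h" by (rule add)
  finally have sum: "(\<Sum>z \<in> zeros (hom_cotangent f) (d_section f). local_index (hom_cotangent f) N 1 (d_section f) z)
      = zmult (int (Suc j + j + 1)) gw_h" .
  have p: "p = Suc j + j + 1 + 1" by (simp add: k j)
  have "zmult (int p) gw_h = zmult (int (Suc j + j + 1)) gw_h + (gw_h :: 'l gw)"
    unfolding p add[symmetric, of _ 1] one ..
  then show ?thesis unfolding euler_char_P1_eq map_degree_f sum by simp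
qed

end

lemma CHAR_fract: "CHAR('a::idom fract) = CHAR('a)"
proof (rule CHAR_eqI)
  have nat: "of_nat n = to_fract (of_nat n :: 'a)" for n by (simp add: to_fract_def of_nat_fract)
  show "of_nat CHAR('a) = (0 :: 'a fract)" by (simp add: nat)
  fix n assume "of_nat n = (0 :: 'a fract)"
  then show "CHAR('a) dvd n" by (simp add: nat of_nat_eq_0_iff_char_dvd)
qed

text \<open>Degrees: A^p = t B^p would give p deg A = 1 + p deg B.\<close>

lemma fract_var_not_power:
  assumes "p > 1" shows "\<nexists>c. c ^ p = (fract_var :: 'k::field poly fract)"
proof
  assume "\<exists>c. c ^ p = (fract_var :: 'k poly fract)"
  then obtain c where c: "c ^ p = (fract_var :: 'k poly fract)" by blast
  obtain A B where AB: "B \<noteq> 0" "c = to_fract A / to_fract B" by (rule fract_repr)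
  have "to_fract A = c * to_fract B" using AB by simp
  then have "to_fract (A ^ p) = fract_var * to_fract B ^ p" by (simp add: power_mult_distrib c)
  also have "\<dots> = to_fract ([:0, 1:] * B ^ p)" by (simp only: to_fract_mult to_fract_power fract_var_conv)
  finally have eq: "A ^ p = [:0, 1:] * B ^ p" by (simp only: to_fract_eq_iff)
  have A: "A \<noteq> 0"
  proof
    assume "A = 0"
    then show False using eq AB(1) assms by (simp add: power_0_left)
  qed
  have "degree (A ^ p) = degree ([:0, 1 :: 'k:] * B ^ p)" by (simp only: eq)
  also have "\<dots> = 1 + degree (B ^ p)"
    using AB(1) by (subst degree_mult_eq) simp_all
  finally have "p * degree A = 1 + p * degree B" using A AB(1) by (simp add: degree_power_eq)
  then have "p dvd 1 + p * degree B" by (metis dvd_triv_left)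
  then have "p dvd 1" using dvd_add_left_iff[of p "p * degree B" 1] by simp
  then show False using assms by simp
qed

theorem proposition3p1:
  fixes p :: nat
    and t :: "'k::field poly fract"
    and y f :: "'k poly fract poly fract"
    and q :: "'k poly fract poly point"
  assumes "CHAR('k) = p" and "odd p"
    and "t = fract_var" and "y = fract_var"
    and "f = (fract_const t - y ^ p) / y"
    and "q = Finite (monom 1 p - [:t:])"
  shows "\<exists>N c. relative_orientation (hom_cotangent f) N c \<and>
    local_index (hom_cotangent f) N c (d_section f) q
      = zmult (int ((p - 1) div 2)) gw_h + gw_unary 1 \<and>
    local_index (hom_cotangent f) N c (d_section f) Infinity
      = zmult (int ((p - 3) div 2)) gw_h + gw_unary (- 1) \<and>
    euler_char_P1 = zmult (int (map_degree f)) euler_char_P1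
      - (\<Sum>z \<in> zeros (hom_cotangent f) (d_section f).
           local_index (hom_cotangent f) N c (d_section f) z)"
proof -
  \<comment> \<open>Oddness excludes characteristic 0, and a positive characteristic of a field is
    prime.\<close>
  have "p > 0" using assms(2) by (rule odd_pos)
  then have prime: "prime p" using prime_CHAR_semidom[where 'a = 'k] assms(1) by simp
  interpret F: frobenius_quotient p t
  proof
    show "CHAR('k poly fract) = p" using assms(1) by (simp add: CHAR_fract)
    show "\<nexists>c. c ^ p = t"
      unfolding assms(3) by (rule fract_var_not_power) (rule prime_gt_1_nat[OF prime])
  qed (use prime assms(2) in simp_all)
  have "f = F.f" "q = Finite F.P" by (simp_all add: assms(4-6) F.f_def F.P_def)
  then show ?thesis
    using F.relative_orientation_N F.local_index_P F.local_index_Infinity F.riemann_hurwitz by blast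
qed

end
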